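(* Let $d\ge 2$ and let $r=r(n)\in[r_{\min},r_{\max}]$ where $r_g<r_{\min}\le r_{\max}$ are constants. For each $n\ge 4$ let $B_1,\dots,B_{2^dn}$ be axis-parallel cubes of side length $(\log n)^{2/d}$ covering $\Lambda_n^{(d)}$. Then with high probability as $n\to\infty$, for every $i$, the sum of the degrees (in $G$) of the vertices of $G$ lying in $B_i$ is less than $2\gamma_d r^d(\log n)^2$.
   Context: $\Lambda_n^{(d)}$ is the torus $\left[-\frac{n^{1/d}}{2},\frac{n^{1/d}}{2}\right]^d$ with the Euclidean metric; $G=G(\Lambda_n^{(d)},r(n))$ is the random geometric graph whose vertices form a Poisson point process of intensity $1$ on $\Lambda_n^{(d)}$, with edges between vertices at distance at most $r(n)$. $r_g$ is the critical radius above which $G$ has a giant component with high probability. $\gamma_d$ is the volume of the unit ball in $\mathbb{R}^d$. "With high probability" means with probability tending to $1$ as $n\to\infty$. *)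

theory Defs
  imports "HOL-Probability.Probability"
begin

definition side :: "'d::finite itself \<Rightarrow> nat \<Rightarrow> real" where
  "side _ n = real n powr (1 / real CARD('d))"

definition torus :: "nat \<Rightarrow> (real^'d::finite) set" where
  "torus n = {x. \<forall>i. - side TYPE('d) n / 2 \<le> x $ i \<and> x $ i \<le> side TYPE('d) n / 2}"

text \<open>Euclidean metric of the torus (coordinates identified modulo L).\<close>
definition tdist :: "nat \<Rightarrow> real^'d::finite \<Rightarrow> real^'d \<Rightarrow> real" where
  "tdist n x y = sqrt (\<Sum>i\<in>UNIV.
     (let L = side TYPE('d) n; t = \<bar>x $ i - y $ i\<bar> - L * real_of_int \<lfloor>\<bar>x $ i - y $ i\<bar> / L\<rfloor>
      in (min t (L - t))\<^sup>2))"

text \<open>Axis-parallel cube of side s with lower corner c, projected onto the torus.\<close>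
definition tcube :: "nat \<Rightarrow> real^'d::finite \<Rightarrow> real \<Rightarrow> (real^'d) set" where
  "tcube n c s = {x \<in> torus n. \<exists>k::int^'d. \<forall>i.
      c $ i \<le> x $ i + side TYPE('d) n * real_of_int (k $ i) \<and>
      x $ i + side TYPE('d) n * real_of_int (k $ i) \<le> c $ i + s}"

text \<open>Poisson point process of intensity 1 on the torus (volume n): the number of
  points N is Poisson(n), and the points are the first N entries of an i.i.d.
  sequence of uniform points of the torus. An outcome is a pair (N, points).\<close>
definition PPP :: "nat \<Rightarrow> (nat \<times> (real^'d::finite) stream) measure" where
  "PPP n = measure_pmf (poisson_pmf (real n)) \<Otimes>\<^sub>M
           stream_space (uniform_measure lborel (torus n))"

definition adj :: "nat \<Rightarrow> real \<Rightarrow> nat \<times> (real^'d::finite) stream \<Rightarrow> nat \<Rightarrow> nat \<Rightarrow> bool" where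
  "adj n r \<omega> j k \<longleftrightarrow> j < fst \<omega> \<and> k < fst \<omega> \<and> j \<noteq> k \<and>
     tdist n (snd \<omega> !! j) (snd \<omega> !! k) \<le> r"

definition degree :: "nat \<Rightarrow> real \<Rightarrow> nat \<times> (real^'d::finite) stream \<Rightarrow> nat \<Rightarrow> nat" where
  "degree n r \<omega> j = card {k. adj n r \<omega> j k}"

definition deg_sum :: "nat \<Rightarrow> real \<Rightarrow> nat \<times> (real^'d::finite) stream \<Rightarrow> (real^'d) set \<Rightarrow> nat" where
  "deg_sum n r \<omega> B = (\<Sum>j\<in>{j. j < fst \<omega> \<and> snd \<omega> !! j \<in> B}. degree n r \<omega> j)"

definition comp_size :: "nat \<Rightarrow> real \<Rightarrow> nat \<times> (real^'d::finite) stream \<Rightarrow> nat \<Rightarrow> nat" where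
  "comp_size n r \<omega> j = card {k. k < fst \<omega> \<and> (adj n r \<omega>)\<^sup>*\<^sup>* j k}"

definition has_giant :: "'d::finite itself \<Rightarrow> nat \<Rightarrow> real \<Rightarrow> real \<Rightarrow> nat \<times> (real^'d) stream \<Rightarrow> bool" where
  "has_giant _ n r c \<omega> \<longleftrightarrow> (\<exists>j < fst \<omega>. real (comp_size n r \<omega> j) \<ge> c * real n)"

definition r_g :: "'d::finite itself \<Rightarrow> real" where
  "r_g D = Inf {r. r > 0 \<and> (\<exists>c>0. (\<lambda>n. measure (PPP n :: (nat \<times> (real^'d) stream) measure)
              {\<omega> \<in> space (PPP n). has_giant D n r c \<omega>}) \<longlonglongrightarrow> 1)}"

definition gamma :: "'d::finite itself \<Rightarrow> real" where
  "gamma _ = measure lborel (ball (0::real^'d) 1)"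

end

theory Submission
  imports Defs "HOL-Combinatorics.Multiset_Permutations" "HOL-Real_Asymp.Real_Asymp"
begin

text \<open>
  Divide the torus into small cubic cells; the numbers of points in them are independent Poisson
  variables. If two points at distance at most \<open>r\<close> lie in the cells \<open>e\<close> and \<open>e'\<close>, then \<open>e' - e\<close> is one
  of about \<open>\<gamma> r^d / v\<close> offsets, \<open>v\<close> being the volume of a cell. So the degree sum over a cube is at
  most the sum over offsets \<open>z\<close> and over the cells \<open>e\<close> meeting the cube of the products
  \<open>N e * N (e + z)\<close>, with mean \<open>v^2\<close>. For a fixed offset these products split into two families of
  independent variables. With high probability no cell contains more than \<open>(log n) / C\<close> points, and the
  products truncated accordingly have bounded exponential moments of order \<open>C / log n\<close>. The Chernoff
  bound then gives a deviation by \<open>\<eta> (log n)^2\<close> the probability \<open>O(n^(-2))\<close>, which survives the union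
  bound over \<open>O(n)\<close> cubes and boundedly many offsets.

  The hypothesis \<open>r_g < r_min\<close> only yields \<open>r_min > 0\<close> once \<open>r_g\<close> is known to be an infimum over a
  nonempty set, that is, once a giant component is shown to exist for some radius. For large
  cells, most of them occupied, this follows by multiscale renormalisation.
\<close>

subsection \<open>Poisson counts in the cells of a grid\<close>

text \<open>The degree sum is quadratic in Poisson counts, so it has no exponential moments, and the
  truncation must be tied to the exponent. With \<open>lam = C / log n\<close> and
  \<open>T = (log n) / C\<close> one has \<open>lam * T = 1\<close>, so that in the exponent a
  product of two truncated counts is no larger than a single count. A cube meets of order
  \<open>(log n)^2\<close> cells, so the second-order term of the Chernoff exponent stays bounded,
  while a deviation \<open>t = \<eta> (log n)^2\<close> contributes
  \<open>lam * t = C * \<eta> * log n\<close>; this equals \<open>2 log n\<close> for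
  \<open>C = 2 / \<eta>\<close>, which is where the \<open>n^(-2)\<close> comes from.

  The cells can keep a size of constant order because the factor 2 in the claim leaves room:
  rounding distances to cells costs a factor 5/4, rounding the cube to cells a factor 6/5, the
  fluctuations add 1/4, and \<open>5/4 * 6/5 + 1/4 < 2\<close>.

  For the giant component one large radius is enough, so the cells can be taken so large that a
  crude count of vacant configurations beats all entropy.\<close>

definition cells :: "nat \<Rightarrow> (int^'d::finite) set" where
  "cells M = {c. \<forall>i. 0 \<le> c $ i \<and> c $ i < int M}"

text \<open>The clamping puts the points of the closed upper faces into the last cells, and makes the
  label total (points outside the torus form a null set).\<close>

definition cell :: "nat \<Rightarrow> nat \<Rightarrow> real^'d::finite \<Rightarrow> int^'d" where
  "cell n M x = (\<chi> i. max 0 (min (int M - 1)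
     \<lfloor>(x $ i + side TYPE('d) n / 2) * real M / side TYPE('d) n\<rfloor>))"

definition cnt :: "nat \<Rightarrow> nat \<Rightarrow> nat \<times> (real^'d::finite) stream \<Rightarrow> int^'d \<Rightarrow> nat" where
  "cnt n M \<omega> c = card {j. j < fst \<omega> \<and> cell n M (snd \<omega> !! j) = c}"

lemma vec_box_bij:
  "bij_betw (\<lambda>f. \<chi> i. f i) (PiE (UNIV::'d::finite set) A) {c::'a^'d. \<forall>i. c $ i \<in> A i}"
  by (rule bij_betw_byWitness[where f' = "vec_nth"]) auto

lemma card_vec_box: "card {c::'a^'d::finite. \<forall>i. c $ i \<in> A i} = (\<Prod>i\<in>UNIV. card (A i))"
  using bij_betw_same_card[OF vec_box_bij[of A]] by (simp add: card_PiE)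

lemma finite_vec_box: "(\<And>i. finite (A i)) \<Longrightarrow> finite {c::'a^'d::finite. \<forall>i. c $ i \<in> A i}"
  using bij_betw_finite[OF vec_box_bij[of A]] by (simp add: finite_PiE)

lemma cells_alt: "cells M = {c::int^'d::finite. \<forall>i. c $ i \<in> {0..<int M}}"
  by (auto simp: cells_def)

lemma finite_cells [simp]: "finite (cells M :: (int^'d::finite) set)"
  unfolding cells_alt by (rule finite_vec_box) auto

lemma card_cells [simp]: "card (cells M :: (int^'d::finite) set) = M ^ CARD('d)"
  unfolding cells_alt by (subst card_vec_box) auto

lemma side_pos: "n > 0 \<Longrightarrow> side TYPE('d::finite) n > 0"
  by (simp add: side_def)

lemma side_power: "n > 0 \<Longrightarrow> side TYPE('d::finite) n ^ CARD('d) = real n"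
  by (simp add: side_def powr_realpow[symmetric] powr_powr)

lemma torus_cbox: "torus n = cbox (\<chi> i. - side TYPE('d) n / 2) (\<chi> i::'d::finite. side TYPE('d) n / 2)"
  by (auto simp: torus_def cbox_interval less_eq_vec_def)

lemma torus_iff:
  "x \<in> torus n \<longleftrightarrow> (\<forall>i. 0 \<le> x $ i + side TYPE('d::finite) n / 2 \<and> x $ i + side TYPE('d) n / 2 \<le> side TYPE('d) n)"
  for x :: "real^'d"
proof -
  have "- L / 2 \<le> t \<and> t \<le> L / 2 \<longleftrightarrow> 0 \<le> t + L / 2 \<and> t + L / 2 \<le> L" for t L :: real by argo
  then show ?thesis unfolding torus_def by auto
qed

lemma measure_torus: "n > 0 \<Longrightarrow> measure lborel (torus n :: (real^'d::finite) set) = real n"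
  using side_pos[where ?'d='d, of n] side_power[where ?'d='d, of n]
  unfolding torus_cbox
  by (subst content_cbox_cart) (auto simp: cbox_interval less_eq_vec_def)

lemma cell_in_cells: "M > 0 \<Longrightarrow> cell n M x \<in> cells M"
  by (auto simp: cell_def cells_def)

text \<open>Both bounds are non-strict because a point on an upper face has \<open>u = M\<close> and
  is assigned to the cell \<open>M - 1\<close>, whose closed upper face contains it.\<close>

lemma cell_bounds:
  fixes x :: "real^'d::finite"
  assumes "x \<in> torus n" "M > 0" "n > 0"
  defines "a \<equiv> side TYPE('d) n / real M"
  shows "a * real_of_int (cell n M x $ i) \<le> x $ i + side TYPE('d) n / 2"
    and "x $ i + side TYPE('d) n / 2 \<le> a * (real_of_int (cell n M x $ i) + 1)"
proof -
  define L where "L = side TYPE('d) n"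
  have L: "L > 0" using assms(3) by (simp add: L_def side_pos)
  have a: "a > 0" using L assms by (simp add: a_def L_def)
  define u where "u = (x $ i + L / 2) * real M / L"
  have xu: "x $ i + L / 2 = a * u" using L assms(2) by (simp add: u_def a_def L_def field_simps)
  have u0: "0 \<le> u" "u \<le> real M"
  proof -
    have "0 \<le> x $ i + L / 2" "x $ i + L / 2 \<le> L" using assms(1) by (auto simp: torus_iff L_def)
    then have "0 \<le> (x $ i + L / 2) / L" "(x $ i + L / 2) / L \<le> 1" using L by (auto simp: divide_simps)
    note le = this
    have "0 \<le> (x $ i + L / 2) / L * real M" "(x $ i + L / 2) / L * real M \<le> 1 * real M"
      by (rule mult_nonneg_nonneg[OF le(1)], simp) (rule mult_right_mono[OF le(2)], simp)
    then show "0 \<le> u" "u \<le> real M" by (auto simp: u_def)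
  qed
  have c: "cell n M x $ i = max 0 (min (int M - 1) \<lfloor>u\<rfloor>)" by (simp add: cell_def u_def L_def)
  have "real_of_int (cell n M x $ i) \<le> u \<and> u \<le> real_of_int (cell n M x $ i) + 1"
  proof (cases "\<lfloor>u\<rfloor> \<le> int M - 1")
    case True
    then have "cell n M x $ i = \<lfloor>u\<rfloor>" using u0 c by simp
    then show ?thesis by linarith
  next
    case False
    then have "cell n M x $ i = int M - 1" using u0 c assms(2) by simp
    moreover have "u = real M" using False u0 by linarith
    ultimately show ?thesis by simp
  qed
  then show "a * real_of_int (cell n M x $ i) \<le> x $ i + side TYPE('d) n / 2"
     "x $ i + side TYPE('d) n / 2 \<le> a * (real_of_int (cell n M x $ i) + 1)"
    unfolding L_def[symmetric] xu using a by (auto intro!: mult_left_mono)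
qed

lemma measurable_vec_nth_borel [measurable]: "(\<lambda>x::real^'d::finite. x $ i) \<in> borel_measurable borel"
  by (intro borel_measurable_continuous_onI continuous_intros)

lemma measurable_cell: "{x::real^'d::finite. cell n M x = c} \<in> sets borel"
proof -
  have "{x::real^'d. cell n M x = c} = (\<Inter>i\<in>UNIV. {x. max 0 (min (int M - 1)
     \<lfloor>(x $ i + side TYPE('d) n / 2) * real M / side TYPE('d) n\<rfloor>) = c $ i})"
    by (auto simp: cell_def vec_eq_iff)
  also have "\<dots> \<in> sets borel"
    by (intro sets.finite_INT) auto
  finally show ?thesis .
qed

section \<open>The uniform law on the torus and the probability of a cell\<close>

definition unif :: "nat \<Rightarrow> (real^'d::finite) measure" where "unif n = uniform_measure lborel (torus n)"

lemma emeasure_torus: "n > 0 \<Longrightarrow> emeasure lborel (torus n :: (real^'d::finite) set) = ennreal (real n)"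
  using measure_torus[where ?'d='d, of n] emeasure_lborel_cbox_finite
  by (metis emeasure_eq_ennreal_measure infinity_ennreal_def less_irrefl torus_cbox)

lemma torus_borel [measurable]: "torus n \<in> sets borel"
  unfolding torus_cbox by simp

lemma prob_space_unif: "n > 0 \<Longrightarrow> prob_space (unif n :: (real^'d::finite) measure)"
  unfolding unif_def by (intro prob_space_uniform_measure) (auto simp: emeasure_torus)

lemma sets_unif [simp, measurable_cong]: "sets (unif n) = sets borel" and space_unif [simp]: "space (unif n) = UNIV"
  by (auto simp: unif_def)

text \<open>A sandwich avoids any discussion of faces: within the torus the cell contains an open
  box and lies in the closed one, and the two have equal volume.\<close>

lemma prob_cell:
  fixes c :: "int^'d::finite"
  assumes "n > 0" "M > 0" "c \<in> cells M"
  shows "measure (unif n) {x::real^'d. cell n M x = c} = 1 / real M ^ CARD('d)"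
proof -
  define L where "L = side TYPE('d) n"
  have L: "L > 0" using assms(1) by (simp add: L_def side_pos)
  define a where "a = L / real M"
  have a: "a > 0" using L assms by (simp add: a_def)
  define lo where "lo = (\<chi> i. a * real_of_int (c $ i) - L / 2)"
  define hi where "hi = (\<chi> i. a * (real_of_int (c $ i) + 1) - L / 2)"
  let ?S = "torus n \<inter> {x::real^'d. cell n M x = c}"
  have lh: "lo $ i < hi $ i" for i using a by (simp add: lo_def hi_def)
  have sub1: "box lo hi \<subseteq> ?S"
  proof
    fix x assume x: "x \<in> box lo hi"
    have b: "a * real_of_int (c $ i) < x $ i + L/2" "x $ i + L/2 < a * (real_of_int (c $ i) + 1)" for i
      using x by (auto simp: mem_box_cart lo_def hi_def algebra_simps)
    have ci: "0 \<le> c $ i" "c $ i + 1 \<le> int M" for i using assms(3) by (auto simp: cells_def add1_zle_eq)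
    have "cell n M x $ i = c $ i" for i
    proof -
      have "(x $ i + L / 2) * real M / L = (x $ i + L/2) / a" by (simp add: a_def)
      moreover have "real_of_int (c $ i) < (x $ i + L/2) / a" "(x $ i + L/2) / a < real_of_int (c $ i) + 1"
        using b[of i] a by (auto simp: field_simps)
      ultimately have "\<lfloor>(x $ i + L / 2) * real M / L\<rfloor> = c $ i" by linarith
      then show ?thesis using ci[of i] by (simp add: cell_def L_def)
    qed
    moreover have "0 \<le> x $ i + L/2 \<and> x $ i + L/2 \<le> L" for i
    proof
      have "0 \<le> a * real_of_int (c $ i)" using a ci[of i] by simp
      then show "0 \<le> x $ i + L/2" using b(1)[of i] by linarith
      have "a * (real_of_int (c $ i) + 1) \<le> a * real M"
        using a ci(2)[of i] by (intro mult_left_mono) linarith+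
      also have "\<dots> = L" using assms(2) by (simp add: a_def)
      finally show "x $ i + L/2 \<le> L" using b(2)[of i] by linarith
    qed
    ultimately show "x \<in> ?S" by (auto simp: vec_eq_iff torus_iff L_def)
  qed
  have sub2: "?S \<subseteq> cbox lo hi"
    using cell_bounds[of _ n M] assms
    by (auto simp: mem_box_cart lo_def hi_def a_def L_def field_simps) 
  have S: "?S \<in> sets lborel" using measurable_cell[of n M c] by auto
  have prod: "(\<Prod>i\<in>UNIV. hi $ i - lo $ i) = a ^ CARD('d)"
    by (simp add: lo_def hi_def algebra_simps)
  have ce: "emeasure lborel (cbox lo hi) = ennreal (a ^ CARD('d))"
  proof -
    have "measure lborel (cbox lo hi) = a ^ CARD('d)"
      using content_cbox_cart[of lo hi] lh prod
      by (metis (mono_tags, lifting) empty_iff less_imp_le mem_box_cart(2) order_refl)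
    then show ?thesis using emeasure_lborel_cbox_finite[of lo hi]
      by (metis emeasure_eq_ennreal_measure infinity_ennreal_def less_irrefl)
  qed
  have be: "emeasure lborel (box lo hi) = ennreal (a ^ CARD('d))"
    using ce lh by (simp add: emeasure_lborel_cbox_eq emeasure_lborel_box_eq Basis_vec_def inner_axis)
  have Se: "emeasure lborel ?S = ennreal (a ^ CARD('d))"
    using emeasure_mono[OF sub1 S] emeasure_mono[OF sub2, of lborel] be ce by (simp add: antisym)
  have "emeasure (unif n) {x::real^'d. cell n M x = c} = emeasure lborel ?S / emeasure lborel (torus n :: (real^'d) set)"
    unfolding unif_def using measurable_cell[of n M c] by (subst emeasure_uniform_measure) auto
  also have "\<dots> = ennreal (a ^ CARD('d) / real n)"
    using assms a by (simp add: Se emeasure_torus divide_ennreal)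
  also have "a ^ CARD('d) / real n = 1 / real M ^ CARD('d)"
    using assms side_power[where ?'d='d, of n] by (simp add: a_def L_def power_divide)
  finally show ?thesis by (simp add: measure_def)
qed


text \<open>Finite-dimensional marginals of the i.i.d. sequence. The rectangle formula is that of
  the infinite product measure, of which the stream measure is the image under
  \<open>to_stream\<close>.\<close>

lemma emeasure_word:
  fixes A :: "nat \<Rightarrow> 'a set"
  assumes "prob_space N" and A: "\<And>j. A j \<in> sets N"
  shows "{s \<in> space (stream_space N). \<forall>j<K. s !! j \<in> A j} \<in> sets (stream_space N)"
    and "emeasure (stream_space N) {s \<in> space (stream_space N). \<forall>j<K. s !! j \<in> A j} = (\<Prod>j<K. emeasure N (A j))"
proof -
  interpret N: prob_space N by fact
  interpret P: product_prob_space "\<lambda>_::nat. N" UNIV ..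
  let ?E = "{s \<in> space (stream_space N). \<forall>j<K. s !! j \<in> A j}"
  show m: "?E \<in> sets (stream_space N)" using A by measurable
  have "emeasure (distr (PiM UNIV (\<lambda>_::nat. N)) (stream_space N) to_stream) ?E
      = emeasure (PiM UNIV (\<lambda>_::nat. N)) (to_stream -` ?E \<inter> space (PiM UNIV (\<lambda>_. N)))"
    by (rule emeasure_distr[OF measurable_to_stream m])
  then have "emeasure (stream_space N) ?E = emeasure (PiM UNIV (\<lambda>_::nat. N)) (to_stream -` ?E \<inter> space (PiM UNIV (\<lambda>_. N)))"
    by (simp only: stream_space_eq_distr[symmetric])
  also have "to_stream -` ?E \<inter> space (PiM UNIV (\<lambda>_. N)) = {x \<in> space (PiM UNIV (\<lambda>_::nat. N)). \<forall>j\<in>{..<K}. x j \<in> A j}"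
    by (auto simp: space_stream_space space_PiM to_stream_in_streams) (auto simp: to_stream_def)
  also have "emeasure (PiM UNIV (\<lambda>_::nat. N)) \<dots> = (\<Prod>j<K. emeasure N (A j))"
    using A by (subst P.emeasure_PiM_Collect) auto
  finally show "emeasure (stream_space N) ?E = (\<Prod>j<K. emeasure N (A j))" .
qed

section \<open>The Poisson process and the joint law of its cell counts\<close>

lemma PPP_unif: "PPP n = measure_pmf (poisson_pmf (real n)) \<Otimes>\<^sub>M stream_space (unif n)"
  by (simp add: PPP_def unif_def)

lemma space_PPP [simp]: "space (PPP n) = UNIV"
  by (simp add: PPP_unif space_pair_measure space_stream_space)

lemma prob_space_PPP: "n > 0 \<Longrightarrow> prob_space (PPP n)"
proof -
  assume "n > 0"
  then interpret U: prob_space "unif n" by (rule prob_space_unif)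
  interpret S: prob_space "stream_space (unif n)" by (rule U.prob_space_stream_space)
  interpret pair_prob_space "measure_pmf (poisson_pmf (real n))" "stream_space (unif n)" ..
  show ?thesis unfolding PPP_unif by (rule P.prob_space_axioms)
qed

lemma cnt_eq_count: "cnt n M \<omega> c = count (mset (map (cell n M) (stake (fst \<omega>) (snd \<omega>)))) c"
  for c :: "int^'d::finite"
proof -
  have "count (mset xs) c = card {i. i < length xs \<and> xs ! i = c}" for xs :: "(int^'d) list"
    unfolding count_mset count_list_eq_length_filter length_filter_conv_card by (simp add: eq_commute)
  also have "{i. i < length (map (cell n M) (stake (fst \<omega>) (snd \<omega>))) \<and> map (cell n M) (stake (fst \<omega>) (snd \<omega>)) ! i = c}
     = {j. j < fst \<omega> \<and> cell n M (snd \<omega> !! j) = c}" by auto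
  finally show ?thesis unfolding cnt_def ..
qed

lemma cnt_outside: "M > 0 \<Longrightarrow> c \<notin> cells M \<Longrightarrow> cnt n M \<omega> c = 0"
  using cell_in_cells by (auto simp: cnt_def)

text \<open>Poisson splitting. The counts equal \<open>f\<close> exactly when the number of points
  is \<open>K\<close>, the total of \<open>f\<close>, and the word of the first \<open>K\<close>
  cell labels is an arrangement of the multiset with multiplicities \<open>f\<close>. The number of
  such words is \<open>K!\<close> divided by the product of the \<open>f c!\<close>, each has
  probability \<open>M^(-d K)\<close>, and \<open>K!\<close> cancels against the Poisson weight of
  \<open>K\<close>, which leaves a product over the cells.\<close>

lemma cnt_singleton:
  fixes f :: "int^'d::finite \<Rightarrow> nat"
  assumes n: "n > 0" and M: "M > 0" and f: "\<And>c. c \<notin> cells M \<Longrightarrow> f c = 0"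
  shows "{\<omega>. cnt n M \<omega> = f} \<in> sets (PPP n)"
    and "emeasure (PPP n) {\<omega>. cnt n M \<omega> = f} =
      ennreal (pmf (Pi_pmf (cells M) 0 (\<lambda>_. poisson_pmf (real n / real M ^ CARD('d)))) f)"
proof -
  interpret U: prob_space "unif n :: (real^'d) measure" using n by (rule prob_space_unif)
  interpret S: prob_space "stream_space (unif n :: (real^'d) measure)" by (rule U.prob_space_stream_space)
  define A where "A = Abs_multiset f"
  have fpos: "c \<in> cells M" if "0 < f c" for c using f[of c] that by (metis less_numeral_extra(3))
  have "finite {c. 0 < f c}" by (rule finite_subset[OF _ finite_cells[of M]]) (use fpos in auto)
  then have cA: "count A = f" by (simp add: A_def count_Abs_multiset)
  have setA: "set_mset A \<subseteq> cells M" using fpos by (auto simp: set_mset_def cA)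
  have sizeA: "size A = (\<Sum>c\<in>cells M. f c)"
    unfolding size_multiset_overloaded_eq cA using setA
    by (intro sum.mono_neutral_left) (auto simp: not_in_iff cA)
  define K where "K = size A"
  define W where "W w = {s \<in> space (stream_space (unif n :: (real^'d) measure)). \<forall>j<K. s !! j \<in> {x. cell n M x = w ! j}}" for w
  let ?P = "permutations_of_multiset A"
  let ?q = "1 / real M ^ CARD('d)"
  have finP: "finite ?P" by simp
  have lenP: "length w = K" "set w \<subseteq> cells M" if "w \<in> ?P" for w
    using that setA by (auto simp: permutations_of_multiset_def K_def)
  have mW: "W w \<in> sets (stream_space (unif n))" for w
    unfolding W_def by (rule emeasure_word(1)) (use U.prob_space_axioms measurable_cell in auto)
  have eW: "emeasure (stream_space (unif n)) (W w) = ennreal (?q ^ K)" if "w \<in> ?P" for w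
  proof -
    have "emeasure (stream_space (unif n)) (W w) = (\<Prod>j<K. emeasure (unif n) {x::real^'d. cell n M x = w ! j})"
      unfolding W_def by (rule emeasure_word(2)) (use U.prob_space_axioms measurable_cell in auto)
    also have "\<dots> = (\<Prod>j<K. ennreal ?q)"
    proof (intro prod.cong refl)
      fix j assume "j \<in> {..<K}"
      then have "w ! j \<in> cells M" using lenP[OF that] by (auto dest!: nth_mem)
      then show "emeasure (unif n) {x::real^'d. cell n M x = w ! j} = ennreal ?q"
        using prob_cell[OF n M] by (simp add: U.emeasure_eq_measure)
    qed
    also have "\<dots> = ennreal (?q ^ K)" by (simp add: ennreal_power)
    finally show ?thesis .
  qed
  have iff: "cnt n M (N, s) = f \<longleftrightarrow> N = K \<and> s \<in> (\<Union>w\<in>?P. W w)" for N s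
  proof -
    have "cnt n M (N, s) = f \<longleftrightarrow> mset (map (cell n M) (stake N s)) = A"
      unfolding multiset_eq_iff cA by (auto simp: cnt_eq_count fun_eq_iff)
    also have "\<dots> \<longleftrightarrow> N = K \<and> mset (map (cell n M) (stake K s)) = A"
      by (auto simp: K_def)
    also have "mset (map (cell n M) (stake K s)) = A \<longleftrightarrow> s \<in> (\<Union>w\<in>?P. W w)"
    proof
      assume "mset (map (cell n M) (stake K s)) = A"
      then have "map (cell n M) (stake K s) \<in> ?P" by (simp add: permutations_of_multiset_def)
      moreover have "s \<in> W (map (cell n M) (stake K s))" by (auto simp: W_def space_stream_space)
      ultimately show "s \<in> (\<Union>w\<in>?P. W w)" by blast
    next
      assume "s \<in> (\<Union>w\<in>?P. W w)"
      then obtain w where w: "w \<in> ?P" "s \<in> W w" by blast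
      have "map (cell n M) (stake K s) = w"
        using w lenP[OF w(1)] by (intro nth_equalityI) (auto simp: W_def)
      then show "mset (map (cell n M) (stake K s)) = A" using w(1) by (simp add: permutations_of_multiset_def)
    qed
    finally show ?thesis .
  qed
  have eq: "{\<omega>. cnt n M \<omega> = f} = {K} \<times> (\<Union>w\<in>?P. W w)"
    using iff by auto
  have mU: "(\<Union>w\<in>?P. W w) \<in> sets (stream_space (unif n))"
    using mW finP by auto
  show "{\<omega>. cnt n M \<omega> = f} \<in> sets (PPP n)"
    unfolding eq PPP_unif using mU by (intro pair_measureI) auto
  have "disjoint_family_on W ?P"
  proof (unfold disjoint_family_on_def, intro ballI impI)
    fix w w' assume w: "w \<in> ?P" "w' \<in> ?P" "w \<noteq> w'"
    show "W w \<inter> W w' = {}"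
    proof (rule ccontr)
      assume "W w \<inter> W w' \<noteq> {}"
      then have "w = w'" using lenP[OF w(1)] lenP[OF w(2)] by (intro nth_equalityI) (auto simp: W_def)
      then show False using w by simp
    qed
  qed
  then have eU: "emeasure (stream_space (unif n)) (\<Union>w\<in>?P. W w) = ennreal (real (card ?P) * ?q ^ K)"
    using mW finP eW by (subst sum_emeasure[symmetric]) (auto simp: ennreal_mult' ennreal_of_nat_eq_real_of_nat)
  \<comment> \<open>The mean number of points per cell; as there are \<open>M^d\<close> cells,
    \<open>exp (- n)\<close> splits into one factor \<open>exp (- v)\<close> for each.\<close>
  define v where "v = real n / real M ^ CARD('d)"
  have v: "v > 0" using n M by (simp add: v_def)
  have "card ?P * (\<Prod>x\<in>set_mset A. fact (count A x)) = (fact (size A) :: nat)"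
    by (rule card_permutations_of_multiset_aux)
  also have "(\<Prod>x\<in>set_mset A. fact (count A x)) = (\<Prod>c\<in>cells M. fact (f c) :: nat)"
    using setA by (intro prod.mono_neutral_cong_left) (auto simp: not_in_iff cA)
  finally have "real (card ?P * (\<Prod>c\<in>cells M. fact (f c))) = real (fact K)" unfolding K_def by simp
  then have cP: "real (card ?P) * (\<Prod>c\<in>cells M. fact (f c)) = fact K" by simp
  have F0: "(\<Prod>c\<in>cells M. fact (f c) :: real) \<noteq> 0" by simp
  have "emeasure (PPP n) {\<omega>. cnt n M \<omega> = f} = ennreal (pmf (poisson_pmf (real n)) K) * ennreal (real (card ?P) * ?q ^ K)"
    unfolding eq PPP_unif using mU by (simp add: S.emeasure_pair_measure_Times eU emeasure_pmf_single)
  also have "\<dots> = ennreal (real n ^ K / fact K * exp (- real n) * (real (card ?P) * ?q ^ K))"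
    using n by (subst ennreal_mult[symmetric]) simp_all
  also have "real n ^ K / fact K * exp (- real n) * (real (card ?P) * ?q ^ K)
      = v ^ K * exp (- real n) * (real (card ?P) / fact K)"
    by (simp add: v_def power_divide power_one_over)
  also have "real (card ?P) / fact K = 1 / (\<Prod>c\<in>cells M. fact (f c))"
    using cP F0 by (simp add: field_simps)
  also have "v ^ K = (\<Prod>c\<in>cells M. v ^ f c)" by (simp add: K_def sizeA power_sum)
  also have "exp (- real n) = (\<Prod>c\<in>(cells M :: (int^'d) set). exp (- v))"
    using M by (simp add: exp_of_nat_mult[symmetric] v_def)
  also have "(\<Prod>c\<in>cells M. v ^ f c) * (\<Prod>c\<in>(cells M :: (int^'d) set). exp (- v)) * (1 / (\<Prod>c\<in>cells M. fact (f c)))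
     = (\<Prod>c\<in>cells M. pmf (poisson_pmf v) (f c))"
    using v by (simp add: prod.distrib prod_dividef)
  also have "\<dots> = pmf (Pi_pmf (cells M) 0 (\<lambda>_. poisson_pmf v)) f"
    using f by (subst pmf_Pi') auto
  finally show "emeasure (PPP n) {\<omega>. cnt n M \<omega> = f} = ennreal (pmf (Pi_pmf (cells M) 0 (\<lambda>_. poisson_pmf (real n / real M ^ CARD('d)))) f)"
    unfolding v_def .
qed

lemma countable_support_functions:
  assumes "finite A"
  shows "countable {f :: 'a \<Rightarrow> nat. \<forall>c. c \<notin> A \<longrightarrow> f c = 0}"
proof -
  have "{f :: 'a \<Rightarrow> nat. \<forall>c. c \<notin> A \<longrightarrow> f c = 0} \<subseteq> (\<lambda>g c. if c \<in> A then g c else 0) ` (PiE A (\<lambda>_. UNIV))"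
  proof
    fix f :: "'a \<Rightarrow> nat" assume "f \<in> {f. \<forall>c. c \<notin> A \<longrightarrow> f c = 0}"
    then have "f = (\<lambda>c. if c \<in> A then restrict f A c else 0)" by auto
    then show "f \<in> (\<lambda>g c. if c \<in> A then g c else 0) ` (PiE A (\<lambda>_. UNIV))"
      by (intro image_eqI[where x = "restrict f A"]) auto
  qed
  moreover have "countable (PiE A (\<lambda>_. UNIV :: nat set))" using assms by (intro countable_PiE) auto
  ultimately show ?thesis by (meson countable_image countable_subset)
qed

text \<open>Counts vanish off finitely many cells, so only countably many count functions occur, and
  the event of an arbitrary \<open>Q\<close> is a countable union of singleton events.\<close>

lemma cnt_law:
  fixes Q :: "(int^'d::finite \<Rightarrow> nat) \<Rightarrow> bool"
  assumes n: "n > 0" and M: "M > 0"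
  shows "{\<omega>. Q (cnt n M \<omega>)} \<in> sets (PPP n)"
    and "measure (PPP n) {\<omega>. Q (cnt n M \<omega>)} =
      measure_pmf.prob (Pi_pmf (cells M) 0 (\<lambda>_. poisson_pmf (real n / real M ^ CARD('d)))) {f. Q f}"
proof -
  let ?p = "Pi_pmf (cells M) 0 (\<lambda>_. poisson_pmf (real n / real M ^ CARD('d))) :: (int^'d \<Rightarrow> nat) pmf"
  define F where "F = {f :: int^'d \<Rightarrow> nat. (\<forall>c. c \<notin> cells M \<longrightarrow> f c = 0) \<and> Q f}"
  have cF: "countable F" unfolding F_def
    by (rule countable_subset[OF _ countable_support_functions[OF finite_cells]]) auto
  have eq: "{\<omega>. Q (cnt n M \<omega>)} = (\<Union>f\<in>F. {\<omega>. cnt n M \<omega> = f})"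
    using cnt_outside[OF M] by (auto simp: F_def)
  have s: "{\<omega>. cnt n M \<omega> = f} \<in> sets (PPP n)" if "f \<in> F" for f
    using cnt_singleton(1)[OF n M] that by (auto simp: F_def)
  show "{\<omega>. Q (cnt n M \<omega>)} \<in> sets (PPP n)"
    unfolding eq using s by (intro sets.countable_UN'[OF cF]) auto
  have "emeasure (PPP n) {\<omega>. Q (cnt n M \<omega>)} = (\<integral>\<^sup>+f. emeasure (PPP n) {\<omega>. cnt n M \<omega> = f} \<partial>count_space F)"
    unfolding eq using s cF by (intro emeasure_UN_countable) (auto simp: disjoint_family_on_def)
  also have "\<dots> = (\<integral>\<^sup>+f. emeasure ?p {f} \<partial>count_space F)"
    using cnt_singleton(2)[OF n M] by (intro nn_integral_cong) (auto simp: F_def emeasure_pmf_single)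
  also have "\<dots> = emeasure ?p (\<Union>f\<in>F. {f})"
    using cF by (intro emeasure_UN_countable[symmetric]) (auto simp: disjoint_family_on_def)
  also have "\<dots> = emeasure ?p {f. Q f}"
    using set_Pi_pmf_subset[OF finite_cells, of M 0 "\<lambda>_. poisson_pmf (real n / real M ^ CARD('d))"]
    by (intro emeasure_eq_AE) (auto simp: AE_measure_pmf_iff F_def)
  finally show "measure (PPP n) {\<omega>. Q (cnt n M \<omega>)} = measure_pmf.prob ?p {f. Q f}"
    by (simp add: measure_def)
qed

subsection \<open>Tail bounds for independent Poisson variables\<close>

text \<open>Under a \<open>pmf\<close> every function is measurable, so independence of two
  functionals reduces to their reading disjoint sets of coordinates.\<close>

definition depends_on :: "'a set \<Rightarrow> (('a \<Rightarrow> 'b) \<Rightarrow> 'c) \<Rightarrow> bool" where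
  "depends_on K h \<longleftrightarrow> (\<forall>f g. (\<forall>x\<in>K. f x = g x) \<longrightarrow> h f = h g)"

lemma nn_integral_Pi_pmf_split:
  fixes h g :: "('a \<Rightarrow> 'b) \<Rightarrow> ennreal"
  assumes A: "finite A" "K \<subseteq> A" and h: "depends_on K h" and g: "depends_on (A - K) g"
  shows "(\<integral>\<^sup>+f. h f * g f \<partial>Pi_pmf A d p) = (\<integral>\<^sup>+f. h f \<partial>Pi_pmf A d p) * (\<integral>\<^sup>+f. g f \<partial>Pi_pmf A d p)"
proof -
  have fin: "finite K" "finite (A - K)" using A by (auto dest: finite_subset)
  have key: "(\<integral>\<^sup>+f. h f * g f \<partial>Pi_pmf A d p) = (\<integral>\<^sup>+f. h f \<partial>Pi_pmf K d p) * (\<integral>\<^sup>+f. g f \<partial>Pi_pmf (A - K) d p)"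
    if h: "depends_on K h" and g: "depends_on (A - K) g" for h g :: "('a \<Rightarrow> 'b) \<Rightarrow> ennreal"
  proof -
    have "A = K \<union> (A - K)" using A by blast
    then have "Pi_pmf A d p = map_pmf (\<lambda>(f,g) x. if x \<in> K then f x else g x) (pair_pmf (Pi_pmf K d p) (Pi_pmf (A - K) d p))"
      using Pi_pmf_union[of K "A - K" d p] fin by auto
    then have "(\<integral>\<^sup>+f. h f * g f \<partial>Pi_pmf A d p)
      = (\<integral>\<^sup>+a. \<integral>\<^sup>+b. h (\<lambda>x. if x \<in> K then a x else b x) * g (\<lambda>x. if x \<in> K then a x else b x)
           \<partial>Pi_pmf (A - K) d p \<partial>Pi_pmf K d p)"
      by (simp add: nn_integral_pair_pmf')
    also have "\<dots> = (\<integral>\<^sup>+a. \<integral>\<^sup>+b. h a * g b \<partial>Pi_pmf (A - K) d p \<partial>Pi_pmf K d p)"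
    proof (intro nn_integral_cong)
      fix a b
      have "h (\<lambda>x. if x \<in> K then a x else b x) = h a"
        by (rule h[unfolded depends_on_def, rule_format]) auto
      moreover have "g (\<lambda>x. if x \<in> K then a x else b x) = g b"
        by (rule g[unfolded depends_on_def, rule_format]) auto
      ultimately show "h (\<lambda>x. if x \<in> K then a x else b x) * g (\<lambda>x. if x \<in> K then a x else b x) = h a * g b" by simp
    qed
    finally show ?thesis by (simp add: nn_integral_cmult nn_integral_multc)
  qed
  \<comment> \<open>With one factor constantly 1, \<open>key\<close> identifies each marginal
    integral with an integral under the full law.\<close>
  have one: "depends_on S (\<lambda>_. 1 :: ennreal)" for S :: "'a set" by (simp add: depends_on_def)
  show ?thesis
    using key[OF h g] key[OF h one] key[OF one g] by simp
qed

lemma nn_integral_Pi_pmf_prod: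
  fixes h :: "'i \<Rightarrow> ('a \<Rightarrow> 'b) \<Rightarrow> ennreal"
  assumes "finite A" "finite I" "\<And>i. i \<in> I \<Longrightarrow> K i \<subseteq> A" "disjoint_family_on K I"
    "\<And>i. i \<in> I \<Longrightarrow> depends_on (K i) (h i)"
  shows "(\<integral>\<^sup>+f. (\<Prod>i\<in>I. h i f) \<partial>Pi_pmf A d p) = (\<Prod>i\<in>I. \<integral>\<^sup>+f. h i f \<partial>Pi_pmf A d p)"
  using assms(2-)
proof (induction I rule: finite_induct)
  case (insert i I)
  have "depends_on (A - K i) (\<lambda>f. \<Prod>j\<in>I. h j f)"
    unfolding depends_on_def
  proof (intro allI impI prod.cong refl)
    fix f g :: "'a \<Rightarrow> 'b" and j assume fg: "\<forall>x\<in>A - K i. f x = g x" and j: "j \<in> I"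
    have "K j \<subseteq> A - K i"
      using insert.prems(1)[of j] insert.prems(2) insert.hyps j by (auto simp: disjoint_family_on_def)
    then show "h j f = h j g" using insert.prems(3)[of j] fg j unfolding depends_on_def by blast
  qed
  then have "(\<integral>\<^sup>+f. h i f * (\<Prod>j\<in>I. h j f) \<partial>Pi_pmf A d p)
     = (\<integral>\<^sup>+f. h i f \<partial>Pi_pmf A d p) * (\<integral>\<^sup>+f. (\<Prod>j\<in>I. h j f) \<partial>Pi_pmf A d p)"
    using insert.prems assms(1) by (intro nn_integral_Pi_pmf_split) auto
  also have "(\<integral>\<^sup>+f. (\<Prod>j\<in>I. h j f) \<partial>Pi_pmf A d p) = (\<Prod>i\<in>I. \<integral>\<^sup>+f. h i f \<partial>Pi_pmf A d p)"
    using insert.prems by (intro insert.IH) (auto simp: disjoint_family_on_def)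
  finally show ?case using insert.hyps by simp
qed simp

lemma nn_integral_Pi_pmf_component:
  "finite A \<Longrightarrow> x \<in> A \<Longrightarrow> (\<integral>\<^sup>+f. g (f x) \<partial>Pi_pmf A d p) = (\<integral>\<^sup>+k. g k \<partial>p x)"
  using Pi_pmf_component[of A x d p] nn_integral_map_pmf[of "\<lambda>f. f x" "Pi_pmf A d p" g] by simp

lemma nn_integral_Pi_pmf_two:
  assumes "finite A" "x \<in> A" "y \<in> A" "x \<noteq> y"
  shows "(\<integral>\<^sup>+f. g (f x) * h (f y) \<partial>Pi_pmf A d p) = (\<integral>\<^sup>+k. g k \<partial>p x) * (\<integral>\<^sup>+k. h k \<partial>p y)"
  using nn_integral_Pi_pmf_split[of A "{x}" "\<lambda>f. g (f x)" "\<lambda>f. h (f y)" d p] assms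
  by (simp add: depends_on_def nn_integral_Pi_pmf_component)

text \<open>Markov's inequality for the exponential of the sum. The moment bound is asked at a
  single value of \<open>lam\<close>, since the truncation of the variables will be tied to that
  value.\<close>

lemma Pi_pmf_chernoff:
  fixes X :: "'i \<Rightarrow> ('a \<Rightarrow> 'b) \<Rightarrow> real"
  assumes "finite A" "finite I" "\<And>i. i \<in> I \<Longrightarrow> K i \<subseteq> A" "disjoint_family_on K I"
    "\<And>i. i \<in> I \<Longrightarrow> depends_on (K i) (X i)" "lam \<ge> 0"
    "\<And>i. i \<in> I \<Longrightarrow> (\<integral>\<^sup>+f. ennreal (exp (lam * X i f)) \<partial>Pi_pmf A d p) \<le> ennreal (exp (lam * m + lam\<^sup>2 * C))"
  shows "measure_pmf.prob (Pi_pmf A d p) {f. (\<Sum>i\<in>I. X i f) \<ge> real (card I) * m + t}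
     \<le> exp (- lam * t + lam\<^sup>2 * real (card I) * C)"
proof -
  define q where "q = Pi_pmf A d p"
  define u where "u f = ennreal (exp (lam * (\<Sum>i\<in>I. X i f)))" for f
  define c where "c = exp (- lam * (real (card I) * m + t))"
  have "emeasure q {f. (\<Sum>i\<in>I. X i f) \<ge> real (card I) * m + t} \<le> emeasure q {f \<in> UNIV. 1 \<le> ennreal c * u f}"
  proof (rule emeasure_mono)
    show "{f. (\<Sum>i\<in>I. X i f) \<ge> real (card I) * m + t} \<subseteq> {f \<in> UNIV. 1 \<le> ennreal c * u f}"
    proof
      fix f assume "f \<in> {f. (\<Sum>i\<in>I. X i f) \<ge> real (card I) * m + t}"
      then have "lam * (real (card I) * m + t) \<le> lam * (\<Sum>i\<in>I. X i f)"
        using assms(6) by (intro mult_left_mono) auto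
      then have "1 \<le> c * exp (lam * (\<Sum>i\<in>I. X i f))"
        by (simp add: c_def exp_add[symmetric])
      then show "f \<in> {f \<in> UNIV. 1 \<le> ennreal c * u f}"
        by (simp add: u_def ennreal_mult[symmetric] c_def)
    qed
  qed auto
  also have "\<dots> \<le> ennreal c * (\<integral>\<^sup>+f. u f * indicator UNIV f \<partial>q)"
    by (rule nn_integral_Markov_inequality) auto
  also have "\<dots> \<le> ennreal c * ennreal (exp (real (card I) * (lam * m + lam\<^sup>2 * C)))"
  proof (rule mult_left_mono)
    have "(\<integral>\<^sup>+f. u f * indicator UNIV f \<partial>q) = (\<integral>\<^sup>+f. (\<Prod>i\<in>I. ennreal (exp (lam * X i f))) \<partial>q)"
      using assms(2) by (simp add: u_def prod_ennreal sum_distrib_left exp_sum)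
    also have "\<dots> = (\<Prod>i\<in>I. \<integral>\<^sup>+f. ennreal (exp (lam * X i f)) \<partial>q)"
      unfolding q_def using assms(1-5)
      by (intro nn_integral_Pi_pmf_prod[where K = K]) (auto simp: depends_on_def)
    also have "\<dots> \<le> (\<Prod>i\<in>I. ennreal (exp (lam * m + lam\<^sup>2 * C)))"
      unfolding q_def by (rule prod_mono_ennreal) (rule assms(7))
    also have "\<dots> = ennreal (exp (real (card I) * (lam * m + lam\<^sup>2 * C)))"
      by (simp add: ennreal_power exp_of_nat_mult)
    finally show "(\<integral>\<^sup>+f. u f * indicator UNIV f \<partial>q) \<le> ennreal (exp (real (card I) * (lam * m + lam\<^sup>2 * C)))" .
  qed simp
  also have "\<dots> = ennreal (exp (- lam * t + lam\<^sup>2 * real (card I) * C))"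
    by (simp add: c_def ennreal_mult[symmetric] exp_add[symmetric] algebra_simps)
  finally have "emeasure q {f. (\<Sum>i\<in>I. X i f) \<ge> real (card I) * m + t} \<le> ennreal (exp (- lam * t + lam\<^sup>2 * real (card I) * C))"
    .
  then show ?thesis unfolding q_def
    by (simp add: measure_pmf.emeasure_eq_measure)
qed

section \<open>Moments of the Poisson law and tail bounds for pair products\<close>

lemma nn_integral_poisson:
  assumes "v > 0" "\<And>k. g k \<ge> 0" "(\<lambda>k. v ^ k / fact k * g k) sums s"
  shows "(\<integral>\<^sup>+k. ennreal (g k) \<partial>poisson_pmf v) = ennreal (exp (- v) * s)"
proof -
  have "(\<integral>\<^sup>+k. ennreal (g k) \<partial>poisson_pmf v) = (\<Sum>k. ennreal (exp (- v) * (v ^ k / fact k * g k)))"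
    using assms by (simp add: nn_integral_measure_pmf nn_integral_count_space_nat ennreal_mult[symmetric] mult_ac)
  also have "\<dots> = ennreal (exp (- v) * s)"
    using assms sums_mult[OF assms(3), of "exp (- v)"] by (intro suminf_ennreal_eq) auto
  finally show ?thesis .
qed

lemma exp_sums_real: "(\<lambda>k. (x::real) ^ k / fact k) sums exp x"
  using exp_converges[of x] by (simp add: divide_inverse mult.commute)

lemma nn_integral_poisson_exp:
  assumes "v > 0"
  shows "(\<integral>\<^sup>+k. ennreal (exp (s * real k)) \<partial>poisson_pmf v) = ennreal (exp (v * (exp s - 1)))"
proof -
  have "(\<lambda>k. v ^ k / fact k * exp (s * real k)) sums exp (v * exp s)"
    using exp_sums_real[of "v * exp s"]
    by (simp add: power_mult_distrib exp_of_nat_mult mult.commute[of s])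
  from nn_integral_poisson[OF assms _ this] show ?thesis
    by (simp add: exp_add[symmetric] algebra_simps)
qed

lemma nn_integral_poisson_mean:
  assumes "v > 0"
  shows "(\<integral>\<^sup>+k. ennreal (real k) \<partial>poisson_pmf v) = ennreal v"
proof -
  have "(\<lambda>k. v ^ Suc k / fact (Suc k) * real (Suc k)) sums (v * exp v)"
    using sums_mult[OF exp_sums_real[of v], of v] by (simp add: field_simps del: of_nat_Suc)
  from sums_Suc[OF this] have "(\<lambda>k. v ^ k / fact k * real k) sums (v * exp v)" by simp
  from nn_integral_poisson[OF assms _ this] show ?thesis
    by (simp add: exp_minus field_simps)
qed

text \<open>The second factorial moment coincides with the mean of a product of two independent
  counts; hence pairs of points inside one cell obey the same bound as pairs in distinct
  cells.\<close>

lemma nn_integral_poisson_fact2: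
  assumes "v > 0"
  shows "(\<integral>\<^sup>+k. ennreal (real k * (real k - 1)) \<partial>poisson_pmf v) = ennreal (v\<^sup>2)"
proof -
  have "v ^ Suc (Suc k) / fact (Suc (Suc k)) * (real (Suc (Suc k)) * (real (Suc (Suc k)) - 1)) = v\<^sup>2 * (v ^ k / fact k)" for k
  proof -
    have "fact (Suc (Suc k)) = real (Suc (Suc k)) * (real (Suc (Suc k)) - 1) * fact k" by simp
    moreover have "real (Suc (Suc k)) * (real (Suc (Suc k)) - 1) \<noteq> 0" by simp
    ultimately show ?thesis by (simp add: power2_eq_square)
  qed
  then have "(\<lambda>k. v ^ Suc (Suc k) / fact (Suc (Suc k)) * (real (Suc (Suc k)) * (real (Suc (Suc k)) - 1))) sums (v\<^sup>2 * exp v)"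
    using sums_mult[OF exp_sums_real[of v], of "v\<^sup>2"] by presburger
  from sums_Suc[OF sums_Suc[OF this]] have "(\<lambda>k. v ^ k / fact k * (real k * (real k - 1))) sums (v\<^sup>2 * exp v)" by simp
  moreover have "0 \<le> real k * (real k - 1)" for k :: nat by (cases k) auto
  ultimately show ?thesis using nn_integral_poisson[OF assms, of "\<lambda>k. real k * (real k - 1)"]
    by (simp add: exp_minus field_simps)
qed

text \<open>Two uses of \<open>exp x - 1 \<le> x * exp x\<close>. The factor \<open>exp x\<close> in
  the remainder admits large exponents; it is absorbed later by the exponential moments of a single
  count.\<close>

lemma exp_le_quadratic: "x \<ge> 0 \<Longrightarrow> exp x \<le> 1 + x + x\<^sup>2 * exp (x::real)"
proof -
  assume x: "x \<ge> 0"
  have "1 - x \<le> exp (- x)" using exp_ge_add_one_self[of "- x"] by simp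
  then have "(1 - x) * exp x \<le> exp (- x) * exp x" by (intro mult_right_mono) auto
  then have 1: "exp x - 1 \<le> x * exp x" by (simp add: exp_minus algebra_simps)
  then have "x * (exp x - 1) \<le> x * (x * exp x)" using x by (intro mult_left_mono) auto
  then show ?thesis using 1 by (simp add: power2_eq_square algebra_simps)
qed

lemma power_le_fact_exp: "x \<ge> 0 \<Longrightarrow> x ^ k \<le> fact k * exp (x::real)"
proof -
  assume x: "x \<ge> 0"
  have "x ^ k / fact k \<le> exp x"
    using sum_le_suminf[of "\<lambda>k. x ^ k / fact k" "{k}"] exp_sums_real[of x] x
    by (auto simp: sums_iff)
  then show ?thesis by (simp add: divide_simps mult.commute)
qed

text \<open>The factor 24 is \<open>4!\<close>, from \<open>k^4 \<le> 4! * exp k\<close> for pairs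
  inside one cell; pairs in two cells give only 4. The exponent dominates those of
  \<open>E exp (2 N)\<close> and of \<open>E exp (2 N) * E exp N\<close>, which occur in the two
  tail bounds.\<close>

definition moment_const :: "real \<Rightarrow> real" where "moment_const v = 24 * exp (2 * v * exp 2)"

text \<open>A product of two Poisson variables has no exponential moments. Truncating both factors at
  \<open>T \<le> 1 / lam\<close> gives \<open>lam * N * N' \<le> N\<close>, which has.\<close>

lemma poisson_pair_tail:
  fixes y z :: "'i \<Rightarrow> 'a"
  assumes A: "finite A" and I: "finite I" and yz: "\<And>i. i \<in> I \<Longrightarrow> y i \<in> A" "\<And>i. i \<in> I \<Longrightarrow> z i \<in> A"
    "\<And>i. i \<in> I \<Longrightarrow> y i \<noteq> z i" and dis: "disjoint_family_on (\<lambda>i. {y i, z i}) I"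
    and v: "v > 0" and lam: "lam \<ge> 0" "lam * T \<le> 1"
  shows "measure_pmf.prob (Pi_pmf A 0 (\<lambda>_. poisson_pmf v))
     {f. (\<forall>x\<in>A. real (f x) \<le> T) \<and> (\<Sum>i\<in>I. real (f (y i)) * real (f (z i))) \<ge> real (card I) * v\<^sup>2 + t}
     \<le> exp (- lam * t + lam\<^sup>2 * real (card I) * moment_const v)"
proof -
  define q where "q = Pi_pmf A 0 (\<lambda>_. poisson_pmf v)"
  define X where "X i f = (if real (f (y i)) \<le> T \<and> real (f (z i)) \<le> T then real (f (y i)) * real (f (z i)) else 0)"
    for i and f :: "'a \<Rightarrow> nat"
  have "{f. (\<forall>x\<in>A. real (f x) \<le> T) \<and> (\<Sum>i\<in>I. real (f (y i)) * real (f (z i))) \<ge> real (card I) * v\<^sup>2 + t}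
    \<subseteq> {f. (\<Sum>i\<in>I. X i f) \<ge> real (card I) * v\<^sup>2 + t}"
  proof safe
    fix f assume f: "\<forall>x\<in>A. real (f x) \<le> T" "real (card I) * v\<^sup>2 + t \<le> (\<Sum>i\<in>I. real (f (y i)) * real (f (z i)))"
    have "(\<Sum>i\<in>I. X i f) = (\<Sum>i\<in>I. real (f (y i)) * real (f (z i)))"
      using f(1) yz by (intro sum.cong) (auto simp: X_def)
    then show "real (card I) * v\<^sup>2 + t \<le> (\<Sum>i\<in>I. X i f)" using f(2) by simp
  qed
  then have "measure_pmf.prob q {f. (\<forall>x\<in>A. real (f x) \<le> T) \<and> (\<Sum>i\<in>I. real (f (y i)) * real (f (z i))) \<ge> real (card I) * v\<^sup>2 + t}
    \<le> measure_pmf.prob q {f. (\<Sum>i\<in>I. X i f) \<ge> real (card I) * v\<^sup>2 + t}"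
    by (intro measure_pmf.finite_measure_mono) auto
  also have "\<dots> \<le> exp (- lam * t + lam\<^sup>2 * real (card I) * moment_const v)"
    unfolding q_def
  proof (rule Pi_pmf_chernoff[OF A I _ dis _ lam(1)])
    fix i assume i: "i \<in> I"
    show "{y i, z i} \<subseteq> A" using yz i by auto
    show "depends_on {y i, z i} (X i)" by (auto simp: depends_on_def X_def)
    \<comment> \<open>For counts \<open>a\<close> and \<open>b\<close> in the two cells the
      remainder is at most \<open>(lam * a * b)^2 * exp a\<close>. The bounds
      \<open>a^2 \<le> 2 * exp a\<close> and \<open>b^2 \<le> 2 * exp b\<close> turn it into
      \<open>4 * lam^2 * exp (2 * a) * exp b\<close>, whence these weights.\<close>
    define g where "g a = ennreal (exp (2 * real a))" for a :: nat
    define h where "h a = ennreal (exp (1 * real a))" for a :: nat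
    define e where "e a = ennreal (real a)" for a :: nat
    have pw: "ennreal (exp (lam * X i f)) \<le> 1 + ennreal lam * (e (f (y i)) * e (f (z i)))
         + ennreal (4 * lam\<^sup>2) * (g (f (y i)) * h (f (z i)))" for f
    proof -
      define a where "a = real (f (y i))"
      define b where "b = real (f (z i))"
      have ab: "a \<ge> 0" "b \<ge> 0" by (auto simp: a_def b_def)
      have X: "X i f = (if a \<le> T \<and> b \<le> T then a * b else 0)" by (simp add: X_def a_def b_def)
      have X0: "0 \<le> X i f" "X i f \<le> a * b" using ab by (auto simp: X)
      have "lam * X i f \<le> a"
      proof (cases "a \<le> T \<and> b \<le> T")
        case True
        have "lam * X i f = a * (lam * b)" using True by (simp add: X)
        also have "\<dots> \<le> a * (lam * T)" using True ab lam by (intro mult_left_mono) auto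
        also have "\<dots> \<le> a * 1" using ab lam by (intro mult_left_mono) auto
        finally show ?thesis by simp
      qed (use ab X in auto)
      then have le: "exp (lam * X i f) \<le> exp a" by simp
      have "(lam * (a * b))\<^sup>2 * exp a = lam\<^sup>2 * (a\<^sup>2 * b\<^sup>2 * exp a)" by (simp add: power_mult_distrib)
      also have "\<dots> \<le> lam\<^sup>2 * ((2 * exp a) * (2 * exp b) * exp a)"
        using power_le_fact_exp[OF ab(1), of 2] power_le_fact_exp[OF ab(2), of 2]
        by (intro mult_left_mono mult_right_mono mult_mono) auto
      also have "\<dots> = 4 * lam\<^sup>2 * (exp (2 * a) * exp (1 * b))"
        by (simp add: exp_double power2_eq_square)
      finally have sq: "(lam * (a * b))\<^sup>2 * exp a \<le> 4 * lam\<^sup>2 * (exp (2 * a) * exp (1 * b))" .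
      have "exp (lam * X i f) \<le> 1 + lam * X i f + (lam * X i f)\<^sup>2 * exp (lam * X i f)"
        using X0 lam by (intro exp_le_quadratic) auto
      also have "\<dots> \<le> 1 + lam * (a * b) + (lam * (a * b))\<^sup>2 * exp a"
        using X0 lam le by (intro add_mono mult_mono power_mono mult_left_mono) auto
      finally have "exp (lam * X i f) \<le> 1 + lam * (a * b) + 4 * lam\<^sup>2 * (exp (2 * a) * exp (1 * b))"
        using sq by linarith
      then have "ennreal (exp (lam * X i f)) \<le> ennreal (1 + lam * (a * b) + 4 * lam\<^sup>2 * (exp (2 * a) * exp (1 * b)))"
        by (intro ennreal_leI) auto
      also have "\<dots> = 1 + ennreal lam * (ennreal a * ennreal b) + ennreal (4 * lam\<^sup>2) * (ennreal (exp (2 * a)) * ennreal (exp (1 * b)))"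
        using ab lam by (simp add: ennreal_plus[symmetric] ennreal_mult[symmetric] flip: ennreal_1 del: ennreal_plus)
      finally show ?thesis by (simp add: g_def h_def e_def a_def b_def)
    qed
    have ie: "(\<integral>\<^sup>+k. e k \<partial>poisson_pmf v) = ennreal v"
      unfolding e_def by (rule nn_integral_poisson_mean[OF v])
    have ig: "(\<integral>\<^sup>+k. g k \<partial>poisson_pmf v) = ennreal (exp (v * (exp 2 - 1)))"
      unfolding g_def by (rule nn_integral_poisson_exp[OF v])
    have ih: "(\<integral>\<^sup>+k. h k \<partial>poisson_pmf v) = ennreal (exp (v * (exp 1 - 1)))"
      unfolding h_def by (rule nn_integral_poisson_exp[OF v])
    have "(\<integral>\<^sup>+f. ennreal (exp (lam * X i f)) \<partial>Pi_pmf A 0 (\<lambda>_. poisson_pmf v))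
      \<le> (\<integral>\<^sup>+f. 1 + ennreal lam * (e (f (y i)) * e (f (z i)))
         + ennreal (4 * lam\<^sup>2) * (g (f (y i)) * h (f (z i))) \<partial>Pi_pmf A 0 (\<lambda>_. poisson_pmf v))"
      by (intro nn_integral_mono pw)
    also have "\<dots> = 1 + ennreal lam * (ennreal v * ennreal v) + ennreal (4 * lam\<^sup>2) * (ennreal (exp (v * (exp 2 - 1))) * ennreal (exp (v * (exp 1 - 1))))"
      using A yz[OF i] ie ig ih by (simp add: nn_integral_add nn_integral_cmult nn_integral_Pi_pmf_two)
    also have "\<dots> = ennreal (1 + lam * v\<^sup>2 + 4 * lam\<^sup>2 * (exp (v * (exp 2 - 1)) * exp (v * (exp 1 - 1))))"
      using v lam by (simp add: power2_eq_square ennreal_plus[symmetric] ennreal_mult[symmetric] flip: ennreal_1 del: ennreal_plus)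
    also have "\<dots> \<le> ennreal (exp (lam * v\<^sup>2 + lam\<^sup>2 * moment_const v))"
    proof (rule ennreal_leI)
      have "exp 1 \<le> (exp 2 :: real)" by simp
      then have "v * exp 1 \<le> v * exp 2" using v by (intro mult_left_mono) auto
      then have "exp (v * (exp 2 - 1)) * exp (v * (exp 1 - 1)) \<le> exp (2 * v * exp 2)"
        unfolding exp_add[symmetric] exp_le_cancel_iff right_diff_distrib using v by linarith
      moreover have "0 \<le> exp (2 * v * exp 2)" by simp
      ultimately have "4 * (exp (v * (exp 2 - 1)) * exp (v * (exp 1 - 1))) \<le> moment_const v"
        unfolding moment_const_def by linarith
      then have "lam\<^sup>2 * (4 * (exp (v * (exp 2 - 1)) * exp (v * (exp 1 - 1)))) \<le> lam\<^sup>2 * moment_const v"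
        by (intro mult_left_mono) auto
      then show "1 + lam * v\<^sup>2 + 4 * lam\<^sup>2 * (exp (v * (exp 2 - 1)) * exp (v * (exp 1 - 1))) \<le> exp (lam * v\<^sup>2 + lam\<^sup>2 * moment_const v)"
        using exp_ge_add_one_self[of "lam * v\<^sup>2 + lam\<^sup>2 * moment_const v"] by linarith
    qed
    finally show "(\<integral>\<^sup>+f. ennreal (exp (lam * X i f)) \<partial>Pi_pmf A 0 (\<lambda>_. poisson_pmf v)) \<le> ennreal (exp (lam * v\<^sup>2 + lam\<^sup>2 * moment_const v))" .
  qed
  finally show ?thesis unfolding q_def .
qed

text \<open>The contribution of ordered pairs of distinct points within one cell. The truncation
  gives \<open>lam * k * (k - 1) \<le> k\<close>, so the weight \<open>exp (2 * k)\<close> of a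
  single count controls the remainder.\<close>

lemma poisson_self_tail:
  fixes y :: "'i \<Rightarrow> 'a"
  assumes A: "finite A" and I: "finite I" and y: "\<And>i. i \<in> I \<Longrightarrow> y i \<in> A" and inj: "inj_on y I"
    and v: "v > 0" and lam: "lam \<ge> 0" "lam * T \<le> 1"
  shows "measure_pmf.prob (Pi_pmf A 0 (\<lambda>_. poisson_pmf v))
     {f. (\<forall>x\<in>A. real (f x) \<le> T) \<and> (\<Sum>i\<in>I. real (f (y i)) * (real (f (y i)) - 1)) \<ge> real (card I) * v\<^sup>2 + t}
     \<le> exp (- lam * t + lam\<^sup>2 * real (card I) * moment_const v)"
proof -
  define q where "q = Pi_pmf A 0 (\<lambda>_. poisson_pmf v)"
  define X where "X i f = (if real (f (y i)) \<le> T then real (f (y i)) * (real (f (y i)) - 1) else 0)"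
    for i and f :: "'a \<Rightarrow> nat"
  have "{f. (\<forall>x\<in>A. real (f x) \<le> T) \<and> (\<Sum>i\<in>I. real (f (y i)) * (real (f (y i)) - 1)) \<ge> real (card I) * v\<^sup>2 + t}
    \<subseteq> {f. (\<Sum>i\<in>I. X i f) \<ge> real (card I) * v\<^sup>2 + t}"
  proof safe
    fix f assume f: "\<forall>x\<in>A. real (f x) \<le> T" "real (card I) * v\<^sup>2 + t \<le> (\<Sum>i\<in>I. real (f (y i)) * (real (f (y i)) - 1))"
    have "(\<Sum>i\<in>I. X i f) = (\<Sum>i\<in>I. real (f (y i)) * (real (f (y i)) - 1))"
      using f(1) y by (intro sum.cong) (auto simp: X_def)
    then show "real (card I) * v\<^sup>2 + t \<le> (\<Sum>i\<in>I. X i f)" using f(2) by simp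
  qed
  then have "measure_pmf.prob q {f. (\<forall>x\<in>A. real (f x) \<le> T) \<and> (\<Sum>i\<in>I. real (f (y i)) * (real (f (y i)) - 1)) \<ge> real (card I) * v\<^sup>2 + t}
    \<le> measure_pmf.prob q {f. (\<Sum>i\<in>I. X i f) \<ge> real (card I) * v\<^sup>2 + t}"
    by (intro measure_pmf.finite_measure_mono) auto
  also have "\<dots> \<le> exp (- lam * t + lam\<^sup>2 * real (card I) * moment_const v)"
    unfolding q_def
  proof (rule Pi_pmf_chernoff[where K = "\<lambda>i. {y i}", OF A I _ _ _ lam(1)])
    show "disjoint_family_on (\<lambda>i. {y i}) I" using inj by (auto simp: disjoint_family_on_def inj_on_def)
    fix i assume i: "i \<in> I"
    show "{y i} \<subseteq> A" using y i by auto
    show "depends_on {y i} (X i)" by (auto simp: depends_on_def X_def)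
    define Y where "Y k = (if real k \<le> T then real k * (real k - 1) else 0)" for k :: nat
    have pw: "ennreal (exp (lam * Y k)) \<le> 1 + ennreal lam * ennreal (real k * (real k - 1))
         + ennreal (24 * lam\<^sup>2) * ennreal (exp (2 * real k))" for k
    proof -
      define a where "a = real k"
      \<comment> \<open>Uses that the count is an integer: the product is negative between 0 and
        1.\<close>
      have aa: "a * (a - 1) \<ge> 0" unfolding a_def by (cases k) auto
      have a: "a \<ge> 0" by (auto simp: a_def)
      have X: "Y k = (if a \<le> T then a * (a - 1) else 0)" by (simp add: Y_def a_def)
      have "a * (a - 1) \<le> a * a" using a by (intro mult_left_mono) auto
      then have X0: "0 \<le> Y k" "Y k \<le> a * (a - 1)" "Y k \<le> a\<^sup>2" using aa by (auto simp: X power2_eq_square)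
      have "lam * Y k \<le> a"
      proof (cases "a \<le> T")
        case True
        have "lam * Y k = a * (lam * (a - 1))" using True by (simp add: X)
        also have "\<dots> \<le> a * (lam * T)" using True a lam by (intro mult_left_mono) auto
        also have "\<dots> \<le> a * 1" using a lam by (intro mult_left_mono) auto
        finally show ?thesis by simp
      qed (use a X in auto)
      then have le: "exp (lam * Y k) \<le> exp a" by simp
      have "(lam * a\<^sup>2)\<^sup>2 * exp a = lam\<^sup>2 * (a ^ 4 * exp a)" by (simp add: power_mult_distrib power_mult[symmetric])
      also have "\<dots> \<le> lam\<^sup>2 * ((24 * exp a) * exp a)"
        using power_le_fact_exp[OF a, of 4]
        by (intro mult_left_mono mult_right_mono) (auto simp: fact_numeral)
      also have "\<dots> = 24 * lam\<^sup>2 * exp (2 * a)"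
        by (simp add: exp_double power2_eq_square)
      finally have sq: "(lam * a\<^sup>2)\<^sup>2 * exp a \<le> 24 * lam\<^sup>2 * exp (2 * a)" .
      have "exp (lam * Y k) \<le> 1 + lam * Y k + (lam * Y k)\<^sup>2 * exp (lam * Y k)"
        using X0 lam by (intro exp_le_quadratic) auto
      also have "\<dots> \<le> 1 + lam * (a * (a - 1)) + (lam * a\<^sup>2)\<^sup>2 * exp a"
        using X0 lam le by (intro add_mono mult_mono power_mono mult_left_mono) auto
      finally have "exp (lam * Y k) \<le> 1 + lam * (a * (a - 1)) + 24 * lam\<^sup>2 * exp (2 * a)"
        using sq by linarith
      then have "ennreal (exp (lam * Y k)) \<le> ennreal (1 + lam * (a * (a - 1)) + 24 * lam\<^sup>2 * exp (2 * a))"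
        by (intro ennreal_leI) auto
      also have "\<dots> = 1 + ennreal lam * ennreal (a * (a - 1)) + ennreal (24 * lam\<^sup>2) * ennreal (exp (2 * a))"
        using aa lam by (simp add: ennreal_plus[symmetric] ennreal_mult[symmetric] flip: ennreal_1 del: ennreal_plus)
      finally show ?thesis by (simp add: a_def)
    qed
    have "(\<integral>\<^sup>+f. ennreal (exp (lam * X i f)) \<partial>Pi_pmf A 0 (\<lambda>_. poisson_pmf v)) = (\<integral>\<^sup>+k. ennreal (exp (lam * Y k)) \<partial>poisson_pmf v)"
      using nn_integral_Pi_pmf_component[OF A y[OF i], where g = "\<lambda>k. ennreal (exp (lam * Y k))" and d = 0 and p = "\<lambda>_. poisson_pmf v"]
      by (simp add: X_def Y_def)
    also have "\<dots> \<le> (\<integral>\<^sup>+k. 1 + ennreal lam * ennreal (real k * (real k - 1))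
         + ennreal (24 * lam\<^sup>2) * ennreal (exp (2 * real k)) \<partial>poisson_pmf v)"
      by (intro nn_integral_mono pw)
    also have "\<dots> = 1 + ennreal lam * ennreal (v\<^sup>2) + ennreal (24 * lam\<^sup>2) * ennreal (exp (v * (exp 2 - 1)))"
      using v by (simp add: nn_integral_add nn_integral_cmult nn_integral_poisson_fact2 nn_integral_poisson_exp)
    also have "\<dots> = ennreal (1 + lam * v\<^sup>2 + 24 * lam\<^sup>2 * exp (v * (exp 2 - 1)))"
      using v lam by (simp add: ennreal_plus[symmetric] ennreal_mult[symmetric] flip: ennreal_1 del: ennreal_plus)
    also have "\<dots> \<le> ennreal (exp (lam * v\<^sup>2 + lam\<^sup>2 * moment_const v))"
    proof (rule ennreal_leI)
      have "v * (exp 2 - 1) \<le> 2 * v * exp 2" using v by (simp add: algebra_simps add_increasing2)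
      then have "24 * exp (v * (exp 2 - 1)) \<le> moment_const v"
        unfolding moment_const_def by simp
      then have "lam\<^sup>2 * (24 * exp (v * (exp 2 - 1))) \<le> lam\<^sup>2 * moment_const v"
        by (intro mult_left_mono) auto
      then show "1 + lam * v\<^sup>2 + 24 * lam\<^sup>2 * exp (v * (exp 2 - 1)) \<le> exp (lam * v\<^sup>2 + lam\<^sup>2 * moment_const v)"
        using exp_ge_add_one_self[of "lam * v\<^sup>2 + lam\<^sup>2 * moment_const v"] by linarith
    qed
    finally show "(\<integral>\<^sup>+f. ennreal (exp (lam * X i f)) \<partial>Pi_pmf A 0 (\<lambda>_. poisson_pmf v)) \<le> ennreal (exp (lam * v\<^sup>2 + lam\<^sup>2 * moment_const v))" .
  qed
  finally show ?thesis unfolding q_def .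
qed

text \<open>Chernoff in each cell and a union bound. The exponent \<open>s\<close> stays free; taken
  as \<open>2 * C\<close> with \<open>T = (log n) / C\<close> it yields a factor
  \<open>n^(-2)\<close>.\<close>

lemma poisson_max_tail:
  assumes A: "finite A" and v: "v > 0" and s: "s \<ge> 0"
  shows "measure_pmf.prob (Pi_pmf A 0 (\<lambda>_. poisson_pmf v)) {f. \<exists>x\<in>A. real (f x) > T}
    \<le> real (card A) * exp (v * (exp s - 1) - s * T)"
proof -
  let ?q = "Pi_pmf A 0 (\<lambda>_. poisson_pmf v)"
  have one: "measure_pmf.prob ?q {f. real (f x) > T} \<le> exp (v * (exp s - 1) - s * T)" if x: "x \<in> A" for x
  proof -
    have "emeasure ?q {f. real (f x) > T} \<le> emeasure ?q {f\<in>UNIV. 1 \<le> ennreal (exp (- s * T)) * ennreal (exp (s * real (f x)))}"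
      using s by (intro emeasure_mono)
        (auto simp: ennreal_mult[symmetric] exp_add[symmetric] mult_left_mono less_imp_le)
    also have "\<dots> \<le> ennreal (exp (- s * T)) * (\<integral>\<^sup>+f. ennreal (exp (s * real (f x))) * indicator UNIV f \<partial>?q)"
      by (rule nn_integral_Markov_inequality) auto
    also have "(\<integral>\<^sup>+f. ennreal (exp (s * real (f x))) * indicator UNIV f \<partial>?q) = ennreal (exp (v * (exp s - 1)))"
      using nn_integral_Pi_pmf_component[OF A x, where g = "\<lambda>k. ennreal (exp (s * real k))" and d = 0 and p = "\<lambda>_. poisson_pmf v"]
      by (simp add: nn_integral_poisson_exp[OF v])
    also have "ennreal (exp (- s * T)) * \<dots> = ennreal (exp (v * (exp s - 1) - s * T))"
      by (simp add: ennreal_mult[symmetric] exp_add[symmetric])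
    finally show ?thesis by (simp add: measure_pmf.emeasure_eq_measure)
  qed
  have "{f. \<exists>x\<in>A. real (f x) > T} = (\<Union>x\<in>A. {f. real (f x) > T})" by auto
  then have "measure_pmf.prob ?q {f. \<exists>x\<in>A. real (f x) > T} \<le> (\<Sum>x\<in>A. measure_pmf.prob ?q {f. real (f x) > T})"
    using A by (simp add: measure_pmf.finite_measure_subadditive_finite)
  also have "\<dots> \<le> (\<Sum>x\<in>A. exp (v * (exp s - 1) - s * T))" using one by (intro sum_mono) auto
  finally show ?thesis by simp
qed

subsection \<open>Site percolation at high density\<close>

text \<open>Adjacency in the integer lattice, without wrapping around the torus: dropping edges is
  harmless when a large component is to be found.\<close>

definition nbr :: "int^'d::finite \<Rightarrow> int^'d \<Rightarrow> bool" where
  "nbr x y \<longleftrightarrow> (\<exists>i. \<bar>x $ i - y $ i\<bar> = 1 \<and> (\<forall>j. j \<noteq> i \<longrightarrow> x $ j = y $ j))"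

lemma nbr_sym: "nbr x y \<Longrightarrow> nbr y x"
  unfolding nbr_def by (metis abs_minus_commute)

definition step_in :: "(int^'d::finite) set \<Rightarrow> int^'d \<Rightarrow> int^'d \<Rightarrow> bool" where
  "step_in S u w \<longleftrightarrow> u \<in> S \<and> w \<in> S \<and> nbr u w"

text \<open>Induction on the \<open>l1\<close> distance: moving one differing coordinate by one
  towards \<open>y\<close> stays inside the box spanned by \<open>x\<close> and \<open>y\<close>,
  and the box spanned afterwards is contained in it.\<close>

lemma box_path:
  fixes x y :: "int^'d::finite"
  assumes "\<And>w. (\<And>i. min (x $ i) (y $ i) \<le> w $ i \<and> w $ i \<le> max (x $ i) (y $ i)) \<Longrightarrow> w \<in> S"
  shows "(step_in S)\<^sup>*\<^sup>* x y"
  using assms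
proof (induction "nat (\<Sum>i\<in>UNIV. \<bar>x $ i - y $ i\<bar>)" arbitrary: x rule: less_induct)
  case less
  show ?case
  proof (cases "x = y")
    case False
    then obtain i where i: "x $ i \<noteq> y $ i" by (auto simp: vec_eq_iff)
    define x' where "x' = (\<chi> j. if j = i then x $ i + sgn (y $ i - x $ i) else x $ j)"
    have x'i: "x' $ i = x $ i + sgn (y $ i - x $ i)" and x'j: "\<And>j. j \<noteq> i \<Longrightarrow> x' $ j = x $ j" by (auto simp: x'_def)
    have bet: "min (x $ j) (y $ j) \<le> x' $ j \<and> x' $ j \<le> max (x $ j) (y $ j)" for j
      using i by (cases "j = i") (auto simp: x'i x'j sgn_if)
    have "(\<Sum>j\<in>UNIV. \<bar>x' $ j - y $ j\<bar>) < (\<Sum>j\<in>UNIV. \<bar>x $ j - y $ j\<bar>)"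
    proof (rule sum_strict_mono_ex1)
      show "\<forall>j\<in>UNIV. \<bar>x' $ j - y $ j\<bar> \<le> \<bar>x $ j - y $ j\<bar>"
      proof
        fix j show "\<bar>x' $ j - y $ j\<bar> \<le> \<bar>x $ j - y $ j\<bar>" using bet[of j] by linarith
      qed
      show "\<exists>j\<in>UNIV. \<bar>x' $ j - y $ j\<bar> < \<bar>x $ j - y $ j\<bar>"
        using i by (intro bexI[of _ i]) (auto simp: x'i sgn_if)
    qed auto
    moreover have "0 \<le> (\<Sum>j\<in>UNIV. \<bar>x' $ j - y $ j\<bar>)" by (intro sum_nonneg) auto
    ultimately have "nat (\<Sum>j\<in>UNIV. \<bar>x' $ j - y $ j\<bar>) < nat (\<Sum>j\<in>UNIV. \<bar>x $ j - y $ j\<bar>)" by linarith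
    then have "(step_in S)\<^sup>*\<^sup>* x' y"
    proof (rule less.hyps)
      fix w assume w: "\<And>i. min (x' $ i) (y $ i) \<le> w $ i \<and> w $ i \<le> max (x' $ i) (y $ i)"
      show "w \<in> S"
      proof (rule less.prems)
        fix j show "min (x $ j) (y $ j) \<le> w $ j \<and> w $ j \<le> max (x $ j) (y $ j)"
          using w[of j] bet[of j] by linarith
      qed
    qed
    moreover have "step_in S x x'"
    proof -
      have "x \<in> S" by (rule less.prems) auto
      moreover have "x' \<in> S" by (rule less.prems) (rule bet)
      moreover have "nbr x x'" unfolding nbr_def using i by (intro exI[of _ i]) (auto simp: x'i x'j sgn_if)
      ultimately show ?thesis by (simp add: step_in_def)
    qed
    ultimately show ?thesis by (rule converse_rtranclp_into_rtranclp[rotated])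
  qed simp
qed

section \<open>Connectivity of a cube with at most one site removed\<close>

definition subblocks :: "int \<Rightarrow> int^'d::finite \<Rightarrow> (int^'d) set" where
  "subblocks l b = {c. \<forall>i. l * b $ i \<le> c $ i \<and> c $ i < l * b $ i + l}"

lemma subblocks_alt: "subblocks l b = {c. \<forall>i. c $ i \<in> {l * b $ i..<l * b $ i + l}}"
  by (auto simp: subblocks_def)

lemma finite_subblocks [simp]: "finite (subblocks l b)"
  unfolding subblocks_alt by (rule finite_vec_box) auto

lemma card_subblocks: "card (subblocks l b :: (int^'d::finite) set) = nat l ^ CARD('d)"
  unfolding subblocks_alt by (subst card_vec_box) auto

text \<open>A slice on which some coordinate is fixed at a value other than that of \<open>v\<close>
  is a box avoiding \<open>v\<close>, hence connected by \<open>box_path\<close>. Two sites other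
  than \<open>v\<close> are joined through at most three such slices; the second dimension makes the
  detour around \<open>v\<close> possible.\<close>

lemma subblocks_path:
  fixes b :: "int^'d::finite"
  assumes d: "CARD('d) \<ge> 2" and l: "l \<ge> 2" and S: "S \<subseteq> subblocks l b" "\<And>c. c \<in> subblocks l b \<Longrightarrow> c \<noteq> v \<Longrightarrow> c \<in> S"
    and x: "x \<in> S" and y: "y \<in> S"
  shows "(step_in S)\<^sup>*\<^sup>* x y"
proof -
  have hyper: "(step_in S)\<^sup>*\<^sup>* u w" if "u \<in> subblocks l b" "w \<in> subblocks l b" "u $ i = w $ i" "u $ i \<noteq> v $ i" for u w i
  proof (rule box_path)
    fix z assume z: "\<And>i. min (u $ i) (w $ i) \<le> z $ i \<and> z $ i \<le> max (u $ i) (w $ i)"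
    have "z \<in> subblocks l b" unfolding subblocks_def
    proof (intro CollectI allI)
      fix j
      have "l * b $ j \<le> u $ j \<and> u $ j < l * b $ j + l" "l * b $ j \<le> w $ j \<and> w $ j < l * b $ j + l"
        using that(1,2) by (auto simp: subblocks_def)
      then show "l * b $ j \<le> z $ j \<and> z $ j < l * b $ j + l" using z[of j] by linarith
    qed
    moreover have "z $ i = u $ i" using z[of i] that by simp
    ultimately show "z \<in> S" using that S(2) by metis
  qed
  show ?thesis
  proof (cases "v \<in> S")
    case True
    have full: "S = subblocks l b" using S True by blast
    show ?thesis
    proof (rule box_path)
      fix z assume z: "\<And>i. min (x $ i) (y $ i) \<le> z $ i \<and> z $ i \<le> max (x $ i) (y $ i)"
      show "z \<in> S" unfolding full subblocks_def
      proof (intro CollectI allI)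
        fix j
        have "l * b $ j \<le> x $ j \<and> x $ j < l * b $ j + l" "l * b $ j \<le> y $ j \<and> y $ j < l * b $ j + l"
          using x y by (auto simp: full subblocks_def)
        then show "l * b $ j \<le> z $ j \<and> z $ j < l * b $ j + l" using z[of j] by linarith
      qed
    qed
  next
    case False
    then have "x \<noteq> v" "y \<noteq> v" using x y by auto
    then obtain i j where i: "x $ i \<noteq> v $ i" and j: "y $ j \<noteq> v $ j" by (metis vec_eq_iff)
    have xs: "x \<in> subblocks l b" "y \<in> subblocks l b" using x y S by auto
    have upd: "(\<chi> m. if m = k then t else u $ m) \<in> subblocks l b"
      if "u \<in> subblocks l b" "l * b $ k \<le> t" "t < l * b $ k + l" for u k t
      using that by (auto simp: subblocks_def)
    show ?thesis
    proof (cases "i = j")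
      case False
      define w where "w = (\<chi> m. if m = j then y $ j else x $ m)"
      have w: "w \<in> subblocks l b" unfolding w_def using xs by (intro upd) (auto simp: subblocks_def)
      have "(step_in S)\<^sup>*\<^sup>* x w" by (rule hyper[of _ _ i]) (use xs w i False in \<open>auto simp: w_def\<close>)
      also have "(step_in S)\<^sup>*\<^sup>* w y" by (rule hyper[of _ _ j]) (use xs w j in \<open>auto simp: w_def\<close>)
      finally show ?thesis .
    next
      case True
      obtain k where k: "k \<noteq> i"
      proof -
        have "\<not> UNIV \<subseteq> {i}" using d card_mono[of "{i}" UNIV] by auto
        then show thesis using that by auto
      qed
      obtain t where t: "l * b $ k \<le> t" "t < l * b $ k + l" "t \<noteq> v $ k"
      proof -
        have "l * b $ k \<noteq> v $ k \<or> l * b $ k + 1 \<noteq> v $ k" by auto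
        then show thesis using that[of "l * b $ k"] that[of "l * b $ k + 1"] l by fastforce
      qed
      \<comment> \<open>Here \<open>x\<close> and \<open>y\<close> may differ from \<open>v\<close>
        in the coordinate \<open>i\<close> only, possibly on opposite sides. The path moves along
        \<open>k\<close> to a level \<open>t\<close> different from that of \<open>v\<close>,
        crosses there and returns.\<close>
      define w1 where "w1 = (\<chi> m. if m = k then t else x $ m)"
      define w2 where "w2 = (\<chi> m. if m = k then t else y $ m)"
      have w: "w1 \<in> subblocks l b" "w2 \<in> subblocks l b" unfolding w1_def w2_def using xs t by (auto intro!: upd)
      have "(step_in S)\<^sup>*\<^sup>* x w1" by (rule hyper[of _ _ i]) (use xs w i k in \<open>auto simp: w1_def\<close>)
      also have "(step_in S)\<^sup>*\<^sup>* w1 w2" by (rule hyper[of _ _ k]) (use w t in \<open>auto simp: w1_def w2_def\<close>)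
      also have "(step_in S)\<^sup>*\<^sup>* w2 y" by (rule hyper[of _ _ i]) (use xs w j k True in \<open>auto simp: w2_def\<close>)
      finally show ?thesis .
    qed
  qed
qed

section \<open>Renormalised blocks and the density of their cores\<close>

definition ratio :: "nat \<Rightarrow> int" where "ratio k = 2 ^ (k + 2)"

fun block_side :: "nat \<Rightarrow> int" where
  "block_side 0 = 1"
| "block_side (Suc k) = ratio k * block_side k"

text \<open>A block of level \<open>k + 1\<close> consists of \<open>ratio k\<close> blocks of level \<open>k\<close> in each direction. It may
  contain one bad block: removing it neither disconnects the remaining ones nor spoils all the
  facing pairs of two adjacent blocks. As the ratios grow, the product of the retained proportions
  stays above \<open>1/2\<close>.\<close>

fun good :: "nat \<Rightarrow> (int^'d::finite \<Rightarrow> bool) \<Rightarrow> int^'d \<Rightarrow> bool" where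
  "good 0 occ b = occ b"
| "good (Suc k) occ b = (\<exists>v. \<forall>c\<in>subblocks (ratio k) b. c \<noteq> v \<longrightarrow> good k occ c)"

text \<open>Taking all good subblocks, rather than all but a chosen exceptional one, makes the core
  independent of the choice of \<open>v\<close> in \<open>good\<close>.\<close>

fun core :: "nat \<Rightarrow> (int^'d::finite \<Rightarrow> bool) \<Rightarrow> int^'d \<Rightarrow> (int^'d) set" where
  "core 0 occ b = {b}"
| "core (Suc k) occ b = (\<Union>c\<in>{c \<in> subblocks (ratio k) b. good k occ c}. core k occ c)"

text \<open>The index \<open>b\<close> counts in units of \<open>block_side k\<close>, as in
  \<open>good\<close> and \<open>core\<close>, whereas the block is a set of sites of level
  0.\<close>

definition block :: "nat \<Rightarrow> int^'d::finite \<Rightarrow> (int^'d) set" where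
  "block k b = {x. \<forall>i. block_side k * b $ i \<le> x $ i \<and> x $ i < block_side k * (b $ i + 1)}"

lemma ratio_ge: "ratio k \<ge> 4"
proof -
  have "(2::int) ^ 2 \<le> 2 ^ (k + 2)" by (rule power_increasing) auto
  then show ?thesis by (simp add: ratio_def)
qed

lemma nat_ratio: "nat (ratio k) = 2 ^ (k + 2)"
  unfolding ratio_def by (subst nat_power_eq) auto

lemma block_side_pos: "block_side k > 0"
proof (induction k)
  case (Suc k) then show ?case using ratio_ge[of k] by simp
qed simp

lemma block_subset: "c \<in> subblocks (ratio k) b \<Longrightarrow> block k c \<subseteq> block (Suc k) b"
proof
  fix x assume c: "c \<in> subblocks (ratio k) b" and x: "x \<in> block k c"
  show "x \<in> block (Suc k) b" unfolding block_def
  proof (intro CollectI allI)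
    fix i
    have "ratio k * b $ i \<le> c $ i" "c $ i + 1 \<le> ratio k * (b $ i + 1)"
      using c by (auto simp: subblocks_def distrib_left add1_zle_eq)
    then have "block_side k * (ratio k * b $ i) \<le> block_side k * c $ i" "block_side k * (c $ i + 1) \<le> block_side k * (ratio k * (b $ i + 1))"
      using block_side_pos[of k] by (auto intro!: mult_left_mono)
    moreover have "block_side k * c $ i \<le> x $ i" "x $ i < block_side k * (c $ i + 1)" using x by (auto simp: block_def)
    moreover have "block_side (Suc k) * b $ i = block_side k * (ratio k * b $ i)" "block_side (Suc k) * (b $ i + 1) = block_side k * (ratio k * (b $ i + 1))"
      by (simp_all add: algebra_simps)
    ultimately show "block_side (Suc k) * b $ i \<le> x $ i \<and> x $ i < block_side (Suc k) * (b $ i + 1)" by linarith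
  qed
qed

lemma block_disjoint: "c \<noteq> c' \<Longrightarrow> block k c \<inter> block k c' = {}"
proof (rule ccontr)
  assume ne: "c \<noteq> c'" and "block k c \<inter> block k c' \<noteq> {}"
  then obtain x where x: "x \<in> block k c" "x \<in> block k c'" by blast
  have "c $ i = c' $ i" for i
  proof -
    have "block_side k * c $ i \<le> x $ i" "x $ i < block_side k * (c $ i + 1)" "block_side k * c' $ i \<le> x $ i" "x $ i < block_side k * (c' $ i + 1)"
      using x by (auto simp: block_def)
    then have "block_side k * c $ i < block_side k * (c' $ i + 1)" "block_side k * c' $ i < block_side k * (c $ i + 1)" by linarith+
    then show ?thesis using block_side_pos[of k] by (simp add: mult_less_cancel_left)
  qed
  then show False using ne by (simp add: vec_eq_iff)
qed

lemma core_block: "core k occ b \<subseteq> block k b"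
proof (induction k arbitrary: b)
  case 0 show ?case by (simp add: block_def)
next
  case (Suc k)
  show ?case
  proof
    fix x assume "x \<in> core (Suc k) occ b"
    then obtain c where "c \<in> subblocks (ratio k) b" "x \<in> core k occ c" by auto
    then show "x \<in> block (Suc k) b" using block_subset Suc by blast
  qed
qed

lemma core_occ: "good k occ b \<Longrightarrow> x \<in> core k occ b \<Longrightarrow> occ x"
  by (induction k arbitrary: b) auto

lemma finite_core: "finite (core k occ b)"
  by (induction k arbitrary: b) auto

text \<open>A step up loses at most one of \<open>l^d\<close> subblocks, where
  \<open>l = 2^(k+2)\<close>, hence a proportion of at most \<open>1 / l\<close>. This is exactly
  the decrease of \<open>1/2 + 1 / 2^(k+1)\<close> from one level to the next. Cores of distinct
  subblocks are disjoint because the blocks containing them are.\<close>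

lemma card_core:
  fixes b :: "int^'d::finite"
  assumes d: "CARD('d) \<ge> 2"
  shows "good k occ b \<Longrightarrow> real (card (core k occ b)) \<ge> (1/2 + 1 / 2 ^ (k+1)) * of_int (block_side k) ^ CARD('d)"
proof (induction k arbitrary: b)
  case 0 then show ?case by simp
next
  case (Suc k)
  define G where "G = {c \<in> subblocks (ratio k) b. good k occ c}"
  define l where "l = (2::real) ^ (k + 2)"
  define D where "D = 1/2 + 1 / (2::real) ^ (k+1)"
  define T where "T = (of_int (block_side k) :: real) ^ CARD('d)"
  obtain v where v: "\<forall>c\<in>subblocks (ratio k) b. c \<noteq> v \<longrightarrow> good k occ c" using Suc.prems by auto
  have T: "T > 0" using block_side_pos[of k] by (simp add: T_def)
  have "subblocks (ratio k) b \<subseteq> insert v G" using v by (auto simp: G_def)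
  moreover have finG: "finite G" by (simp add: G_def)
  ultimately have "card (subblocks (ratio k) b) \<le> card (insert v G)" by (intro card_mono) auto
  also have "\<dots> \<le> card G + 1" using finG by (simp add: card_insert_if)
  finally have "real (nat (ratio k) ^ CARD('d)) \<le> real (card G + 1)" by (simp add: card_subblocks del: of_nat_add of_nat_power)
  then have cG: "l ^ CARD('d) - 1 \<le> real (card G)"
    by (simp add: ratio_def l_def nat_power_eq)
  have "card (core (Suc k) occ b) = (\<Sum>c\<in>G. card (core k occ c))"
    unfolding core.simps G_def[symmetric]
  proof (rule card_UN_disjoint[OF finG])
    show "\<forall>i\<in>G. finite (core k occ i)" by (simp add: finite_core)
    show "\<forall>i\<in>G. \<forall>j\<in>G. i \<noteq> j \<longrightarrow> core k occ i \<inter> core k occ j = {}"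
      using core_block[of k occ] block_disjoint[of _ _ k] by blast
  qed
  then have "real (card (core (Suc k) occ b)) = (\<Sum>c\<in>G. real (card (core k occ c)))" by simp
  also have "\<dots> \<ge> (\<Sum>c\<in>G. D * T)"
    using Suc.IH by (intro sum_mono) (auto simp: G_def D_def T_def)
  finally have "real (card (core (Suc k) occ b)) \<ge> real (card G) * (D * T)" by simp
  moreover have "real (card G) * (D * T) \<ge> (l ^ CARD('d) - 1) * (D * T)"
    using cG T by (intro mult_right_mono) (auto simp: D_def)
  moreover have "(l ^ CARD('d) - 1) * D \<ge> (1/2 + 1 / 2 ^ (k+2)) * l ^ CARD('d)"
  proof -
    have l1: "l \<ge> 1" unfolding l_def by (rule one_le_power) simp
    have "l\<^sup>2 \<le> l ^ CARD('d)" using d l1 by (intro power_increasing) auto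
    moreover have "l * l \<ge> 1 * l" using l1 by (intro mult_right_mono) auto
    ultimately have ld: "l \<le> l ^ CARD('d)" by (simp add: power2_eq_square)
    have "(1::real) / 2 ^ (k+1) \<le> 1 / 2 ^ 1" by (intro divide_left_mono power_increasing) auto
    then have D1: "D \<le> 1" unfolding D_def power_one_right by linarith
    define E where "E = 1/2 + 1 / (2::real) ^ (k+2)"
    \<comment> \<open>\<open>E\<close> is the density claimed at the next level. The surplus
      \<open>l^d / l\<close> pays for the lost subblock, as \<open>D \<le> 1\<close>.\<close>
    have "D = E + 1 / l" by (simp add: D_def E_def l_def field_simps)
    then have "(l ^ CARD('d) - 1) * D = E * l ^ CARD('d) + (l ^ CARD('d) / l - D)"
      by (simp add: algebra_simps)
    moreover have "l ^ CARD('d) / l \<ge> 1" using ld l1 by (simp add: field_simps)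
    ultimately show ?thesis using D1 unfolding E_def[symmetric] by linarith
  qed
  then have "(l ^ CARD('d) - 1) * D * T \<ge> (1/2 + 1 / 2 ^ (k+2)) * l ^ CARD('d) * T"
    using T by (intro mult_right_mono) auto
  moreover have "(of_int (block_side (Suc k)) :: real) ^ CARD('d) = l ^ CARD('d) * T"
    by (simp add: T_def l_def ratio_def power_mult_distrib)
  ultimately show ?case by (simp add: mult.assoc)
qed

lemma core_nonempty:
  fixes b :: "int^'d::finite"
  assumes "CARD('d) \<ge> 2" "good k occ b" shows "core k occ b \<noteq> {}"
proof -
  have "0 < (1/2 + 1 / 2 ^ (k+1)) * (of_int (block_side k) :: real) ^ CARD('d)"
    using block_side_pos[of k] by (intro mult_pos_pos) (auto simp: add_pos_pos)
  then have "0 < card (core k occ b)" using card_core[OF assms] by linarith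
  then show ?thesis by auto
qed

section \<open>Linking the cores of neighbouring good blocks\<close>

definition linked :: "(int^'d::finite \<Rightarrow> bool) \<Rightarrow> int^'d \<Rightarrow> int^'d \<Rightarrow> bool" where
  "linked occ = (step_in {x. occ x})\<^sup>*\<^sup>*"

lemma linked_trans: "linked occ x y \<Longrightarrow> linked occ y z \<Longrightarrow> linked occ x z"
  unfolding linked_def by (rule rtranclp_trans)

text \<open>Lifts a path of good blocks to a path of sites through an arbitrary core site of each
  intermediate block. With the one-step link \<open>IH\<close> as a hypothesis, the lemma serves
  inside the induction of \<open>core_linked\<close> and once more afterwards in
  \<open>giant_cells\<close>.\<close>

lemma path_linked:
  fixes c c' :: "int^'d::finite"
  assumes d: "CARD('d) \<ge> 2"
    and IH: "\<And>b b' x y. good k occ b \<Longrightarrow> good k occ b' \<Longrightarrow> b = b' \<or> nbr b b' \<Longrightarrow> x \<in> core k occ b \<Longrightarrow> y \<in> core k occ b' \<Longrightarrow> linked occ x y"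
    and S: "\<And>c. c \<in> S \<Longrightarrow> good k occ c" and p: "(step_in S)\<^sup>*\<^sup>* c c'" and c: "c \<in> S"
    and x: "x \<in> core k occ c" and y: "y \<in> core k occ c'"
  shows "linked occ x y"
  using p y
proof (induction arbitrary: y rule: rtranclp_induct)
  case base
  then show ?case using IH[of c c x y] S[OF c] x by auto
next
  case (step u w)
  have g: "good k occ u" "good k occ w" "nbr u w" using step.hyps(2) S by (auto simp: step_in_def)
  obtain z where z: "z \<in> core k occ u" using core_nonempty[OF d g(1)] by blast
  then show ?case using step.IH[OF z] IH[OF g(1,2) _ z step.prems] g(3) linked_trans by blast
qed

text \<open>Along the common face run pairs of facing subblocks. Each of the two exceptional
  subblocks can spoil only the pairs at one level of the coordinate \<open>j\<close>, so one of the
  three levels \<open>t = 0, 1, 2\<close> is free of both.\<close>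

lemma facing_pair:
  fixes b b' :: "int^'d::finite"
  assumes d: "CARD('d) \<ge> 2" and g: "good (Suc k) occ b" "good (Suc k) occ b'"
    and i: "b' $ i = b $ i + 1" "\<And>j. j \<noteq> i \<Longrightarrow> b $ j = b' $ j"
  shows "\<exists>c\<in>subblocks (ratio k) b. \<exists>c'\<in>subblocks (ratio k) b'. good k occ c \<and> good k occ c' \<and> nbr c c'"
proof -
  define l where "l = ratio k"
  have l: "l \<ge> 4" using ratio_ge by (simp add: l_def)
  obtain v where v: "\<forall>c\<in>subblocks l b. c \<noteq> v \<longrightarrow> good k occ c" using g(1) by (auto simp: l_def)
  obtain v' where v': "\<forall>c\<in>subblocks l b'. c \<noteq> v' \<longrightarrow> good k occ c" using g(2) by (auto simp: l_def)
  obtain j where j: "j \<noteq> i"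
  proof -
    have "\<not> UNIV \<subseteq> {i}" using d card_mono[of "{i}" UNIV] by auto
    then show thesis using that by auto
  qed
  obtain t where t: "0 \<le> t" "t \<le> 2" "t \<noteq> v $ j - l * b $ j" "t \<noteq> v' $ j - l * b $ j"
  proof -
    have "\<exists>t. 0 \<le> t \<and> t \<le> 2 \<and> t \<noteq> p \<and> t \<noteq> q" for p q :: int by presburger
    then show thesis using that by blast
  qed
  define c where "c = (\<chi> m. if m = i then l * b $ i + l - 1 else if m = j then l * b $ j + t else l * b $ m)"
  define c' where "c' = (\<chi> m. if m = i then l * b' $ i else if m = j then l * b $ j + t else l * b $ m)"
  have c: "c \<in> subblocks l b" using l t j by (auto simp: subblocks_def c_def)
  have c': "c' \<in> subblocks l b'" using l t j i by (auto simp: subblocks_def c'_def)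
  have "c $ j \<noteq> v $ j" "c' $ j \<noteq> v' $ j" using t j by (auto simp: c_def c'_def)
  then have "c \<noteq> v" "c' \<noteq> v'" by auto
  moreover have "nbr c c'" unfolding nbr_def by (rule exI[of _ i]) (auto simp: c_def c'_def i algebra_simps)
  ultimately show ?thesis using c c' v v' unfolding l_def[symmetric] by blast
qed

text \<open>The cases \<open>b = b'\<close> and \<open>nbr b b'\<close> need a common induction:
  inside a block of level \<open>k + 1\<close> the path passes between neighbouring subblocks of
  level \<open>k\<close>, and from one block to the next it crosses at a facing pair.\<close>

lemma core_linked:
  fixes b b' :: "int^'d::finite"
  assumes d: "CARD('d) \<ge> 2"
  shows "good k occ b \<Longrightarrow> good k occ b' \<Longrightarrow> b = b' \<or> nbr b b' \<Longrightarrow> x \<in> core k occ b \<Longrightarrow> y \<in> core k occ b' \<Longrightarrow> linked occ x y"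
proof (induction k arbitrary: b b' x y)
  case 0
  then show ?case by (auto simp: linked_def step_in_def)
next
  case (Suc k)
  define S where "S b = {c \<in> subblocks (ratio k) b. good k occ c}" for b
  have inside: "linked occ x y" if g: "good (Suc k) occ b" and x: "x \<in> core k occ c" "c \<in> S b" and y: "y \<in> core k occ c'" "c' \<in> S b"
    for b c c' x y
  proof -
    obtain v where v: "\<forall>c\<in>subblocks (ratio k) b. c \<noteq> v \<longrightarrow> good k occ c" using g by auto
    have p: "(step_in (S b))\<^sup>*\<^sup>* c c'"
      using ratio_ge[of k] v x y by (intro subblocks_path[OF d, of "ratio k" _ b v]) (auto simp: S_def)
    show ?thesis
      by (rule path_linked[OF d _ _ p x(2) x(1) y(1)], rule Suc.IH, assumption+, simp add: S_def)
  qed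
  obtain c where c: "c \<in> S b" "x \<in> core k occ c" using Suc.prems(4) by (auto simp: S_def)
  obtain c' where c': "c' \<in> S b'" "y \<in> core k occ c'" using Suc.prems(5) by (auto simp: S_def)
  show ?case
  proof (cases "b = b'")
    case True
    then show ?thesis using inside[OF Suc.prems(1) c(2,1)] c' by auto
  next
    case False
    then obtain i where i: "\<bar>b $ i - b' $ i\<bar> = 1" "\<And>j. j \<noteq> i \<Longrightarrow> b $ j = b' $ j"
      using Suc.prems(3) by (auto simp: nbr_def)
    have "\<exists>e\<in>S b. \<exists>e'\<in>S b'. nbr e e'"
    proof (cases "b' $ i = b $ i + 1")
      case True
      then show ?thesis using facing_pair[OF d Suc.prems(1,2) True i(2)] by (auto simp: S_def)
    next
      case False
      then have "b $ i = b' $ i + 1" using i(1) by linarith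
      from facing_pair[OF d Suc.prems(2,1) this i(2)[symmetric]] show ?thesis
        using nbr_sym by (fastforce simp: S_def)
    qed
    then obtain e e' where e: "e \<in> S b" "e' \<in> S b'" "nbr e e'" by blast
    have ge: "good k occ e" "good k occ e'" using e by (auto simp: S_def)
    obtain u w where uw: "u \<in> core k occ e" "w \<in> core k occ e'"
      using core_nonempty[OF d ge(1)] core_nonempty[OF d ge(2)] by blast
    have "linked occ x u" using inside[OF Suc.prems(1) c(2,1) uw(1) e(1)] .
    moreover have "linked occ u w" using Suc.IH[OF ge _ uw] e(3) by blast
    moreover have "linked occ w y" using inside[OF Suc.prems(2) uw(2) e(2) c'(2,1)] .
    ultimately show ?thesis using linked_trans by blast
  qed
qed

lemma giant_cells:
  fixes occ :: "int^'d::finite \<Rightarrow> bool"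
  assumes d: "CARD('d) \<ge> 2" and g: "\<And>b. b \<in> cells m \<Longrightarrow> good k occ b"
  shows "\<exists>G. finite G \<and> (\<forall>x\<in>G. occ x) \<and> (\<forall>x\<in>G. \<forall>y\<in>G. linked occ x y) \<and>
     real (card G) \<ge> 1/2 * (real m * of_int (block_side k)) ^ CARD('d)"
proof (intro exI conjI ballI)
  let ?G = "\<Union>b\<in>cells m. core k occ b"
  show "finite ?G" by (auto simp: finite_core)
  show "occ x" if "x \<in> ?G" for x using that g core_occ by blast
  show "linked occ x y" if xy: "x \<in> ?G" "y \<in> ?G" for x y
  proof -
    obtain b where b: "b \<in> cells m" "x \<in> core k occ b" using xy(1) by auto
    obtain b' where b': "b' \<in> cells m" "y \<in> core k occ b'" using xy(2) by auto
    have p: "(step_in (cells m))\<^sup>*\<^sup>* b b'"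
    proof (rule box_path)
      fix z assume z: "\<And>i. min (b $ i) (b' $ i) \<le> z $ i \<and> z $ i \<le> max (b $ i) (b' $ i)"
      show "z \<in> cells m" unfolding cells_def
      proof (intro CollectI allI)
        fix j
        have "0 \<le> b $ j \<and> b $ j < int m" "0 \<le> b' $ j \<and> b' $ j < int m" using b b' by (auto simp: cells_def)
        then show "0 \<le> z $ j \<and> z $ j < int m" using z[of j] by linarith
      qed
    qed
    show ?thesis
      by (rule path_linked[OF d _ _ p b(1,2) b'(2)], rule core_linked[OF d], assumption+, rule g)
  qed
  have "card ?G = (\<Sum>b\<in>cells m. card (core k occ b))"
    using core_block[of k occ] block_disjoint[of _ _ k]
    by (intro card_UN_disjoint) (auto simp: finite_core, blast)
  then have "real (card ?G) = (\<Sum>b\<in>cells m. real (card (core k occ b)))" by simp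
  also have "\<dots> \<ge> (\<Sum>b\<in>(cells m :: (int^'d) set). 1/2 * of_int (block_side k) ^ CARD('d))"
  proof (intro sum_mono)
    fix b :: "int^'d" assume "b \<in> cells m"
    then have "real (card (core k occ b)) \<ge> (1/2 + 1 / 2 ^ (k+1)) * of_int (block_side k) ^ CARD('d)"
      using card_core[OF d] g by blast
    moreover have "(1/2 + 1 / 2 ^ (k+1)) * (of_int (block_side k)::real) ^ CARD('d) \<ge> 1/2 * of_int (block_side k) ^ CARD('d)"
      using block_side_pos[of k] by (intro mult_right_mono) auto
    ultimately show "1/2 * of_int (block_side k) ^ CARD('d) \<le> real (card (core k occ b))" by linarith
  qed
  finally show "real (card ?G) \<ge> 1/2 * (real m * of_int (block_side k)) ^ CARD('d)"
    by (simp add: power_mult_distrib)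
qed


text \<open>Unfolding badness down to level 0 exhibits \<open>2 ^ k\<close> distinct vacant cells, so a union bound over
  these sets replaces any independence argument for the block events.\<close>

fun witness :: "nat \<Rightarrow> int^'d::finite \<Rightarrow> (int^'d) set set" where
  "witness 0 b = {{b}}"
| "witness (Suc k) b = {A \<union> B | A B c c'. c \<in> subblocks (ratio k) b \<and> c' \<in> subblocks (ratio k) b \<and> c \<noteq> c' \<and>
     A \<in> witness k c \<and> B \<in> witness k c'}"

lemma bad_witness: "\<not> good k occ b \<Longrightarrow> \<exists>A\<in>witness k b. \<forall>x\<in>A. \<not> occ x"
proof (induction k arbitrary: b)
  case (Suc k)
  have "\<forall>v. \<exists>c\<in>subblocks (ratio k) b. c \<noteq> v \<and> \<not> good k occ c" using Suc.prems by auto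
  \<comment> \<open>Any \<open>v\<close> yields a first bad subblock; taking that subblock as
    \<open>v\<close> yields a second one different from it.\<close>
  then obtain c c' where c: "c \<in> subblocks (ratio k) b" "\<not> good k occ c" "c' \<in> subblocks (ratio k) b" "\<not> good k occ c'" "c \<noteq> c'"
    by metis
  obtain A B where "A \<in> witness k c" "\<forall>x\<in>A. \<not> occ x" "B \<in> witness k c'" "\<forall>x\<in>B. \<not> occ x"
    using Suc.IH[OF c(2)] Suc.IH[OF c(4)] by blast
  then show ?case using c by (intro bexI[of _ "A \<union> B"]) auto
qed simp

lemma witness_props: "A \<in> witness k b \<Longrightarrow> finite A \<and> card A = 2 ^ k \<and> A \<subseteq> block k b"
proof (induction k arbitrary: A b)
  case 0 then show ?case by (auto simp: block_def)
next
  case (Suc k)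
  then obtain A1 A2 c c' where *: "A = A1 \<union> A2" "c \<in> subblocks (ratio k) b" "c' \<in> subblocks (ratio k) b" "c \<noteq> c'"
    "A1 \<in> witness k c" "A2 \<in> witness k c'" by auto
  have IH: "finite A1" "card A1 = 2 ^ k" "A1 \<subseteq> block k c" "finite A2" "card A2 = 2 ^ k" "A2 \<subseteq> block k c'"
    using Suc.IH[OF *(5)] Suc.IH[OF *(6)] by auto
  have "A1 \<inter> A2 = {}" using IH block_disjoint[OF *(4), of k] by blast
  then have "card A = 2 ^ Suc k" using IH by (simp add: *(1) card_Un_disjoint)
  moreover have "A \<subseteq> block (Suc k) b" using IH *(1) block_subset[OF *(2)] block_subset[OF *(3)] by blast
  ultimately show ?case using IH *(1) by simp
qed

text \<open>For the number \<open>W\<close> of witnesses the recursion is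
  \<open>W' \<le> (l^d * W)^2\<close> with \<open>l = 2^(k+2)\<close>. The factor
  \<open>X = 2^(2 d (k+3))\<close> is chosen to solve it: since \<open>2 d (k+2) + 2 d (k+4)\<close>
  is twice \<open>2 d (k+3)\<close>, one gets \<open>W' * X' \<le> (W * X)^2\<close>. The initial
  value of \<open>W * X\<close> is \<open>2^(6 d)\<close>, the source of the constant 6.\<close>

lemma card_witness:
  "finite (witness k b) \<and> card (witness k b) * 2 ^ (2 * CARD('d) * (k + 3)) \<le> (2 ^ (6 * CARD('d))) ^ (2 ^ k)"
  for b :: "int^'d::finite"
proof (induction k arbitrary: b)
  case 0 show ?case by simp
next
  case (Suc k)
  let ?d = "CARD('d)"
  define U where "U = (\<Union>c\<in>subblocks (ratio k) b. witness k c)"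
  define X where "X = (2::nat) ^ (2 * ?d * (k + 3))"
  have finU: "finite U" using Suc by (auto simp: U_def)
  have sub: "witness (Suc k) b \<subseteq> (\<lambda>(A, B). A \<union> B) ` (U \<times> U)"
  proof
    fix Y assume "Y \<in> witness (Suc k) b"
    then obtain A1 A2 c c' where "Y = A1 \<union> A2" "c \<in> subblocks (ratio k) b" "c' \<in> subblocks (ratio k) b"
      "A1 \<in> witness k c" "A2 \<in> witness k c'" by auto
    then show "Y \<in> (\<lambda>(A, B). A \<union> B) ` (U \<times> U)" by (intro image_eqI[of _ _ "(A1, A2)"]) (auto simp: U_def)
  qed
  then have fin: "finite (witness (Suc k) b)" using finU by (meson finite_SigmaI finite_imageI finite_subset)
  have "card (witness (Suc k) b) \<le> card ((\<lambda>(A, B). A \<union> B) ` (U \<times> U))" using sub finU by (intro card_mono) auto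
  also have "\<dots> \<le> card (U \<times> U)" using finU by (intro card_image_le) auto
  also have "\<dots> = (card U)\<^sup>2" by (simp add: card_cartesian_product power2_eq_square)
  finally have c1: "card (witness (Suc k) b) \<le> (card U)\<^sup>2" .
  have "card U * X \<le> (\<Sum>c\<in>subblocks (ratio k) b. card (witness k c)) * X"
    unfolding U_def by (intro mult_right_mono card_UN_le) auto
  also have "\<dots> = (\<Sum>c\<in>subblocks (ratio k) b. card (witness k c) * X)" by (simp add: sum_distrib_right)
  also have "\<dots> \<le> (\<Sum>c\<in>subblocks (ratio k) b. (2 ^ (6 * ?d)) ^ (2 ^ k))"
    unfolding X_def using Suc by (intro sum_mono) blast
  also have "\<dots> = 2 ^ ((k + 2) * ?d) * (2 ^ (6 * ?d)) ^ (2 ^ k)"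
    by (simp only: sum_constant card_subblocks nat_ratio power_mult of_nat_id)
  finally have c2: "card U * X \<le> 2 ^ ((k + 2) * ?d) * (2 ^ (6 * ?d)) ^ (2 ^ k)" .
  have "2 ^ (2 * ((k + 2) * ?d)) * (card (witness (Suc k) b) * 2 ^ (2 * ?d * (Suc k + 3))) = card (witness (Suc k) b) * X\<^sup>2"
    by (simp add: X_def power_add[symmetric] power_mult[symmetric] algebra_simps)
  also have "\<dots> \<le> (card U)\<^sup>2 * X\<^sup>2" using c1 by (intro mult_right_mono) auto
  also have "\<dots> = (card U * X)\<^sup>2" by (simp add: power_mult_distrib)
  also have "\<dots> \<le> (2 ^ ((k + 2) * ?d) * (2 ^ (6 * ?d)) ^ (2 ^ k))\<^sup>2" using c2 by (intro power_mono) auto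
  also have "\<dots> = 2 ^ (2 * ((k + 2) * ?d)) * (2 ^ (6 * ?d)) ^ (2 ^ Suc k)"
    by (simp add: power_mult_distrib power_mult[symmetric] mult_ac)
  finally have "card (witness (Suc k) b) * 2 ^ (2 * ?d * (Suc k + 3)) \<le> (2 ^ (6 * ?d)) ^ (2 ^ Suc k)"
    by (simp del: power_Suc add_Suc)
  then show ?case using fin by blast
qed

section \<open>The probability of a bad block, and percolation in a large box\<close>

lemma prob_all_zero:
  assumes "finite A" "W \<subseteq> A" "v > 0"
  shows "measure_pmf.prob (Pi_pmf A 0 (\<lambda>_. poisson_pmf v)) {f. \<forall>x\<in>W. f x = 0} = exp (- v) ^ card W"
proof -
  have "{f. \<forall>x\<in>W. f x = (0::nat)} = Pi A (\<lambda>x. if x \<in> W then {0} else UNIV)"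
    using assms(2) by (auto simp: Pi_def split: if_splits)
  then have "measure_pmf.prob (Pi_pmf A 0 (\<lambda>_. poisson_pmf v)) {f. \<forall>x\<in>W. f x = 0}
     = (\<Prod>x\<in>A. measure_pmf.prob (poisson_pmf v) (if x \<in> W then {0} else UNIV))"
    using assms(1) by (simp add: measure_Pi_pmf_Pi)
  also have "\<dots> = (\<Prod>x\<in>A. if x \<in> W then exp (- v) else 1)"
    using assms(3) by (intro prod.cong) (auto simp: measure_pmf_single)
  also have "\<dots> = (\<Prod>x\<in>W. exp (- v))"
    using assms by (simp add: prod.If_cases Int_absorb1 Int_commute)
  finally show ?thesis by simp
qed

text \<open>Each of the \<open>2^k\<close> vacant cells of a witness costs
  \<open>2^(-6 d - 1)\<close>, against an entropy of at most \<open>2^(6 d)\<close> per cell; a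
  factor 1/2 per cell remains. The power of 2 kept on the left pays for the number of blocks in
  \<open>percolation\<close>.\<close>

lemma prob_bad:
  fixes b :: "int^'d::finite"
  assumes sub: "block k b \<subseteq> cells M" and v: "v > 0" "exp (- v) \<le> 1 / 2 ^ (6 * CARD('d) + 1)"
  shows "2 ^ (2 * CARD('d) * (k + 3)) *
     measure_pmf.prob (Pi_pmf (cells M) 0 (\<lambda>_. poisson_pmf v)) {f. \<not> good k (\<lambda>x. f x > 0) b} \<le> 1 / 2 ^ (2 ^ k)"
proof -
  let ?q = "Pi_pmf (cells M :: (int^'d) set) 0 (\<lambda>_. poisson_pmf v)"
  let ?X = "2 ^ (2 * CARD('d) * (k + 3)) :: real"
  have fin: "finite (witness k b)" and cw: "card (witness k b) * 2 ^ (2 * CARD('d) * (k + 3)) \<le> (2 ^ (6 * CARD('d))) ^ (2 ^ k)"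
    using card_witness by blast+
  have "{f. \<not> good k (\<lambda>x. f x > 0) b} \<subseteq> (\<Union>W\<in>witness k b. {f. \<forall>x\<in>W. f x = (0::nat)})"
    using bad_witness[of k _ b] by fastforce
  then have "measure_pmf.prob ?q {f. \<not> good k (\<lambda>x. f x > 0) b} \<le> measure_pmf.prob ?q (\<Union>W\<in>witness k b. {f. \<forall>x\<in>W. f x = 0})"
    by (intro measure_pmf.finite_measure_mono) auto
  also have "\<dots> \<le> (\<Sum>W\<in>witness k b. measure_pmf.prob ?q {f. \<forall>x\<in>W. f x = 0})"
    using fin by (intro measure_pmf.finite_measure_subadditive_finite) auto
  also have "\<dots> = (\<Sum>W\<in>witness k b. exp (- v) ^ (2 ^ k))"
  proof (intro sum.cong refl)
    fix W assume "W \<in> witness k b"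
    from witness_props[OF this] sub show "measure_pmf.prob ?q {f. \<forall>x\<in>W. f x = 0} = exp (- v) ^ (2 ^ k)"
      using v(1) by (subst prob_all_zero) auto
  qed
  also have "\<dots> = real (card (witness k b)) * exp (- v) ^ (2 ^ k)" by simp
  finally have "?X * measure_pmf.prob ?q {f. \<not> good k (\<lambda>x. f x > 0) b} \<le> ?X * (real (card (witness k b)) * exp (- v) ^ (2 ^ k))"
    by (intro mult_left_mono) auto
  also have "\<dots> = (real (card (witness k b)) * ?X) * exp (- v) ^ (2 ^ k)" by simp
  also have "\<dots> \<le> (2 ^ (6 * CARD('d))) ^ (2 ^ k) * (1 / 2 ^ (6 * CARD('d) + 1)) ^ (2 ^ k)"
  proof (intro mult_mono power_mono v(2))
    have "real (card (witness k b) * 2 ^ (2 * CARD('d) * (k + 3))) \<le> real ((2 ^ (6 * CARD('d))) ^ (2 ^ k))"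
      using cw by (rule of_nat_mono)
    then show "real (card (witness k b)) * ?X \<le> (2 ^ (6 * CARD('d))) ^ (2 ^ k)" by simp
  qed auto
  also have "\<dots> = ((2 ^ (6 * CARD('d))) * (1 / 2 ^ (6 * CARD('d) + 1))) ^ (2 ^ k)" by (rule power_mult_distrib[symmetric])
  also have "(2 ^ (6 * CARD('d))) * (1 / 2 ^ (6 * CARD('d) + 1)) = (1/2 :: real)" by simp
  finally show ?thesis by (simp add: power_one_over)
qed

text \<open>The scale is the largest one fitting into \<open>M\<close>, so that fewer than
  \<open>ratio k\<close> blocks fit side by side; \<open>k \<ge> k0\<close> makes the failure
  probability small.\<close>

lemma block_side_interval:
  assumes "block_side k0 \<le> int M"
  shows "\<exists>k\<ge>k0. block_side k \<le> int M \<and> int M < block_side (Suc k)"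
proof -
  have grow: "block_side k \<ge> int k" for k
  proof (induction k)
    case (Suc k)
    have "block_side (Suc k) \<ge> 4 * block_side k" using ratio_ge[of k] block_side_pos[of k] by simp
    then show ?case using Suc block_side_pos[of k] by linarith
  qed simp
  define k where "k = (LEAST k. int M < block_side (Suc k) \<and> k \<ge> k0)"
  have "int M < block_side (Suc (M + k0))" using grow[of "Suc (M + k0)"] by linarith
  then have k: "int M < block_side (Suc k) \<and> k \<ge> k0"
    unfolding k_def by (intro LeastI[where P = "\<lambda>k. int M < block_side (Suc k) \<and> k \<ge> k0" and k = "M + k0"]) auto
  have "block_side k \<le> int M"
  proof (cases "k = k0")
    case False
    then obtain j where j: "k = Suc j" "j \<ge> k0" using k by (cases k) auto
    then have "\<not> (int M < block_side (Suc j) \<and> j \<ge> k0)"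
      using not_less_Least[of j "\<lambda>k. int M < block_side (Suc k) \<and> k \<ge> k0"] unfolding k_def[symmetric] by simp
    then show ?thesis using j by simp
  qed (use assms in simp)
  then show ?thesis using k by blast
qed

lemma percolation:
  assumes d: "CARD('d::finite) \<ge> 2" and v: "v > 0" "exp (- v) \<le> 1 / 2 ^ (6 * CARD('d) + 1)"
    and M: "block_side k0 \<le> int M"
  shows "measure_pmf.prob (Pi_pmf (cells M :: (int^'d) set) 0 (\<lambda>_. poisson_pmf v))
    {f. \<not> (\<exists>G. finite G \<and> (\<forall>x\<in>G. f x > 0) \<and> (\<forall>x\<in>G. \<forall>y\<in>G. linked (\<lambda>x. f x > 0) x y) \<and>
       real (card G) \<ge> 1/2 * (real M / 2) ^ CARD('d))} \<le> 1 / 2 ^ k0"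
proof -
  let ?q = "Pi_pmf (cells M :: (int^'d) set) 0 (\<lambda>_. poisson_pmf v)"
  obtain k where k: "k \<ge> k0" "block_side k \<le> int M" "int M < block_side (Suc k)" using block_side_interval[OF M] by blast
  define m where "m = nat (int M div block_side k)"
  have sp: "block_side k > 0" by (rule block_side_pos)
  have dm: "int M = (int M div block_side k) * block_side k + int M mod block_side k" "0 \<le> int M mod block_side k" "int M mod block_side k < block_side k"
    using sp by simp_all
  have "int M div block_side k \<ge> 1" using zdiv_mono1[OF k(2) sp] sp by simp
  then have m: "int m = int M div block_side k" "m \<ge> 1" by (auto simp: m_def)
  have mM: "int m * block_side k \<le> int M" unfolding m(1) using dm by linarith
  have "1 * block_side k \<le> int m * block_side k" using m sp by (intro mult_right_mono) auto
  then have M2: "int M < 2 * (int m * block_side k)" unfolding m(1) using dm by linarith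
  have "int m * block_side k < ratio k * block_side k" using mM k by simp
  then have "int m < ratio k" using sp by simp
  then have "real_of_int (int m) \<le> real_of_int (ratio k)" by (intro iffD2[OF of_int_le_iff]) simp
  then have "real m \<le> 2 ^ (k + 2)" by (simp add: ratio_def)
  then have "real m ^ CARD('d) \<le> (2 ^ (k+2)) ^ CARD('d)" by (intro power_mono) auto
  also have "\<dots> \<le> 2 ^ (2 * CARD('d) * (k + 3))"
    unfolding power_mult[symmetric] by (rule power_increasing) (simp_all add: algebra_simps)
  finally have mX: "real m ^ CARD('d) \<le> 2 ^ (2 * CARD('d) * (k + 3))" .
  let ?bad = "{f. \<not> (\<exists>G. finite G \<and> (\<forall>x\<in>G. f x > 0) \<and> (\<forall>x\<in>G. \<forall>y\<in>G. linked (\<lambda>x. f x > 0) x y) \<and>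
       real (card G) \<ge> 1/2 * (real M / 2) ^ CARD('d))} :: (int^'d \<Rightarrow> nat) set"
  have bl: "block k b \<subseteq> cells M" if b: "b \<in> cells m" for b :: "int^'d"
  proof
    fix x assume x: "x \<in> block k b"
    show "x \<in> cells M" unfolding cells_def
    proof (intro CollectI allI)
      fix i
      have bi: "0 \<le> b $ i" "b $ i + 1 \<le> int m" using b by (auto simp: cells_def add1_zle_eq)
      have "0 \<le> block_side k * b $ i" using bi sp by simp
      moreover have "block_side k * (b $ i + 1) \<le> block_side k * int m" using bi sp by (intro mult_left_mono) auto
      moreover have "block_side k * b $ i \<le> x $ i" "x $ i < block_side k * (b $ i + 1)" using x by (auto simp: block_def)
      ultimately show "0 \<le> x $ i \<and> x $ i < int M" using mM by (simp add: mult.commute)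
    qed
  qed
  have "?bad \<subseteq> (\<Union>b\<in>cells m. {f. \<not> good k (\<lambda>x. f x > 0) b})"
  proof
    fix f assume f: "f \<in> ?bad"
    show "f \<in> (\<Union>b\<in>cells m. {f. \<not> good k (\<lambda>x. f x > 0) b})"
    proof (rule ccontr)
      assume "f \<notin> (\<Union>b\<in>cells m. {f. \<not> good k (\<lambda>x. f x > 0) b})"
      then have "\<And>b. b \<in> cells m \<Longrightarrow> good k (\<lambda>x. f x > 0) b" by auto
      from giant_cells[OF d this] obtain G where G: "finite G \<and> (\<forall>x\<in>G. f x > 0) \<and> (\<forall>x\<in>G. \<forall>y\<in>G. linked (\<lambda>x. f x > 0) x y) \<and>
        real (card G) \<ge> 1/2 * (real m * of_int (block_side k)) ^ CARD('d)" ..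
      have "real_of_int (int M) < real_of_int (2 * (int m * block_side k))" using M2 by (rule iffD2[OF of_int_less_iff])
      then have "real M / 2 \<le> real m * of_int (block_side k)" by simp
      then have "(real M / 2) ^ CARD('d) \<le> (real m * of_int (block_side k)) ^ CARD('d)" by (intro power_mono) auto
      then have cG: "real (card G) \<ge> 1/2 * (real M / 2) ^ CARD('d)" using G by linarith
      show False by (rule notE[OF f[unfolded mem_Collect_eq]], rule exI[of _ G]) (use G cG in simp)
    qed
  qed
  then have "measure_pmf.prob ?q ?bad \<le> measure_pmf.prob ?q (\<Union>b\<in>cells m. {f. \<not> good k (\<lambda>x. f x > 0) b})"
    by (intro measure_pmf.finite_measure_mono) auto
  also have "\<dots> \<le> (\<Sum>b\<in>cells m. measure_pmf.prob ?q {f. \<not> good k (\<lambda>x. f x > 0) b})"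
    by (intro measure_pmf.finite_measure_subadditive_finite) auto
  also have "\<dots> \<le> (\<Sum>b\<in>(cells m :: (int^'d) set). (1 / 2 ^ (2 ^ k)) / 2 ^ (2 * CARD('d) * (k + 3)))"
  proof (intro sum_mono)
    fix b :: "int^'d" assume "b \<in> cells m"
    from prob_bad[OF bl[OF this] v]
    show "measure_pmf.prob ?q {f. \<not> good k (\<lambda>x. f x > 0) b} \<le> (1 / 2 ^ (2 ^ k)) / 2 ^ (2 * CARD('d) * (k + 3))"
      by (simp add: pos_le_divide_eq mult_ac)
  qed
  also have "\<dots> = real m ^ CARD('d) / 2 ^ (2 * CARD('d) * (k + 3)) * (1 / 2 ^ (2 ^ k))" by simp
  also have "\<dots> \<le> 1 * (1 / 2 ^ (2 ^ k))" using mX by (intro mult_right_mono) auto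
  also have "\<dots> \<le> 1 / 2 ^ k0"
  proof -
    have "k0 \<le> 2 ^ k" using k(1) less_exp[of k] by linarith
    then have "(2::real) ^ k0 \<le> 2 ^ (2 ^ k)" by (intro power_increasing) auto
    then show ?thesis by (simp add: frac_le)
  qed
  finally show ?thesis .
qed

subsection \<open>Existence of a giant component\<close>

lemma measurable_fst_PPP [measurable]: "fst \<in> measurable (PPP n) (count_space UNIV)"
  unfolding PPP_unif by (rule measurable_compose[OF measurable_fst]) simp

lemma measurable_point [measurable]: "(\<lambda>\<omega>. snd \<omega> !! j) \<in> measurable (PPP n) borel"
proof -
  have "(\<lambda>\<omega>. snd \<omega> !! j) \<in> measurable (PPP n) (unif n)" unfolding PPP_unif by measurable
  then show ?thesis by (simp cong: measurable_cong_sets)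
qed

lemma measurable_component [measurable (raw)]:
  fixes f :: "'a \<Rightarrow> real^'d::finite"
  shows "f \<in> measurable N borel \<Longrightarrow> (\<lambda>x. f x $ i) \<in> borel_measurable N"
  by (rule measurable_compose[OF _ measurable_vec_nth_borel])

lemma measurable_tdist [measurable (raw)]:
  fixes f g :: "'a \<Rightarrow> real^'d::finite"
  assumes [measurable]: "f \<in> measurable N borel" "g \<in> measurable N borel"
  shows "(\<lambda>x. tdist n (f x) (g x)) \<in> borel_measurable N"
  unfolding tdist_def Let_def by measurable

text \<open>Coordinates are translated independently, so the quantifier over integer vectors turns
  into one over a single integer for each coordinate, within reach of countable unions.\<close>

lemma tcube_alt: "tcube n c s = {x \<in> torus n. \<forall>i. \<exists>k::int. c $ i \<le> x $ i + side TYPE('d) n * real_of_int k \<and>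
      x $ i + side TYPE('d) n * real_of_int k \<le> c $ i + s}" for c :: "real^'d::finite"
proof -
  have "(\<exists>k::int^'d. \<forall>i. P i (k $ i)) \<longleftrightarrow> (\<forall>i. \<exists>k. P i k)" for P
  proof
    assume "\<forall>i. \<exists>k. P i k"
    then obtain f where "\<And>i. P i (f i)" by metis
    then show "\<exists>k::int^'d. \<forall>i. P i (k $ i)" by (intro exI[of _ "\<chi> i. f i"]) simp
  qed blast
  from this[of "\<lambda>i k. c $ i \<le> x $ i + side TYPE('d) n * real_of_int k \<and> x $ i + side TYPE('d) n * real_of_int k \<le> c $ i + s" for x]
  show ?thesis unfolding tcube_def by (intro Collect_cong conj_cong refl)
qed

lemma sets_tcube [measurable]: "tcube n c s \<in> sets borel" for c :: "real^'d::finite"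
  unfolding tcube_alt by measurable

text \<open>The event is split by the number of points and the relation realised on them. For each
  number there are finitely many relations, so every \<open>Q\<close> gives a countable union of
  measurable pieces.\<close>

lemma sets_PPP_finite_structure:
  fixes R :: "nat \<times> (real^'d::finite) stream \<Rightarrow> nat \<Rightarrow> nat \<Rightarrow> bool"
  assumes R [measurable]: "\<And>j k. Measurable.pred (PPP n) (\<lambda>\<omega>. R \<omega> j k)"
  shows "{\<omega>. Q (fst \<omega>) {(j, k). j < fst \<omega> \<and> k < fst \<omega> \<and> R \<omega> j k}} \<in> sets (PPP n)"
proof -
  let ?E = "\<lambda>N E. {\<omega> \<in> space (PPP n). fst \<omega> = N \<and> (\<forall>j\<in>{..<N}. \<forall>k\<in>{..<N}. R \<omega> j k \<longleftrightarrow> (j, k) \<in> E)}"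
  have "{\<omega>. Q (fst \<omega>) {(j, k). j < fst \<omega> \<and> k < fst \<omega> \<and> R \<omega> j k}}
    = (\<Union>N. \<Union>E\<in>{E. E \<subseteq> {..<N} \<times> {..<N} \<and> Q N E}. ?E N E)" (is "?L = ?R")
  proof (intro equalityI subsetI)
    fix \<omega> assume "\<omega> \<in> ?L"
    then show "\<omega> \<in> ?R"
      by (intro UN_I[of "fst \<omega>"] UN_I[of "{(j, k). j < fst \<omega> \<and> k < fst \<omega> \<and> R \<omega> j k}"]) auto
  next
    fix \<omega> assume "\<omega> \<in> ?R"
    then obtain N E where E: "E \<subseteq> {..<N} \<times> {..<N}" "Q N E" "fst \<omega> = N" "\<forall>j\<in>{..<N}. \<forall>k\<in>{..<N}. R \<omega> j k \<longleftrightarrow> (j, k) \<in> E"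
      by auto
    have "{(j, k). j < fst \<omega> \<and> k < fst \<omega> \<and> R \<omega> j k} = E" using E by auto
    then show "\<omega> \<in> ?L" using E by simp
  qed
  also have "\<dots> \<in> sets (PPP n)"
  proof -
    have "(\<Union>E\<in>{E. E \<subseteq> {..<N} \<times> {..<N} \<and> Q N E}. ?E N E) \<in> sets (PPP n)" for N
    proof (rule sets.finite_UN)
      show "finite {E. E \<subseteq> {..<N} \<times> {..<N} \<and> Q N E}"
        by (rule finite_subset[of _ "Pow ({..<N} \<times> {..<N})"]) auto
      show "?E N E \<in> sets (PPP n)" for E by measurable
    qed
    then show ?thesis by (intro sets.countable_UN) auto
  qed
  finally show ?thesis .
qed

lemma sets_has_giant: "{\<omega>. has_giant TYPE('d::finite) n r c \<omega>} \<in> sets (PPP n)"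
proof -
  define Q where "Q N E \<longleftrightarrow> (\<exists>j<N. real (card {k. k < N \<and> (\<lambda>j k. (j, k) \<in> E \<and> j \<noteq> k)\<^sup>*\<^sup>* j k}) \<ge> c * real n)"
    for N :: nat and E
  have "has_giant TYPE('d) n r c \<omega> \<longleftrightarrow> Q (fst \<omega>) {(j, k). j < fst \<omega> \<and> k < fst \<omega> \<and> tdist n (snd \<omega> !! j) (snd \<omega> !! k) \<le> r}" for \<omega> :: "nat \<times> (real^'d) stream"
  proof -
    have "adj n r \<omega> = (\<lambda>j k. (j, k) \<in> {(j, k). j < fst \<omega> \<and> k < fst \<omega> \<and> tdist n (snd \<omega> !! j) (snd \<omega> !! k) \<le> r} \<and> j \<noteq> k)"
      by (auto simp: adj_def fun_eq_iff)
    then show ?thesis by (simp add: has_giant_def comp_size_def Q_def)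
  qed
  then show ?thesis by (simp only:) (rule sets_PPP_finite_structure, measurable)
qed

lemma sets_deg_sum:
  fixes B :: "(real^'d::finite) set"
  assumes [measurable]: "B \<in> sets borel"
  shows "{\<omega>. P (deg_sum n r \<omega> B)} \<in> sets (PPP n)"
proof -
  define Q where "Q N E \<longleftrightarrow> P (\<Sum>j\<in>{j. j < N \<and> (j, j) \<in> E}. card {k. (j, k) \<in> E \<and> j \<noteq> k})"
    for N :: nat and E
  \<comment> \<open>Adjacency never relates a point to itself, so the diagonal is free to record
    membership in \<open>B\<close>.\<close>
  define R where "R \<omega> j k \<longleftrightarrow> (if j = k then snd \<omega> !! j \<in> B else tdist n (snd \<omega> !! j) (snd \<omega> !! k) \<le> r)"
    for \<omega> :: "nat \<times> (real^'d) stream" and j k :: nat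
  have R: "Measurable.pred (PPP n) (\<lambda>\<omega>. R \<omega> j k)" for j k
    by (cases "j = k") (simp_all add: R_def)
  have "P (deg_sum n r \<omega> B) \<longleftrightarrow> Q (fst \<omega>) {(j, k). j < fst \<omega> \<and> k < fst \<omega> \<and> R \<omega> j k}" for \<omega> :: "nat \<times> (real^'d) stream"
  proof -
    have "{k. adj n r \<omega> j k} = {k. (j, k) \<in> {(j, k). j < fst \<omega> \<and> k < fst \<omega> \<and> R \<omega> j k} \<and> j \<noteq> k}" for j
      by (auto simp: adj_def R_def)
    moreover have "{j. j < fst \<omega> \<and> snd \<omega> !! j \<in> B} = {j. j < fst \<omega> \<and> (j, j) \<in> {(j, k). j < fst \<omega> \<and> k < fst \<omega> \<and> R \<omega> j k}}"
      by (auto simp: R_def)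
    ultimately show ?thesis by (simp add: deg_sum_def degree_def Q_def)
  qed
  then show ?thesis by (simp only:) (rule sets_PPP_finite_structure[OF R])
qed

text \<open>The outcome space contains all streams of vectors, while the bounds relating points to
  their cells hold only on the torus.\<close>

lemma AE_points_in_torus:
  assumes "n > 0"
  shows "AE \<omega> in PPP n. \<forall>j. snd \<omega> !! j \<in> (torus n :: (real^'d::finite) set)"
proof (subst AE_all_countable, intro allI)
  fix j
  interpret U: prob_space "unif n :: (real^'d) measure" using assms by (rule prob_space_unif)
  interpret S: prob_space "stream_space (unif n :: (real^'d) measure)" by (rule U.prob_space_stream_space)
  interpret pair_sigma_finite "measure_pmf (poisson_pmf (real n))" "stream_space (unif n :: (real^'d) measure)" ..
  have "AE x in (unif n :: (real^'d) measure). x \<in> torus n"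
    unfolding unif_def by (intro AE_uniform_measureI) auto
  then have "AE s in stream_space (unif n :: (real^'d) measure). stream_all (\<lambda>x. x \<in> torus n) s"
    by (intro U.AE_stream_all) auto
  then have A: "AE s in stream_space (unif n :: (real^'d) measure). s !! j \<in> torus n"
    by eventually_elim (auto simp: stream.pred_set)
  show "AE \<omega> in PPP n. snd \<omega> !! j \<in> (torus n :: (real^'d) set)"
    unfolding PPP_unif
  proof (rule AE_pair_measure)
    have "{\<omega> \<in> space (PPP n). snd \<omega> !! j \<in> (torus n :: (real^'d) set)} \<in> sets (PPP n)" by measurable
    then show "{\<omega> \<in> space (measure_pmf (poisson_pmf (real n)) \<Otimes>\<^sub>M stream_space (unif n)).
         snd \<omega> !! j \<in> (torus n :: (real^'d) set)} \<in> sets (measure_pmf (poisson_pmf (real n)) \<Otimes>\<^sub>M stream_space (unif n))"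
      by (simp only: PPP_unif)
    show "AE x in measure_pmf (poisson_pmf (real n)). AE y in stream_space (unif n).
       snd (x, y) !! j \<in> (torus n :: (real^'d) set)" using A by simp
  qed
qed

text \<open>Only lower bounds on probabilities are transferred, so a one-sided implication from the
  counts to the geometric event suffices, and a null set may be ignored.\<close>

lemma PPP_prob_ge_cnt:
  fixes Q :: "(int^'d::finite \<Rightarrow> nat) \<Rightarrow> bool"
  assumes n: "n > 0" and M: "M > 0" and E: "E \<in> sets (PPP n)"
    and imp: "\<And>\<omega>. (\<And>j. snd \<omega> !! j \<in> torus n) \<Longrightarrow> Q (cnt n M \<omega>) \<Longrightarrow> \<omega> \<in> E"
  shows "measure (PPP n) E \<ge> measure_pmf.prob (Pi_pmf (cells M) 0 (\<lambda>_. poisson_pmf (real n / real M ^ CARD('d)))) {f. Q f}"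
proof -
  interpret prob_space "PPP n :: (nat \<times> (real^'d) stream) measure" using n by (rule prob_space_PPP)
  have "measure (PPP n) {\<omega>. Q (cnt n M \<omega>)} \<le> measure (PPP n) E"
  proof (rule finite_measure_mono_AE[OF _ E])
    show "AE \<omega> in PPP n. \<omega> \<in> {\<omega>. Q (cnt n M \<omega>)} \<longrightarrow> \<omega> \<in> E"
      using AE_points_in_torus[OF n, where ?'d='d] by eventually_elim (use imp in auto)
  qed
  then show ?thesis using cnt_law(2)[OF n M, of Q] by simp
qed

section \<open>From linked occupied cells to a giant component\<close>

lemma tdist_le_norm:
  fixes x y :: "real^'d::finite"
  assumes "n > 0"
  shows "tdist n x y \<le> norm (x - y)"
proof -
  define L where "L = side TYPE('d) n"
  have L: "L > 0" using assms by (simp add: L_def side_pos)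
  have "(min t (L - t))\<^sup>2 \<le> (norm (x $ i - y $ i))\<^sup>2"
    if t: "t = \<bar>x $ i - y $ i\<bar> - L * real_of_int \<lfloor>\<bar>x $ i - y $ i\<bar> / L\<rfloor>" for i t
  proof -
    define u where "u = \<bar>x $ i - y $ i\<bar>"
    have "0 \<le> real_of_int \<lfloor>u / L\<rfloor>" using L by (simp add: u_def)
    moreover have "real_of_int \<lfloor>u / L\<rfloor> \<le> u / L" "u / L < real_of_int \<lfloor>u / L\<rfloor> + 1" by linarith+
    ultimately have "0 \<le> L * real_of_int \<lfloor>u / L\<rfloor>" "L * real_of_int \<lfloor>u / L\<rfloor> \<le> L * (u / L)"
      "L * (u / L) < L * (real_of_int \<lfloor>u / L\<rfloor> + 1)"
      using L by (intro mult_nonneg_nonneg mult_left_mono mult_strict_left_mono; simp)+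
    then have "0 \<le> t" "t \<le> u" "t < L" using L unfolding t u_def[symmetric] by (simp_all add: algebra_simps)
    then have "0 \<le> min t (L - t)" "min t (L - t) \<le> norm (x $ i - y $ i)" by (auto simp: u_def)
    then show ?thesis by (intro power_mono)
  qed
  then show ?thesis
    unfolding tdist_def norm_vec_def L2_set_def Let_def L_def
    by (intro real_sqrt_le_mono sum_mono) auto
qed

lemma tdist_adjacent_cells:
  fixes x y :: "real^'d::finite"
  assumes n: "n > 0" and M: "M > 0" and xy: "x \<in> torus n" "y \<in> torus n"
    and c: "cell n M x = cell n M y \<or> nbr (cell n M x) (cell n M y)"
  shows "tdist n x y \<le> 2 * (side TYPE('d) n / real M) * real CARD('d)"
proof -
  define a where "a = side TYPE('d) n / real M"
  have a: "a > 0" using n M by (simp add: a_def side_pos)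
  have "\<bar>(x - y) $ i\<bar> \<le> 2 * a" for i
  proof -
    have "\<bar>cell n M x $ i - cell n M y $ i\<bar> \<le> 1" using c by (auto simp: nbr_def) (metis abs_zero diff_self order_refl zero_le_one)
    then have ci: "real_of_int (cell n M x $ i) \<le> real_of_int (cell n M y $ i) + 1" "real_of_int (cell n M y $ i) \<le> real_of_int (cell n M x $ i) + 1"
      by linarith+
    have "a * (real_of_int (cell n M x $ i) + 1) \<le> a * (real_of_int (cell n M y $ i) + 2)"
      "a * (real_of_int (cell n M y $ i) + 1) \<le> a * (real_of_int (cell n M x $ i) + 2)"
      using ci a by (auto intro!: mult_left_mono)
    then show ?thesis
      using cell_bounds[OF xy(1) M n, of i] cell_bounds[OF xy(2) M n, of i] unfolding a_def[symmetric]
      by (auto simp: algebra_simps abs_le_iff)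
  qed
  then have "(\<Sum>i\<in>UNIV. \<bar>(x - y) $ i\<bar>) \<le> (\<Sum>i\<in>(UNIV::'d set). 2 * a)" by (intro sum_mono) auto
  then have "norm (x - y) \<le> 2 * a * real CARD('d)" using norm_le_l1_cart[of "x - y"] by (simp add: mult_ac)
  then show ?thesis using tdist_le_norm[OF n, of x y] by (simp add: a_def)
qed

text \<open>One point is chosen in each cell of \<open>G\<close>. Distinct cells give distinct
  points, and a path of occupied cells lifts to a path of the graph because points of equal or
  neighbouring cells are within distance \<open>r\<close>.\<close>

lemma has_giant_of_linked_cells:
  fixes \<omega> :: "nat \<times> (real^'d::finite) stream"
  assumes n: "n > 0" and M: "M > 0" and tor: "\<And>j. snd \<omega> !! j \<in> torus n"
    and r: "2 * (side TYPE('d) n / real M) * real CARD('d) \<le> r"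
    and G: "finite G" "\<And>x. x \<in> G \<Longrightarrow> cnt n M \<omega> x > 0" "\<And>x y. x \<in> G \<Longrightarrow> y \<in> G \<Longrightarrow> linked (\<lambda>x. cnt n M \<omega> x > 0) x y"
    and c: "real (card G) \<ge> c * real n" and ne: "G \<noteq> {}"
  shows "has_giant TYPE('d) n r c \<omega>"
proof -
  have ex: "\<exists>j. j < fst \<omega> \<and> cell n M (snd \<omega> !! j) = x" if "cnt n M \<omega> x > 0" for x
    using that by (metis (mono_tags, lifting) card.empty cnt_def empty_Collect_eq less_numeral_extra(3))
  have one: "(adj n r \<omega>)\<^sup>*\<^sup>* j k" if "j < fst \<omega>" "k < fst \<omega>"
    "cell n M (snd \<omega> !! j) = cell n M (snd \<omega> !! k) \<or> nbr (cell n M (snd \<omega> !! j)) (cell n M (snd \<omega> !! k))" for j k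
  proof (cases "j = k")
    case False
    have "tdist n (snd \<omega> !! j) (snd \<omega> !! k) \<le> r" using tdist_adjacent_cells[OF n M tor tor that(3)] r by linarith
    then show ?thesis using that False by (auto simp: adj_def)
  qed simp
  have link: "(adj n r \<omega>)\<^sup>*\<^sup>* j k" if l: "linked (\<lambda>x. cnt n M \<omega> x > 0) x y" and j: "j < fst \<omega>" "cell n M (snd \<omega> !! j) = x"
    and k: "k < fst \<omega>" "cell n M (snd \<omega> !! k) = y" for j k x y
    using l k unfolding linked_def
  proof (induction arbitrary: k rule: rtranclp_induct)
    case base
    then show ?case using one j by simp
  next
    case (step u w)
    have "cnt n M \<omega> u > 0" "nbr u w" using step.hyps(2) by (auto simp: step_in_def)
    then obtain m where m: "m < fst \<omega>" "cell n M (snd \<omega> !! m) = u" using ex by blast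
    have "(adj n r \<omega>)\<^sup>*\<^sup>* j m" using step.IH[OF m] .
    also have "(adj n r \<omega>)\<^sup>*\<^sup>* m k" using one[OF m(1) step.prems(1)] m(2) step.prems(2) \<open>nbr u w\<close> by simp
    finally show ?case .
  qed
  define p where "p x = (SOME j. j < fst \<omega> \<and> cell n M (snd \<omega> !! j) = x)" for x
  have p: "p x < fst \<omega> \<and> cell n M (snd \<omega> !! p x) = x" if "x \<in> G" for x
    unfolding p_def using someI_ex[OF ex[OF G(2)[OF that]]] .
  obtain x0 where x0: "x0 \<in> G" using ne by blast
  have inj: "inj_on p G" using p by (metis inj_onI)
  have "p ` G \<subseteq> {k. k < fst \<omega> \<and> (adj n r \<omega>)\<^sup>*\<^sup>* (p x0) k}"
    using p x0 G(3) link by blast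
  then have "card G \<le> comp_size n r \<omega> (p x0)"
    unfolding comp_size_def card_image[OF inj, symmetric] by (intro card_mono) auto
  then have "c * real n \<le> real (comp_size n r \<omega> (p x0))" using c by linarith
  then show ?thesis unfolding has_giant_def using p[OF x0] by blast
qed

lemma side_tendsto: "filterlim (\<lambda>n. side TYPE('d::finite) n) at_top sequentially"
proof -
  have "1 / real CARD('d) > 0" by simp
  then show ?thesis unfolding side_def by real_asymp
qed

lemma prob_pmf_not: "measure_pmf.prob p {x. \<not> Q x} = 1 - measure_pmf.prob p {x. Q x}"
  using measure_pmf.prob_compl[of "{x. Q x}" p] by (simp add: Compl_eq_Diff_UNIV[symmetric] Collect_neg_eq)

lemma giant_exists:
  assumes d: "CARD('d::finite) \<ge> 2"
  shows "\<exists>r>0. \<exists>c>0. (\<lambda>n. measure (PPP n :: (nat \<times> (real^'d) stream) measure)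
              {\<omega> \<in> space (PPP n). has_giant TYPE('d) n r c \<omega>}) \<longlonglongrightarrow> 1"
proof -
  \<comment> \<open>The cells will have side between \<open>a1\<close> and \<open>2 * a1\<close>,
    hence mean occupation at least \<open>a1\<close>, and \<open>exp (- a1)\<close> is below the
    threshold \<open>2^(-6 d - 1)\<close> of \<open>percolation\<close>. Points of neighbouring
    cells are then within \<open>2 * (2 * a1) * d\<close>, which is \<open>r\<close>. As
    \<open>n \<le> (2 * a1 * M)^d\<close>, the constant \<open>c\<close> gives
    \<open>c * n \<le> 1/2 * (M / 2)^d\<close>.\<close>
  define a1 where "a1 = real (6 * CARD('d) + 1)"
  define r where "r = 4 * a1 * real CARD('d)"
  define c where "c = 1/2 * (1 / (4 * a1)) ^ CARD('d)"
  have a1: "a1 \<ge> 1" by (simp add: a1_def)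
  have cpos: "c > 0" "r > 0" using a1 d by (auto simp: c_def r_def)
  let ?m = "\<lambda>n. measure (PPP n :: (nat \<times> (real^'d) stream) measure) {\<omega> \<in> space (PPP n). has_giant TYPE('d) n r c \<omega>}"
  have main: "eventually (\<lambda>n. ?m n \<ge> 1 - 1 / 2 ^ k0) sequentially" for k0
  proof -
    have "eventually (\<lambda>n. side TYPE('d) n \<ge> a1 * (real_of_int (block_side k0) + 1)) sequentially"
      using side_tendsto[where ?'d='d] by (simp add: filterlim_at_top)
    then show ?thesis using eventually_gt_at_top[of 0]
    proof eventually_elim
      case (elim n)
      define L where "L = side TYPE('d) n"
      define M where "M = nat \<lfloor>L / a1\<rfloor>"
      have n: "n > 0" using elim by simp
      have "L / a1 \<ge> real_of_int (block_side k0) + 1" using elim(1) a1 by (simp add: L_def field_simps)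
      then have Ms: "block_side k0 \<le> int M" "M \<ge> 1" "real M \<le> L / a1" "L / a1 < real M + 1"
        using block_side_pos[of k0] unfolding M_def by linarith+
      have M: "M > 0" using Ms by simp
      have L: "L > 0" using n by (simp add: L_def side_pos)
      define a where "a = L / real M"
      have a: "a1 \<le> a" "a \<le> 2 * a1"
      proof -
        show "a1 \<le> a" using Ms M a1 by (simp add: a_def field_simps)
        have "L / a1 \<le> 2 * real M" using Ms by linarith
        then show "a \<le> 2 * a1" using M a1 by (simp add: a_def field_simps)
      qed
      define v where "v = real n / real M ^ CARD('d)"
      have va: "v = a ^ CARD('d)" using side_power[OF n, where ?'d='d] by (simp add: v_def a_def L_def power_divide)
      have "a1 \<le> a ^ 1" using a by simp
      also have "\<dots> \<le> a ^ CARD('d)" using a a1 d by (intro power_increasing) auto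
      finally have v1: "a1 \<le> v" by (simp add: va)
      have "exp (- v) \<le> exp (- a1)" using v1 by simp
      also have "\<dots> = (1 / exp 1) ^ (6 * CARD('d) + 1)"
        using exp_of_nat_mult[of "6 * CARD('d) + 1" "1::real"]
        unfolding a1_def by (simp only: exp_minus power_one_over inverse_eq_divide mult_1_right)
      also have "\<dots> \<le> (1 / 2) ^ (6 * CARD('d) + 1)"
        using exp_ge_add_one_self[of 1] by (intro power_mono divide_left_mono) auto
      finally have ev: "exp (- v) \<le> 1 / 2 ^ (6 * CARD('d) + 1)" by (simp add: power_one_over)
      have vpos: "v > 0" using v1 a1 by linarith
      let ?Q = "\<lambda>f :: int^'d \<Rightarrow> nat. \<exists>G. finite G \<and> (\<forall>x\<in>G. f x > 0) \<and> (\<forall>x\<in>G. \<forall>y\<in>G. linked (\<lambda>x. f x > 0) x y) \<and>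
         real (card G) \<ge> 1/2 * (real M / 2) ^ CARD('d)"
      let ?q = "Pi_pmf (cells M :: (int^'d) set) 0 (\<lambda>_. poisson_pmf v)"
      have "measure_pmf.prob ?q {f. \<not> ?Q f} \<le> 1 / 2 ^ k0"
        by (rule percolation[OF d vpos ev Ms(1)])
      moreover have "measure_pmf.prob ?q {f. \<not> ?Q f} = 1 - measure_pmf.prob ?q {f. ?Q f}"
        by (rule prob_pmf_not)
      ultimately have "1 - 1 / 2 ^ k0 \<le> measure_pmf.prob ?q {f. ?Q f}" by linarith
      also have "\<dots> \<le> measure (PPP n) {\<omega>. has_giant TYPE('d) n r c \<omega>}"
        unfolding v_def
      proof (rule PPP_prob_ge_cnt[OF n M sets_has_giant])
        fix \<omega> :: "nat \<times> (real^'d) stream"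
        assume tor: "\<And>j. snd \<omega> !! j \<in> torus n" and Q: "?Q (cnt n M \<omega>)"
        from Q obtain G where G: "finite G \<and> (\<forall>x\<in>G. cnt n M \<omega> x > 0) \<and> (\<forall>x\<in>G. \<forall>y\<in>G. linked (\<lambda>x. cnt n M \<omega> x > 0) x y) \<and>
         real (card G) \<ge> 1/2 * (real M / 2) ^ CARD('d)" ..
        have "real n = (a * real M) ^ CARD('d)" using side_power[OF n, where ?'d='d] M by (simp add: a_def L_def)
        also have "\<dots> \<le> (2 * a1 * real M) ^ CARD('d)" using a a1 by (intro power_mono mult_right_mono) auto
        finally have "c * real n \<le> c * (2 * a1 * real M) ^ CARD('d)" using cpos by (intro mult_left_mono) auto
        also have "\<dots> = 1/2 * ((1 / (4 * a1)) * (2 * a1 * real M)) ^ CARD('d)" by (simp only: c_def power_mult_distrib mult.assoc)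
        also have "(1 / (4 * a1)) * (2 * a1 * real M) = real M / 2" using a1 by (simp add: field_simps)
        finally have cG: "c * real n \<le> real (card G)" using G by linarith
        have "real (card G) > 0" using cG n cpos by (meson less_le_trans mult_pos_pos of_nat_0_less_iff)
        then have "G \<noteq> {}" by auto
        moreover have "2 * (side TYPE('d) n / real M) * real CARD('d) \<le> r"
          unfolding L_def[symmetric] a_def[symmetric] r_def using a by (intro mult_right_mono) auto
        ultimately show "\<omega> \<in> {\<omega>. has_giant TYPE('d) n r c \<omega>}"
          unfolding mem_Collect_eq
          by (intro has_giant_of_linked_cells[OF n M tor, of r G c]) (use G cG in auto)
      qed
      finally show ?case by simp
    qed
  qed
  have le1: "eventually (\<lambda>n. ?m n \<le> 1) sequentially"
    using eventually_gt_at_top[of 0] by eventually_elim (use prob_space.prob_le_1[OF prob_space_PPP] in blast)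
  have "?m \<longlonglongrightarrow> 1"
  proof (rule order_tendstoI)
    fix y :: real assume "y < 1"
    then obtain k0 where "(1/2 :: real) ^ k0 < 1 - y" using real_arch_pow_inv[of "1 - y" "1/2"] by auto
    then have "y < 1 - 1 / 2 ^ k0" by (simp add: power_one_over)
    with main[of k0] show "eventually (\<lambda>n. y < ?m n) sequentially" by (auto elim: eventually_mono)
  next
    fix y :: real assume "1 < y"
    with le1 show "eventually (\<lambda>n. ?m n < y) sequentially" by (auto elim: eventually_mono)
  qed
  then show ?thesis using cpos by blast
qed

text \<open>The infimum of the empty set is an unspecified real, hence the need for \<open>giant_exists\<close>.\<close>

lemma r_g_nonneg: "CARD('d::finite) \<ge> 2 \<Longrightarrow> r_g TYPE('d) \<ge> 0"
  unfolding r_g_def using giant_exists[where ?'d='d] by (intro cInf_greatest) auto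

subsection \<open>Degree sums and cell counts\<close>

definition wrap :: "nat \<Rightarrow> int^'d::finite \<Rightarrow> int^'d" where
  "wrap M e = (\<chi> i. e $ i mod int M)"

definition rvec :: "int^'d::finite \<Rightarrow> real^'d" where
  "rvec z = (\<chi> i. real_of_int (z $ i))"

text \<open>Replacing two points by the lower corners of their cells changes each coordinate of
  their displacement by at most \<open>a\<close>, hence its norm by at most \<open>a * d\<close>;
  this is the slack added to \<open>r\<close>.\<close>

definition offsets :: "real \<Rightarrow> real \<Rightarrow> (int^'d::finite) set" where
  "offsets a r = {z. a * norm (rvec z) \<le> r + a * real CARD('d)}"

text \<open>Labels in the periodic extension of the grid, before reduction by \<open>wrap\<close>,
  since the cube may cross the boundary of the torus. The \<open>- 1\<close> admits the cells that
  start below the cube but still reach it.\<close>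

definition cover :: "nat \<Rightarrow> nat \<Rightarrow> real^'d::finite \<Rightarrow> real \<Rightarrow> (int^'d) set" where
  "cover n M c s = {e. \<forall>i. e $ i \<in>
     {\<lceil>(c $ i + side TYPE('d) n / 2) / (side TYPE('d) n / real M) - 1\<rceil>..
      \<lfloor>(c $ i + side TYPE('d) n / 2 + s) / (side TYPE('d) n / real M)\<rfloor>}}"

lemma wrap_in_cells: "M > 0 \<Longrightarrow> wrap M e \<in> cells M"
  by (auto simp: wrap_def cells_def)

lemma wrap_cell: "c \<in> cells M \<Longrightarrow> wrap M c = c"
  by (auto simp: wrap_def cells_def vec_eq_iff)

lemma wrap_add: "wrap M (wrap M e + z) = wrap M (e + z)"
  by (simp add: wrap_def vec_eq_iff mod_add_left_eq)

lemma wrap_eqD: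
  assumes "wrap M u = wrap M w" "\<And>i. \<bar>u $ i - w $ i\<bar> < int M"
  shows "u = w"
proof (rule vec_eq_iff[THEN iffD2], rule allI)
  fix i
  have "u $ i mod int M = w $ i mod int M" using assms(1) by (simp add: wrap_def vec_eq_iff)
  then have "int M dvd u $ i - w $ i" by (simp add: mod_eq_dvd_iff)
  then show "u $ i = w $ i" using assms(2)[of i] zdvd_imp_le[of "int M" "\<bar>u $ i - w $ i\<bar>"] by fastforce
qed

lemma norm_le_card: "(\<And>i. \<bar>x $ i\<bar> \<le> b) \<Longrightarrow> norm x \<le> b * real CARD('d)" for x :: "real^'d::finite"
  using norm_le_l1_cart[of x] sum_mono[of UNIV "\<lambda>i. \<bar>x $ i\<bar>" "\<lambda>_. b"] by (simp add: mult.commute)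

text \<open>The translation by \<open>L * k\<close> that brings \<open>x\<close> into the cube moves
  its label by \<open>M * k\<close>, which \<open>wrap\<close> undoes.\<close>

lemma tcube_cover:
  fixes x :: "real^'d::finite"
  assumes n: "n > 0" and M: "M > 0" and x: "x \<in> tcube n c s"
  shows "\<exists>e\<in>cover n M c s. wrap M e = cell n M x"
proof -
  define L where "L = side TYPE('d) n"
  define a where "a = L / real M"
  have a: "a > 0" using n M by (simp add: a_def L_def side_pos)
  have aM: "a * real M = L" using M by (simp add: a_def)
  obtain k :: "int^'d" where k: "\<And>i. c $ i \<le> x $ i + L * real_of_int (k $ i)" "\<And>i. x $ i + L * real_of_int (k $ i) \<le> c $ i + s"
    using x unfolding tcube_def L_def by blast
  have xt: "x \<in> torus n" using x by (simp add: tcube_def)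
  define e where "e = (\<chi> i. cell n M x $ i + int M * k $ i)"
  have "e \<in> cover n M c s"
    unfolding cover_def L_def[symmetric] a_def[symmetric]
  proof (intro CollectI allI)
    fix i
    have ae: "a * real_of_int (e $ i) = a * real_of_int (cell n M x $ i) + L * real_of_int (k $ i)"
      using aM by (simp add: e_def algebra_simps)
    have "a * real_of_int (cell n M x $ i) \<le> x $ i + L / 2" "x $ i + L / 2 \<le> a * real_of_int (cell n M x $ i) + a"
      using cell_bounds[OF xt M n, of i] unfolding L_def[symmetric] a_def[symmetric] by (simp_all add: algebra_simps)
    then have "c $ i + L / 2 \<le> a * real_of_int (e $ i) + a" "a * real_of_int (e $ i) \<le> c $ i + L / 2 + s"
      using k[of i] ae by linarith+
    then have "(c $ i + L / 2) / a - 1 \<le> real_of_int (e $ i)" "real_of_int (e $ i) \<le> (c $ i + L / 2 + s) / a"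
      using a by (simp_all add: field_simps)
    then show "e $ i \<in> {\<lceil>(c $ i + L / 2) / a - 1\<rceil>..\<lfloor>(c $ i + L / 2 + s) / a\<rfloor>}"
      by (simp add: le_floor_iff) linarith
  qed
  moreover have "wrap M e = cell n M x"
    using wrap_cell[OF cell_in_cells[OF M, of n x]] by (simp add: wrap_def e_def vec_eq_iff)
  ultimately show ?thesis by blast
qed

text \<open>The right-hand side, as it occurs in \<open>tdist\<close>, is the distance from
  \<open>u\<close> to the nearest multiple of \<open>L\<close>. Exhibiting that multiple turns the
  torus distance into the Euclidean norm of an actual displacement.\<close>

lemma torus_representative:
  fixes u L :: real
  assumes "L > 0"
  shows "\<exists>k::int. \<bar>u + L * real_of_int k\<bar> = min (\<bar>u\<bar> - L * real_of_int \<lfloor>\<bar>u\<bar> / L\<rfloor>) (L - (\<bar>u\<bar> - L * real_of_int \<lfloor>\<bar>u\<bar> / L\<rfloor>))"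
proof -
  define q where "q = \<lfloor>\<bar>u\<bar> / L\<rfloor>"
  define t where "t = \<bar>u\<bar> - L * real_of_int q"
  have q: "real_of_int q \<le> \<bar>u\<bar> / L" "\<bar>u\<bar> / L < real_of_int q + 1" unfolding q_def by linarith+
  have "L * real_of_int q \<le> L * (\<bar>u\<bar> / L)" "L * (\<bar>u\<bar> / L) < L * (real_of_int q + 1)"
    using q assms by (auto intro!: mult_left_mono mult_strict_left_mono simp del: times_divide_eq_right)
  then have t: "0 \<le> t" "t < L" using assms by (simp_all add: t_def algebra_simps)
  have "\<exists>k::int. \<bar>u + L * real_of_int k\<bar> = min t (L - t)"
  proof (cases "t \<le> L - t")
    case True
    show ?thesis
    proof (cases "u \<ge> 0")
      case u: True
      then show ?thesis using True t by (intro exI[of _ "- q"]) (simp add: t_def)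
    next
      case u: False
      then have "u + L * real_of_int q = - t" by (simp add: t_def)
      then show ?thesis using True t by (intro exI[of _ q]) simp
    qed
  next
    case False
    show ?thesis
    proof (cases "u \<ge> 0")
      case u: True
      then have "u + L * real_of_int (- q - 1) = - (L - t)" by (simp add: t_def algebra_simps)
      then show ?thesis using False t by (intro exI[of _ "- q - 1"]) simp
    next
      case u: False
      then have "u + L * real_of_int (q + 1) = L - t" by (simp add: t_def algebra_simps)
      then show ?thesis using False t by (intro exI[of _ "q + 1"]) simp
    qed
  qed
  then show ?thesis by (simp add: t_def q_def)
qed

lemma near_offset:
  fixes x y :: "real^'d::finite"
  assumes n: "n > 0" and M: "M > 0" and xy: "x \<in> torus n" "y \<in> torus n" and r: "tdist n x y \<le> r"
  shows "\<exists>z\<in>offsets (side TYPE('d) n / real M) r. cell n M y = wrap M (cell n M x + z)"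
proof -
  define L where "L = side TYPE('d) n"
  define a where "a = L / real M"
  have L: "L > 0" using n by (simp add: L_def side_pos)
  have a: "a > 0" using L M by (simp add: a_def)
  have aM: "a * real M = L" using M by (simp add: a_def)
  have "\<forall>i. \<exists>k::int. \<bar>x $ i - y $ i + L * real_of_int k\<bar> =
     min (\<bar>x $ i - y $ i\<bar> - L * real_of_int \<lfloor>\<bar>x $ i - y $ i\<bar> / L\<rfloor>) (L - (\<bar>x $ i - y $ i\<bar> - L * real_of_int \<lfloor>\<bar>x $ i - y $ i\<bar> / L\<rfloor>))"
    using torus_representative[OF L] by blast
  then obtain k :: "'d \<Rightarrow> int" where k: "\<And>i. \<bar>x $ i - y $ i + L * real_of_int (k i)\<bar> =
     min (\<bar>x $ i - y $ i\<bar> - L * real_of_int \<lfloor>\<bar>x $ i - y $ i\<bar> / L\<rfloor>) (L - (\<bar>x $ i - y $ i\<bar> - L * real_of_int \<lfloor>\<bar>x $ i - y $ i\<bar> / L\<rfloor>))"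
    by metis
  define w where "w = (\<chi> i. x $ i - y $ i + L * real_of_int (k i))"
  have "tdist n x y = norm w"
    unfolding tdist_def norm_vec_def L2_set_def Let_def L_def[symmetric] w_def
    by (simp add: k[symmetric])
  then have w: "norm w \<le> r" using r by simp
  \<comment> \<open>\<open>z\<close> leads from the cell of \<open>x\<close> to that of
    \<open>y\<close>, against the direction of \<open>w\<close>. Translating by \<open>L\<close>
    shifts labels by \<open>M\<close>, so the multiples \<open>k\<close> cancel in
    \<open>a *\<^sub>R rvec z + w\<close>.\<close>
  define z where "z = (\<chi> i. cell n M y $ i - cell n M x $ i - int M * k i)"
  have "\<bar>(a *\<^sub>R rvec z + w) $ i\<bar> \<le> a" for i
  proof -
    have "a * real_of_int (z $ i) = a * real_of_int (cell n M y $ i) - a * real_of_int (cell n M x $ i) - L * real_of_int (k i)"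
      using aM by (simp add: z_def algebra_simps)
    moreover have "a * real_of_int (cell n M x $ i) \<le> x $ i + L / 2" "x $ i + L / 2 \<le> a * real_of_int (cell n M x $ i) + a"
      "a * real_of_int (cell n M y $ i) \<le> y $ i + L / 2" "y $ i + L / 2 \<le> a * real_of_int (cell n M y $ i) + a"
      using cell_bounds[OF xy(1) M n, of i] cell_bounds[OF xy(2) M n, of i] unfolding L_def[symmetric] a_def[symmetric] by (simp_all add: algebra_simps)
    ultimately show ?thesis by (simp add: rvec_def w_def abs_le_iff)
  qed
  then have "norm (a *\<^sub>R rvec z + w) \<le> a * real CARD('d)" by (rule norm_le_card)
  moreover have "norm (a *\<^sub>R rvec z) \<le> norm (a *\<^sub>R rvec z + w) + norm w"
    using norm_triangle_ineq4[of "a *\<^sub>R rvec z + w" w] by simp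
  ultimately have "a * norm (rvec z) \<le> r + a * real CARD('d)" using w a by simp
  then have "z \<in> offsets a r" by (simp add: offsets_def)
  moreover have "cell n M y = wrap M (cell n M x + z)"
    using wrap_cell[OF cell_in_cells[OF M, of n y]] by (simp add: wrap_def z_def vec_eq_iff) (metis mod_mult_self4 add.commute uminus_add_conv_diff mult_minus_right)
  ultimately show ?thesis unfolding a_def L_def by blast
qed

section \<open>Counting offsets and covering cells\<close>

lemma rvec_component_le: "\<bar>real_of_int (z $ i)\<bar> \<le> norm (rvec z)"
  using component_le_norm_cart[of "rvec z" i] by (simp add: rvec_def)

lemma finite_offsets:
  assumes "a > 0"
  shows "finite (offsets a r :: (int^'d::finite) set)"
proof (rule finite_subset)
  let ?b = "\<lceil>(r + a * real CARD('d)) / a\<rceil>"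
  show "finite {z::int^'d. \<forall>i. z $ i \<in> {- ?b..?b}}" by (rule finite_vec_box) auto
  show "offsets a r \<subseteq> {z::int^'d. \<forall>i. z $ i \<in> {- ?b..?b}}"
  proof (intro subsetI CollectI allI)
    fix z :: "int^'d" and i assume "z \<in> offsets a r"
    then have "norm (rvec z) \<le> (r + a * real CARD('d)) / a" using assms by (simp add: offsets_def field_simps)
    then have "\<bar>real_of_int (z $ i)\<bar> \<le> (r + a * real CARD('d)) / a" using rvec_component_le[of z i] by linarith
    then show "z $ i \<in> {- ?b..?b}" by (auto; linarith)
  qed
qed

lemma gamma_pos: "gamma TYPE('d::finite) > 0"
  unfolding gamma_def by (simp add: content_ball_pos)

text \<open>Packing by volume: the disjoint open cubes of side \<open>a\<close> with lower corners
  \<open>a * z\<close> lie in a ball. Its radius exceeds the bound in \<open>offsets\<close> by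
  another \<open>a * d\<close>, the extent of a cube, hence the factor 2.\<close>

lemma card_offsets:
  assumes a: "a > 0" and r: "r \<ge> 0"
  shows "real (card (offsets a r :: (int^'d::finite) set)) * a ^ CARD('d) \<le> gamma TYPE('d) * (r + 2 * a * real CARD('d)) ^ CARD('d)"
proof -
  let ?O = "offsets a r :: (int^'d) set"
  let ?R = "r + 2 * a * real CARD('d)"
  define lo where "lo z = (\<chi> i. a * real_of_int (z $ i))" for z :: "int^'d"
  define hi where "hi z = (\<chi> i. a * real_of_int (z $ i) + a)" for z :: "int^'d"
  define Bx where "Bx z = box (lo z) (hi z)" for z
  have sub: "(\<Union>z\<in>?O. Bx z) \<subseteq> cball 0 ?R"
  proof
    fix y assume "y \<in> (\<Union>z\<in>?O. Bx z)"
    then obtain z where z: "z \<in> ?O" "y \<in> Bx z" by blast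
    have "\<bar>(y - a *\<^sub>R rvec z) $ i\<bar> \<le> a" for i
      using z(2) by (auto simp: Bx_def mem_box_cart lo_def hi_def rvec_def abs_le_iff less_imp_le algebra_simps)
    then have "norm (y - a *\<^sub>R rvec z) \<le> a * real CARD('d)" by (rule norm_le_card)
    moreover have "norm y \<le> norm (y - a *\<^sub>R rvec z) + norm (a *\<^sub>R rvec z)"
      using norm_triangle_ineq[of "y - a *\<^sub>R rvec z" "a *\<^sub>R rvec z"] by simp
    ultimately show "y \<in> cball 0 ?R" using z(1) a by (simp add: offsets_def)
  qed
  have dis: "disjoint_family_on Bx ?O"
    unfolding disjoint_family_on_def
  proof (intro ballI impI)
    fix z z' :: "int^'d" assume "z \<noteq> z'"
    show "Bx z \<inter> Bx z' = {}"
    proof (rule ccontr)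
      assume "Bx z \<inter> Bx z' \<noteq> {}"
      then obtain y where y: "y \<in> Bx z" "y \<in> Bx z'" by blast
      have "z $ i = z' $ i" for i
      proof -
        have "a * real_of_int (z $ i) < y $ i" "y $ i < a * (real_of_int (z $ i) + 1)" "a * real_of_int (z' $ i) < y $ i" "y $ i < a * (real_of_int (z' $ i) + 1)"
          using y by (auto simp: Bx_def mem_box_cart lo_def hi_def algebra_simps)
        then have "a * real_of_int (z $ i) < a * (real_of_int (z' $ i) + 1)" "a * real_of_int (z' $ i) < a * (real_of_int (z $ i) + 1)" by linarith+
        then have "real_of_int (z $ i) < real_of_int (z' $ i) + 1" "real_of_int (z' $ i) < real_of_int (z $ i) + 1"
          using a by (simp_all add: mult_less_cancel_left_pos)
        then show ?thesis by linarith
      qed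
      then show False using \<open>z \<noteq> z'\<close> by (simp add: vec_eq_iff)
    qed
  qed
  have mB: "measure lborel (Bx z) = a ^ CARD('d)" for z
  proof -
    have "measure lborel (cbox (lo z) (hi z)) = (\<Prod>i\<in>UNIV. hi z $ i - lo z $ i)"
      using a by (intro content_cbox_cart) (auto simp: box_ne_empty lo_def hi_def cbox_interval less_eq_vec_def)
    then show ?thesis using a measure_lborel_box_eq[of "lo z" "hi z"] measure_lborel_cbox_eq[of "lo z" "hi z"]
      by (simp add: Bx_def lo_def hi_def)
  qed
  have "real (card ?O) * a ^ CARD('d) = (\<Sum>z\<in>?O. measure lborel (Bx z))" by (simp add: mB)
  also have "\<dots> = measure lborel (\<Union>z\<in>?O. Bx z)"
    using finite_offsets[OF a] emeasure_lborel_box_finite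
    by (intro measure_finite_Union[OF _ _ dis, symmetric]) (auto simp: Bx_def less_top[symmetric])
  also have "\<dots> \<le> measure lborel (cball 0 ?R :: (real^'d) set)"
    using sub by (intro measure_mono_fmeasurable) (auto simp: Bx_def intro!: fmeasurableI emeasure_bounded_finite)
  also have "\<dots> = gamma TYPE('d) * ?R ^ CARD('d)"
    using a r by (simp add: content_cball content_ball gamma_def)
  finally show ?thesis .
qed

lemma cover_diff:
  fixes c :: "real^'d::finite"
  assumes "u \<in> cover n M c s" "w \<in> cover n M c s" "n > 0" "M > 0"
  shows "\<bar>real_of_int (u $ i - w $ i)\<bar> \<le> s / (side TYPE('d) n / real M) + 1"
proof -
  define a where "a = side TYPE('d) n / real M"
  have b: "(c $ i + side TYPE('d) n / 2) / a - 1 \<le> real_of_int (e $ i)" "real_of_int (e $ i) \<le> (c $ i + side TYPE('d) n / 2) / a + s / a"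
    if "e \<in> cover n M c s" for e
  proof -
    have "\<lceil>(c $ i + side TYPE('d) n / 2) / a - 1\<rceil> \<le> e $ i" "e $ i \<le> \<lfloor>(c $ i + side TYPE('d) n / 2 + s) / a\<rfloor>"
      using that unfolding cover_def a_def[symmetric] by auto
    then show "(c $ i + side TYPE('d) n / 2) / a - 1 \<le> real_of_int (e $ i)" "real_of_int (e $ i) \<le> (c $ i + side TYPE('d) n / 2) / a + s / a"
      unfolding add_divide_distrib[symmetric] by linarith+
  qed
  show ?thesis using b[OF assms(1)] b[OF assms(2)] unfolding a_def[symmetric] by (simp add: abs_le_iff)
qed

lemma finite_cover: "finite (cover n M c s)"
  unfolding cover_def by (rule finite_vec_box) auto

text \<open>In each coordinate the labels lie in an interval of length \<open>s / a + 1\<close>,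
  which contains at most \<open>s / a + 2\<close> integers.\<close>

lemma card_cover:
  fixes c :: "real^'d::finite"
  assumes "n > 0" "M > 0" "s \<ge> 0"
  shows "real (card (cover n M c s)) \<le> (s / (side TYPE('d) n / real M) + 2) ^ CARD('d)"
proof -
  define a where "a = side TYPE('d) n / real M"
  have a: "a > 0" using assms by (simp add: a_def side_pos)
  let ?I = "\<lambda>i. {\<lceil>(c $ i + side TYPE('d) n / 2) / a - 1\<rceil>..\<lfloor>(c $ i + side TYPE('d) n / 2 + s) / a\<rfloor>}"
  have "real (card (cover n M c s)) = (\<Prod>i\<in>UNIV. real (card (?I i)))"
    unfolding cover_def a_def[symmetric] card_vec_box by simp
  also have "\<dots> \<le> (\<Prod>i\<in>(UNIV::'d set). s / a + 2)"
  proof (intro prod_mono conjI)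
    fix i
    have "s / a \<ge> 0" using assms a by simp
    moreover have "real_of_int (\<lfloor>x + s / a\<rfloor> - \<lceil>x - 1\<rceil> + 1) \<le> s / a + 2" for x by linarith
    ultimately show "real (card (?I i)) \<le> s / a + 2" by (simp add: add_divide_distrib) linarith
  qed auto
  finally show ?thesis by (simp add: a_def)
qed

text \<open>Offset 0 counts ordered pairs of distinct points: the square of a count would have mean
  \<open>v^2 + v\<close> and exceed the mean \<open>v^2\<close> of the other products.\<close>

definition pairprod :: "nat \<Rightarrow> (int^'d::finite \<Rightarrow> nat) \<Rightarrow> int^'d \<Rightarrow> int^'d \<Rightarrow> real" where
  "pairprod M f z e = (if z = 0 then real (f (wrap M e)) * (real (f (wrap M e)) - 1)
     else real (f (wrap M e)) * real (f (wrap M (e + z))))"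

lemma card_offdiagonal: "finite C \<Longrightarrow> real (card {(j, k). j \<in> C \<and> k \<in> C \<and> j \<noteq> k}) = real (card C) * (real (card C) - 1)"
proof -
  assume C: "finite C"
  let ?X = "{(j, k). j \<in> C \<and> k \<in> C \<and> j \<noteq> k}"
  have eq: "?X \<union> (\<lambda>j. (j, j)) ` C = C \<times> C" by auto
  have fin: "finite ?X" by (rule finite_subset[of _ "C \<times> C"]) (use C in auto)
  have "card (?X \<union> (\<lambda>j. (j, j)) ` C) = card ?X + card ((\<lambda>j. (j, j)) ` C)"
    by (rule card_Un_disjoint[OF fin]) (use C in auto)
  then have "card (C \<times> C) = card ?X + card ((\<lambda>j. (j, j)) ` C)" by (simp only: eq)
  also have "card ((\<lambda>j. (j, j)) ` C) = card C" by (rule card_image) (auto simp: inj_on_def)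
  finally have "real (card C) * real (card C) = real (card {(j, k). j \<in> C \<and> k \<in> C \<and> j \<noteq> k}) + real (card C)"
    by (simp add: card_cartesian_product flip: of_nat_mult of_nat_add)
  then show ?thesis by (simp add: algebra_simps)
qed

text \<open>Every ordered adjacent pair starting in the cube belongs to \<open>P z e\<close> for a
  covering label \<open>e\<close> of its first point and some offset \<open>z\<close>; a pair
  occurring several times only enlarges the right-hand side.\<close>

lemma deg_sum_le:
  fixes \<omega> :: "nat \<times> (real^'d::finite) stream"
  assumes n: "n > 0" and M: "M > 0" and tor: "\<And>j. snd \<omega> !! j \<in> torus n"
  shows "real (deg_sum n r \<omega> (tcube n c s)) \<le>
    (\<Sum>z\<in>offsets (side TYPE('d) n / real M) r. \<Sum>e\<in>cover n M c s. pairprod M (cnt n M \<omega>) z e)"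
proof -
  let ?O = "offsets (side TYPE('d) n / real M) r :: (int^'d) set"
  let ?I = "cover n M c s"
  define N where "N = fst \<omega>"
  define x where "x j = cell n M (snd \<omega> !! j)" for j
  define J where "J = {j. j < N \<and> snd \<omega> !! j \<in> tcube n c s}"
  define C where "C e = {j. j < N \<and> x j = e}" for e
  define P where "P z e = {(j, k). j \<in> C (wrap M e) \<and> k \<in> C (wrap M (e + z)) \<and> j \<noteq> k}" for z e
  have finC: "finite (C e)" for e by (simp add: C_def)
  have finP: "finite (P z e)" for z e
    by (rule finite_subset[of _ "C (wrap M e) \<times> C (wrap M (e + z))"]) (auto simp: P_def finC)
  have cC: "cnt n M \<omega> e = card (C e)" for e by (simp add: cnt_def C_def N_def x_def)
  have finO: "finite ?O" using n M by (intro finite_offsets) (simp add: side_pos)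
  have fin: "finite {k. adj n r \<omega> j k}" for j by (rule finite_subset[of _ "{..<N}"]) (auto simp: adj_def N_def)
  have "deg_sum n r \<omega> (tcube n c s) = card (SIGMA j:J. {k. adj n r \<omega> j k})"
    unfolding deg_sum_def degree_def J_def N_def by (subst card_SigmaI) (auto simp: fin)
  also have "\<dots> \<le> card (\<Union>z\<in>?O. \<Union>e\<in>?I. P z e)"
  proof (rule card_mono)
    show "finite (\<Union>z\<in>?O. \<Union>e\<in>?I. P z e)" by (intro finite_UN_I finO finite_cover finP)
    show "(SIGMA j:J. {k. adj n r \<omega> j k}) \<subseteq> (\<Union>z\<in>?O. \<Union>e\<in>?I. P z e)"
    proof
      fix jk assume "jk \<in> (SIGMA j:J. {k. adj n r \<omega> j k})"
      then obtain j k where jk: "jk = (j, k)" "j \<in> J" "adj n r \<omega> j k" by auto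
      obtain e where e: "e \<in> ?I" "wrap M e = x j" using tcube_cover[OF n M, of "snd \<omega> !! j" c s] jk(2) by (auto simp: J_def x_def)
      obtain z where z: "z \<in> ?O" "x k = wrap M (x j + z)"
        using near_offset[OF n M tor tor, of j k r] jk(3) by (auto simp: adj_def x_def)
      have "x k = wrap M (e + z)" using z(2) e(2)[symmetric] by (simp add: wrap_add)
      then have "jk \<in> P z e" using jk e(2) by (auto simp: P_def C_def J_def adj_def N_def)
      then show "jk \<in> (\<Union>z\<in>?O. \<Union>e\<in>?I. P z e)" using z(1) e(1) by blast
    qed
  qed
  also have "\<dots> \<le> (\<Sum>z\<in>?O. card (\<Union>e\<in>?I. P z e))" by (rule card_UN_le[OF finO])
  also have "\<dots> \<le> (\<Sum>z\<in>?O. \<Sum>e\<in>?I. card (P z e))" by (intro sum_mono card_UN_le finite_cover)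
  finally have "real (deg_sum n r \<omega> (tcube n c s)) \<le> (\<Sum>z\<in>?O. \<Sum>e\<in>?I. real (card (P z e)))"
    by (simp only: of_nat_sum[symmetric] of_nat_le_iff)
  also have "\<dots> \<le> (\<Sum>z\<in>?O. \<Sum>e\<in>?I. pairprod M (cnt n M \<omega>) z e)"
  proof (intro sum_mono)
    fix z e
    show "real (card (P z e)) \<le> pairprod M (cnt n M \<omega>) z e"
    proof (cases "z = 0")
      case True
      then show ?thesis using card_offdiagonal[OF finC, of "wrap M e"] by (simp add: pairprod_def P_def cC)
    next
      case False
      have "card (P z e) \<le> card (C (wrap M e) \<times> C (wrap M (e + z)))"
        by (intro card_mono) (auto simp: P_def finC)
      then have "real (card (P z e)) \<le> real (card (C (wrap M e))) * real (card (C (wrap M (e + z))))"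
        by (simp only: card_cartesian_product of_nat_mult[symmetric] of_nat_le_iff)
      then show ?thesis using False by (simp add: pairprod_def cC)
    qed
  qed
  finally show ?thesis .
qed

subsection \<open>Concentration\<close>

lemma moment_const_nonneg: "moment_const v \<ge> 0" by (simp add: moment_const_def)

text \<open>\<open>wide\<close> prevents the covering cells and their shifts by \<open>z\<close>
  from wrapping onto each other, so distinct labels stay distinct modulo \<open>M\<close>. For
  \<open>z \<noteq> 0\<close> the sum is split into two classes of independent products, each
  allowed a deviation \<open>t\<close>; hence \<open>2 * t\<close> and the factor 2.\<close>

lemma pairprod_tail:
  fixes c :: "real^'d::finite"
  assumes n: "n > 0" and M: "M > 0"
    and wide: "s + a + r + a * real CARD('d) < side TYPE('d) n" and s: "s \<ge> 0" and r: "r \<ge> 0"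
    and z: "z \<in> offsets a r" and v: "v > 0" and lam: "lam \<ge> 0" "lam * T \<le> 1" and t: "t \<ge> 0"
    and a_def: "a = side TYPE('d) n / real M"
  shows "measure_pmf.prob (Pi_pmf (cells M) 0 (\<lambda>_. poisson_pmf v))
     {f. (\<forall>x\<in>cells M. real (f x) \<le> T) \<and> (\<Sum>e\<in>cover n M c s. pairprod M f z e) \<ge> real (card (cover n M c s)) * v\<^sup>2 + 2 * t}
     \<le> 2 * exp (- lam * t + lam\<^sup>2 * real (card (cover n M c s)) * moment_const v)"
proof -
  let ?q = "Pi_pmf (cells M :: (int^'d) set) 0 (\<lambda>_. poisson_pmf v)"
  let ?I = "cover n M c s"
  let ?bd = "exp (- lam * t + lam\<^sup>2 * real (card ?I) * moment_const v)"
  let ?E = "{f. (\<forall>x\<in>cells M. real (f x) \<le> T) \<and> (\<Sum>e\<in>?I. pairprod M f z e) \<ge> real (card ?I) * v\<^sup>2 + 2 * t}"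
  have a: "a > 0" using n M by (simp add: a_def side_pos)
  have L: "side TYPE('d) n = a * real M" using M by (simp add: a_def)
  have zi: "\<bar>real_of_int (z $ i)\<bar> \<le> (r + a * real CARD('d)) / a" for i
  proof -
    have "norm (rvec z) \<le> (r + a * real CARD('d)) / a" using z a by (simp add: offsets_def field_simps)
    then show ?thesis using rvec_component_le[of z i] by linarith
  qed
  have wide': "s / a + 1 + (r + a * real CARD('d)) / a < real M"
  proof -
    have "(s + a + r + a * real CARD('d)) / a < a * real M / a" using wide a unfolding L by (intro divide_strict_right_mono)
    then show ?thesis using a by (simp add: add_divide_distrib)
  qed
  have ra: "(r + a * real CARD('d)) / a \<ge> 0" using r a by simp
  have diff: "\<bar>real_of_int (u $ i - w $ i)\<bar> \<le> s / a + 1" if "u \<in> ?I" "w \<in> ?I" for u w i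
    using cover_diff[OF that n M] by (simp add: a_def)
  have toint: "\<bar>k\<bar> < int M" if "\<bar>real_of_int k\<bar> < real M" for k using that by linarith
  have inj0: "u = w" if uw: "u \<in> ?I" "w \<in> ?I" "wrap M u = wrap M w" for u w
  proof (rule wrap_eqD[OF uw(3)], rule toint)
    fix i show "\<bar>real_of_int (u $ i - w $ i)\<bar> < real M" using diff[OF uw(1,2), of i] wide' ra by linarith
  qed
  have inj1: "u = w + z" if uw: "u \<in> ?I" "w \<in> ?I" "wrap M u = wrap M (w + z)" for u w
  proof (rule wrap_eqD[OF uw(3)], rule toint)
    fix i
    have "real_of_int (u $ i - (w + z) $ i) = real_of_int (u $ i - w $ i) - real_of_int (z $ i)" by simp
    then show "\<bar>real_of_int (u $ i - (w + z) $ i)\<bar> < real M"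
      using diff[OF uw(1,2), of i] zi[of i] wide' by linarith
  qed
  have inj2: "u = w" if uw: "u \<in> ?I" "w \<in> ?I" "wrap M (u + z) = wrap M (w + z)" for u w
  proof -
    have "u + z = w + z"
    proof (rule wrap_eqD[OF uw(3)], rule toint)
      fix i show "\<bar>real_of_int ((u + z) $ i - (w + z) $ i)\<bar> < real M" using diff[OF uw(1,2), of i] wide' ra by simp
    qed
    then show ?thesis by simp
  qed
  show ?thesis
  proof (cases "z = 0")
    case True
    have "inj_on (wrap M) ?I" using inj0 by (auto simp: inj_on_def)
    then have b: "measure_pmf.prob ?q {f. (\<forall>x\<in>cells M. real (f x) \<le> T) \<and>
        (\<Sum>e\<in>?I. real (f (wrap M e)) * (real (f (wrap M e)) - 1)) \<ge> real (card ?I) * v\<^sup>2 + t} \<le> ?bd"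
      using wrap_in_cells[OF M] by (intro poisson_self_tail finite_cells finite_cover v lam) auto
    have "measure_pmf.prob ?q ?E \<le> measure_pmf.prob ?q {f. (\<forall>x\<in>cells M. real (f x) \<le> T) \<and>
        (\<Sum>e\<in>?I. real (f (wrap M e)) * (real (f (wrap M e)) - 1)) \<ge> real (card ?I) * v\<^sup>2 + t}"
      using t True by (intro measure_pmf.finite_measure_mono) (auto simp: pairprod_def)
    then show ?thesis using b exp_gt_zero[of "- lam * t + lam\<^sup>2 * real (card ?I) * moment_const v"] by linarith
  next
    case False
    then obtain i where i: "z $ i \<noteq> 0" by (auto simp: vec_eq_iff)
    \<comment> \<open>A shift by \<open>z\<close> changes the colour, so that the pairs \<open>e, e + z\<close> with \<open>e\<close> of one colour
      are disjoint and the products are independent.\<close>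
    define col where "col e = even (e $ i div \<bar>z $ i\<bar>)" for e :: "int^'d"
    have col: "col (w + z) \<longleftrightarrow> \<not> col w" for w
    proof (cases "z $ i > 0")
      case True
      then have "(w $ i + z $ i) div z $ i = w $ i div z $ i + 1" by simp
      then show ?thesis using True by (simp add: col_def)
    next
      case False
      then have neg: "z $ i < 0" using i by simp
      have "w $ i = (w $ i + z $ i) + \<bar>z $ i\<bar> * 1" using neg by simp
      then have "w $ i div \<bar>z $ i\<bar> = (w $ i + z $ i) div \<bar>z $ i\<bar> + 1" using i by (metis div_mult_self2 abs_eq_0_iff add.commute)
      then show ?thesis by (simp add: col_def)
    qed
    define Ic where "Ic b = {e \<in> ?I. col e = b}" for b
    have finIc: "finite (Ic b)" for b unfolding Ic_def using finite_cover[of n M c s] by simp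
    have split: "?I = Ic True \<union> Ic False" "Ic True \<inter> Ic False = {}" by (auto simp: Ic_def)
    let ?F = "\<lambda>b. {f. (\<forall>x\<in>cells M. real (f x) \<le> T) \<and> (\<Sum>e\<in>Ic b. real (f (wrap M e)) * real (f (wrap M (e + z)))) \<ge> real (card (Ic b)) * v\<^sup>2 + t}"
    have bF: "measure_pmf.prob ?q (?F b) \<le> ?bd" for b
    proof -
      have "measure_pmf.prob ?q (?F b) \<le> exp (- lam * t + lam\<^sup>2 * real (card (Ic b)) * moment_const v)"
      proof (rule poisson_pair_tail[OF finite_cells finIc _ _ _ _ v lam])
        show "wrap M e \<in> cells M" "wrap M (e + z) \<in> cells M" for e using wrap_in_cells[OF M] by auto
        show "wrap M e \<noteq> wrap M (e + z)" if "e \<in> Ic b" for e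
          using inj1[of e e] that False by (auto simp: Ic_def)
        show "disjoint_family_on (\<lambda>e. {wrap M e, wrap M (e + z)}) (Ic b)"
          unfolding disjoint_family_on_def
        proof (intro ballI impI)
          fix u w assume uw: "u \<in> Ic b" "w \<in> Ic b" "u \<noteq> w"
          have I: "u \<in> ?I" "w \<in> ?I" and c: "col u = b" "col w = b" using uw by (auto simp: Ic_def)
          have "wrap M u \<noteq> wrap M w" using inj0[OF I] uw(3) by blast
          moreover have "wrap M u \<noteq> wrap M (w + z)" using inj1[OF I] c col[of w] by auto
          moreover have "wrap M w \<noteq> wrap M (u + z)" using inj1[OF I(2,1)] c col[of u] by auto
          moreover have "wrap M (u + z) \<noteq> wrap M (w + z)" using inj2[OF I] uw(3) by blast
          ultimately show "{wrap M u, wrap M (u + z)} \<inter> {wrap M w, wrap M (w + z)} = {}" by auto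
        qed
      qed
      also have "\<dots> \<le> ?bd"
      proof -
        have "card (Ic b) \<le> card ?I" by (rule card_mono[OF finite_cover]) (auto simp: Ic_def)
        then have "lam\<^sup>2 * real (card (Ic b)) * moment_const v \<le> lam\<^sup>2 * real (card ?I) * moment_const v"
          by (intro mult_right_mono mult_left_mono moment_const_nonneg) auto
        then show ?thesis by simp
      qed
      finally show ?thesis .
    qed
    have "?E \<subseteq> ?F True \<union> ?F False"
    proof
      fix f assume f: "f \<in> ?E"
      have "(\<Sum>e\<in>?I. pairprod M f z e) = (\<Sum>e\<in>?I. real (f (wrap M e)) * real (f (wrap M (e + z))))"
        using False by (simp add: pairprod_def)
      also have "\<dots> = (\<Sum>e\<in>Ic True. real (f (wrap M e)) * real (f (wrap M (e + z)))) + (\<Sum>e\<in>Ic False. real (f (wrap M e)) * real (f (wrap M (e + z))))"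
        by (subst split(1)) (rule sum.union_disjoint[OF finIc finIc split(2)])
      finally have sum: "(\<Sum>e\<in>?I. pairprod M f z e) = \<dots>" .
      have "card ?I = card (Ic True) + card (Ic False)"
        by (subst split(1)) (rule card_Un_disjoint[OF finIc finIc split(2)])
      then have card: "real (card ?I) * v\<^sup>2 = real (card (Ic True)) * v\<^sup>2 + real (card (Ic False)) * v\<^sup>2" by (simp add: algebra_simps)
      show "f \<in> ?F True \<union> ?F False"
      proof (rule ccontr)
        assume "f \<notin> ?F True \<union> ?F False"
        moreover have "\<forall>x\<in>cells M. real (f x) \<le> T" using f by simp
        ultimately have "(\<Sum>e\<in>Ic True. real (f (wrap M e)) * real (f (wrap M (e + z)))) < real (card (Ic True)) * v\<^sup>2 + t"
          "(\<Sum>e\<in>Ic False. real (f (wrap M e)) * real (f (wrap M (e + z)))) < real (card (Ic False)) * v\<^sup>2 + t" by auto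
        moreover have "(\<Sum>e\<in>?I. pairprod M f z e) \<ge> real (card ?I) * v\<^sup>2 + 2 * t" using f by simp
        ultimately show False using sum card by linarith
      qed
    qed
    then have "measure_pmf.prob ?q ?E \<le> measure_pmf.prob ?q (?F True \<union> ?F False)"
      by (intro measure_pmf.finite_measure_mono) auto
    also have "\<dots> \<le> measure_pmf.prob ?q (?F True) + measure_pmf.prob ?q (?F False)"
      by (rule measure_Un_le) auto
    finally show ?thesis using bF[of True] bF[of False] by linarith
  qed
qed

lemma sets_deg_sum_all:
  fixes B :: "nat \<Rightarrow> real^'d::finite"
  shows "{\<omega> \<in> space (PPP n). \<forall>i<N. real (deg_sum n r \<omega> (tcube n (B i) s)) < c} \<in> sets (PPP n)"
proof -
  have "{\<omega> \<in> space (PPP n). \<forall>i<N. real (deg_sum n r \<omega> (tcube n (B i) s)) < c}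
    = {\<omega> \<in> space (PPP n). \<forall>i\<in>{..<N}. \<omega> \<in> {\<omega>. real (deg_sum n r \<omega> (tcube n (B i) s)) < c}}" by auto
  also have "\<dots> \<in> sets (PPP n)"
    using sets_deg_sum[OF sets_tcube, where P = "\<lambda>x. real x < c"]
    by (intro sets.sets_Collect_finite_All) (auto simp: sets_deg_sum)
  finally show ?thesis .
qed

text \<open>The union bound with its parameters still free: \<open>D\<close> bounds the number of
  offsets, \<open>J\<close> the number of covering cells, and \<open>u\<close> is the exponent for
  overfull cells. The threshold is \<open>D\<close> times the bound for one offset, and the failure
  probability collects the overfull cells and all pairs of a cube and an offset.\<close>

lemma deg_sum_prob:
  fixes B :: "nat \<Rightarrow> real^'d::finite"
  assumes n: "n > 0" and M: "M > 0" and a_def: "a = side TYPE('d) n / real M"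
    and wide: "s + a + r + a * real CARD('d) < side TYPE('d) n" and s: "s \<ge> 0" and r: "r \<ge> 0"
    and lam: "lam \<ge> 0" "lam * T \<le> 1" and t: "t \<ge> 0" and u: "u \<ge> 0"
    and D: "gamma TYPE('d) * (r + 2 * a * real CARD('d)) ^ CARD('d) / a ^ CARD('d) \<le> D"
    and J: "(s / a + 2) ^ CARD('d) \<le> J"
  shows "measure (PPP n) {\<omega>. \<forall>i<Nc. real (deg_sum n r \<omega> (tcube n (B i) s)) < D * (J * (a ^ CARD('d))\<^sup>2 + 2 * t)}
    \<ge> 1 - (real M ^ CARD('d) * exp (a ^ CARD('d) * (exp u - 1) - u * T)
        + real Nc * D * (2 * exp (- lam * t + lam\<^sup>2 * J * moment_const (a ^ CARD('d)))))"
proof -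
  let ?v = "a ^ CARD('d)"
  have a: "a > 0" using n M by (simp add: a_def side_pos)
  have v: "?v > 0" using a by simp
  have vn: "?v = real n / real M ^ CARD('d)" using side_power[OF n, where ?'d='d] by (simp add: a_def power_divide)
  let ?q = "Pi_pmf (cells M :: (int^'d) set) 0 (\<lambda>_. poisson_pmf ?v)"
  let ?O = "offsets a r :: (int^'d) set"
  let ?I = "\<lambda>i. cover n M (B i) s"
  let ?bd = "2 * exp (- lam * t + lam\<^sup>2 * J * moment_const ?v)"
  have finO: "finite ?O" by (rule finite_offsets[OF a])
  have cO: "real (card ?O) \<le> D"
    using card_offsets[OF a r, where ?'d='d] D v by (simp add: pos_le_divide_eq[symmetric])
  have cI: "real (card (?I i)) \<le> J" for i
    using card_cover[OF n M s, of "B i"] J unfolding a_def by linarith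
  \<comment> \<open>Makes the sum over offsets nonempty, without which it could not be strictly
    smaller.\<close>
  have zO: "0 \<in> ?O" using a r by (simp add: offsets_def rvec_def zero_vec_def[symmetric])
  define Bad where "Bad i z = {f. (\<forall>x\<in>cells M. real (f x) \<le> T) \<and>
     (\<Sum>e\<in>?I i. pairprod M f z e) \<ge> real (card (?I i)) * ?v\<^sup>2 + 2 * t}" for i z
  have pB: "measure_pmf.prob ?q (Bad i z) \<le> ?bd" if "z \<in> ?O" for i z
  proof -
    have "measure_pmf.prob ?q (Bad i z) \<le> 2 * exp (- lam * t + lam\<^sup>2 * real (card (?I i)) * moment_const ?v)"
      unfolding Bad_def by (rule pairprod_tail[OF n M wide s r that v lam t a_def])
    moreover have "lam\<^sup>2 * real (card (?I i)) * moment_const ?v \<le> lam\<^sup>2 * J * moment_const ?v"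
      using cI by (intro mult_right_mono mult_left_mono moment_const_nonneg) auto
    ultimately show ?thesis by (smt (verit) exp_le_cancel_iff)
  qed
  let ?X = "{f. \<exists>x\<in>cells M. real (f x) > T}"
  let ?Q = "\<lambda>f. f \<notin> ?X \<and> (\<forall>i<Nc. \<forall>z\<in>?O. f \<notin> Bad i z)"
  have "{f. \<not> ?Q f} \<subseteq> ?X \<union> (\<Union>i\<in>{..<Nc}. \<Union>z\<in>?O. Bad i z)" by auto
  then have "measure_pmf.prob ?q {f. \<not> ?Q f} \<le> measure_pmf.prob ?q (?X \<union> (\<Union>i\<in>{..<Nc}. \<Union>z\<in>?O. Bad i z))"
    by (intro measure_pmf.finite_measure_mono) auto
  also have "\<dots> \<le> measure_pmf.prob ?q ?X + measure_pmf.prob ?q (\<Union>i\<in>{..<Nc}. \<Union>z\<in>?O. Bad i z)"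
    by (rule measure_Un_le) auto
  also have "\<dots> \<le> real M ^ CARD('d) * exp (?v * (exp u - 1) - u * T) + real Nc * D * ?bd"
  proof (rule add_mono)
    show "measure_pmf.prob ?q ?X \<le> real M ^ CARD('d) * exp (?v * (exp u - 1) - u * T)"
      using poisson_max_tail[of "cells M :: (int^'d) set", OF finite_cells v u, of T] by simp
    have "measure_pmf.prob ?q (\<Union>i\<in>{..<Nc}. \<Union>z\<in>?O. Bad i z) \<le> (\<Sum>i\<in>{..<Nc}. measure_pmf.prob ?q (\<Union>z\<in>?O. Bad i z))"
      by (rule measure_pmf.finite_measure_subadditive_finite) auto
    also have "\<dots> \<le> (\<Sum>i\<in>{..<Nc}. \<Sum>z\<in>?O. measure_pmf.prob ?q (Bad i z))"
      by (intro sum_mono measure_pmf.finite_measure_subadditive_finite finO) auto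
    also have "\<dots> \<le> (\<Sum>i\<in>{..<Nc}. \<Sum>z\<in>?O. ?bd)" by (intro sum_mono pB)
    also have "\<dots> = real Nc * real (card ?O) * ?bd" by simp
    also have "\<dots> \<le> real Nc * D * ?bd" using cO by (intro mult_right_mono mult_left_mono) auto
    finally show "measure_pmf.prob ?q (\<Union>i\<in>{..<Nc}. \<Union>z\<in>?O. Bad i z) \<le> real Nc * D * ?bd" .
  qed
  finally have bad: "measure_pmf.prob ?q {f. \<not> ?Q f} \<le> real M ^ CARD('d) * exp (?v * (exp u - 1) - u * T) + real Nc * D * ?bd" .
  let ?E = "{\<omega>. \<forall>i<Nc. real (deg_sum n r \<omega> (tcube n (B i) s)) < D * (J * ?v\<^sup>2 + 2 * t)}"
  have E: "?E \<in> sets (PPP n)"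
    using sets_deg_sum_all[of n Nc r B s] by simp
  have "measure_pmf.prob ?q {f. ?Q f} \<le> measure (PPP n) ?E"
    unfolding vn
  proof (rule PPP_prob_ge_cnt[OF n M E[unfolded vn]], unfold vn[symmetric])
    fix \<omega> :: "nat \<times> (real^'d) stream"
    assume tor: "\<And>j. snd \<omega> !! j \<in> torus n" and Q: "?Q (cnt n M \<omega>)"
    show "\<omega> \<in> ?E"
    proof (intro CollectI allI impI)
      fix i assume i: "i < Nc"
      have "(\<Sum>e\<in>?I i. pairprod M (cnt n M \<omega>) z e) < J * ?v\<^sup>2 + 2 * t" if z: "z \<in> ?O" for z
      proof -
        have "\<forall>x\<in>cells M. real (cnt n M \<omega> x) \<le> T" using Q by (auto simp: not_less)
        moreover have "cnt n M \<omega> \<notin> Bad i z" using Q i z by blast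
        ultimately have "(\<Sum>e\<in>?I i. pairprod M (cnt n M \<omega>) z e) < real (card (?I i)) * ?v\<^sup>2 + 2 * t"
          by (auto simp: Bad_def)
        moreover have "real (card (?I i)) * ?v\<^sup>2 \<le> J * ?v\<^sup>2" using cI by (intro mult_right_mono) auto
        ultimately show ?thesis by linarith
      qed
      then have "(\<Sum>z\<in>?O. \<Sum>e\<in>?I i. pairprod M (cnt n M \<omega>) z e) < (\<Sum>z\<in>?O. J * ?v\<^sup>2 + 2 * t)"
        using finO zO by (intro sum_strict_mono) auto
      also have "\<dots> = real (card ?O) * (J * ?v\<^sup>2 + 2 * t)" by simp
      also have "\<dots> \<le> D * (J * ?v\<^sup>2 + 2 * t)"
      proof (intro mult_right_mono cO)
        have "0 \<le> J" using cI[of 0] by linarith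
        then show "0 \<le> J * ?v\<^sup>2 + 2 * t" using t by simp
      qed
      finally show "real (deg_sum n r \<omega> (tcube n (B i) s)) < D * (J * ?v\<^sup>2 + 2 * t)"
        using deg_sum_le[OF n M tor, of r "B i" s] unfolding a_def[symmetric] by linarith
    qed
  qed
  moreover have "measure_pmf.prob ?q {f. \<not> ?Q f} = 1 - measure_pmf.prob ?q {f. ?Q f}" by (rule prob_pmf_not)
  ultimately show ?thesis using bad by linarith
qed

section \<open>Choice of the constants and passage to the limit\<close>

lemma moment_const_mono: "v \<le> w \<Longrightarrow> moment_const v \<le> moment_const w"
  by (simp add: moment_const_def)

theorem lemma2p3:
  fixes r :: "nat \<Rightarrow> real" and r_min r_max :: real
    and B :: "nat \<Rightarrow> nat \<Rightarrow> real^'d::finite"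
  assumes "CARD('d) \<ge> 2"
    and "r_g TYPE('d) < r_min" and "r_min \<le> r_max"
    and "\<And>n. r_min \<le> r n \<and> r n \<le> r_max"
    and "\<And>n. n \<ge> 4 \<Longrightarrow>
          torus n \<subseteq> (\<Union>i < 2 ^ CARD('d) * n. tcube n (B n i) (ln (real n) powr (2 / real CARD('d))))"
  shows "(\<lambda>n. measure (PPP n)
            {\<omega> \<in> space (PPP n). \<forall>i < 2 ^ CARD('d) * n.
               real (deg_sum n (r n) \<omega> (tcube n (B n i) (ln (real n) powr (2 / real CARD('d)))))
                 < 2 * gamma TYPE('d) * r n ^ CARD('d) * (ln (real n))\<^sup>2})
         \<longlonglongrightarrow> 1"
proof -
  let ?d = "CARD('d)"
  let ?g = "gamma TYPE('d)"
  \<comment> \<open>A uniform positive lower bound on the radii makes the relative rounding error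
    \<open>2 * a * d / r\<close> small for all \<open>n\<close> at once, and lets
    \<open>\<eta>\<close> be a constant.\<close>
  have rmin: "r_min > 0" using r_g_nonneg[OF assms(1)] assms(2) by linarith
  have rmax: "r_max > 0" using rmin assms(3) by linarith
  have g: "?g > 0" by (rule gamma_pos)
  \<comment> \<open>An upper bound for the cell side, so small that enlarging the radius by
    \<open>2 * a * d\<close> costs at most a factor 5/4.\<close>
  obtain \<delta> where \<delta>: "\<delta> > 0" "(1 + 2 * \<delta> * real ?d / r_min) ^ ?d < 5 / 4"
  proof -
    have "((\<lambda>\<delta>. (1 + 2 * \<delta> * real ?d / r_min) ^ ?d) \<longlongrightarrow> (1 + 2 * 0 * real ?d / r_min) ^ ?d) (at_right 0)"
      using rmin by (intro tendsto_intros) auto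
    then have "((\<lambda>\<delta>. (1 + 2 * \<delta> * real ?d / r_min) ^ ?d) \<longlongrightarrow> 1) (at_right 0)" by simp
    then have "eventually (\<lambda>\<delta>. (1 + 2 * \<delta> * real ?d / r_min) ^ ?d < 5 / 4) (at_right 0)"
      by (rule order_tendstoD(2)) simp
    moreover have "eventually (\<lambda>\<delta>. \<delta> > (0::real)) (at_right 0)" by (simp add: eventually_at_right_less)
    ultimately have "eventually (\<lambda>\<delta>. \<delta> > 0 \<and> (1 + 2 * \<delta> * real ?d / r_min) ^ ?d < 5 / 4) (at_right 0)"
      by eventually_elim simp
    then show thesis using that eventually_happens'[OF trivial_limit_at_right_real] by blast
  qed
  define vmin where "vmin = (\<delta> / 2) ^ ?d"
  define Dmax where "Dmax = ?g * (r_max + 2 * \<delta> * real ?d) ^ ?d / vmin"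
  \<comment> \<open>\<open>\<eta>\<close> makes \<open>Dmax * 2 * \<eta>\<close> a quarter of
    \<open>gamma * r_min^d\<close>, and \<open>C\<close> makes \<open>C * \<eta> = 2\<close>.
    \<open>E0\<close> will bound the quadratic term \<open>lam^2 * J * moment_const v\<close>, and
    \<open>K\<close> collects the coefficients of \<open>1 / n\<close> in the failure
    probability.\<close>
  define \<eta> where "\<eta> = ?g * r_min ^ ?d / (8 * Dmax)"
  define C where "C = 2 / \<eta>"
  define E0 where "E0 = C\<^sup>2 * (6 / 5) / vmin * moment_const (\<delta> ^ ?d)"
  define K where "K = 1 / vmin * exp (\<delta> ^ ?d * exp (2 * C)) + 2 ^ ?d * Dmax * (2 * exp E0)"
  have vmin: "vmin > 0" using \<delta> by (simp add: vmin_def)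
  have "r_max + 2 * \<delta> * real ?d > 0" using rmax \<delta> by (intro add_pos_nonneg) auto
  then have Dmax: "Dmax > 0" using g vmin by (simp add: Dmax_def)
  have \<eta>: "\<eta> > 0" using g rmin Dmax by (simp add: \<eta>_def)
  have C: "C > 0" using \<eta> by (simp add: C_def)
  define s where "s n = ln (real n) powr (2 / real ?d)" for n :: nat
  have s_lim: "filterlim s at_top sequentially"
  proof -
    have "2 / real ?d > 0" by simp
    then show ?thesis unfolding s_def by real_asymp
  qed
  let ?m = "\<lambda>n. measure (PPP n) {\<omega> \<in> space (PPP n). \<forall>i < 2 ^ ?d * n.
               real (deg_sum n (r n) \<omega> (tcube n (B n i) (s n))) < 2 * ?g * r n ^ ?d * (ln (real n))\<^sup>2}"
  have ev_L: "eventually (\<lambda>n. side TYPE('d) n \<ge> \<delta>) sequentially"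
    using side_tendsto[where ?'d='d] by (simp add: filterlim_at_top)
  have ev_wide: "eventually (\<lambda>n. s n + (\<delta> + r_max + \<delta> * real ?d) < side TYPE('d) n) sequentially"
  proof -
    define p where "p = 1 / real ?d"
    define c where "c = \<delta> + r_max + \<delta> * real ?d"
    have "p > 0" by (simp add: p_def)
    then have "eventually (\<lambda>n::nat. ln (real n) powr (2 * p) + c < real n powr p) sequentially" by real_asymp
    then show ?thesis by (simp add: s_def side_def p_def c_def)
  qed
  have ev_s: "eventually (\<lambda>n. (1 + 2 * \<delta> / s n) ^ ?d < 6 / 5) sequentially"
  proof -
    have "((\<lambda>n. 2 * \<delta> / s n) \<longlongrightarrow> 0) sequentially"
      by (rule tendsto_divide_0[OF tendsto_const]) (rule filterlim_at_top_imp_at_infinity[OF s_lim])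
    then have "((\<lambda>n. (1 + 2 * \<delta> / s n) ^ ?d) \<longlongrightarrow> (1 + 0) ^ ?d) sequentially" by (intro tendsto_intros)
    then have "((\<lambda>n. (1 + 2 * \<delta> / s n) ^ ?d) \<longlongrightarrow> 1) sequentially" by simp
    then show ?thesis by (rule order_tendstoD(2)) simp
  qed
  have lower: "eventually (\<lambda>n. ?m n \<ge> 1 - K / real n) sequentially"
    using ev_L ev_wide ev_s eventually_ge_at_top[of 3]
  proof eventually_elim
    case (elim n)
    have n: "n > 0" "n \<ge> 3" using elim by auto
    have ln: "ln (real n) > 0" using n by simp
    define L where "L = side TYPE('d) n"
    \<comment> \<open>The number of cells across the torus is an integer, so the cell side varies
      with \<open>n\<close>. Rounding up gives \<open>a \<le> \<delta>\<close>, and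
      \<open>L / \<delta> \<ge> 1\<close> gives \<open>a \<ge> \<delta> / 2\<close>; hence the bound
      \<open>vmin\<close> for the cell volume.\<close>
    define M where "M = nat \<lceil>L / \<delta>\<rceil>"
    define a where "a = L / real M"
    have Lpos: "L > 0" using n by (simp add: L_def side_pos)
    have L1: "L / \<delta> \<ge> 1" using elim(1) \<delta> by (simp add: L_def)
    have M: "M > 0" "L / \<delta> \<le> real M" "real M \<le> 2 * (L / \<delta>)" using L1 unfolding M_def by linarith+
    have a: "\<delta> / 2 \<le> a" "a \<le> \<delta>" using M \<delta> by (simp_all add: a_def field_simps)
    have apos: "a > 0" using a \<delta> by linarith
    have spos: "s n > 0" using ln by (simp add: s_def)
    have sd: "s n ^ ?d = (ln (real n))\<^sup>2"
      using ln by (simp add: s_def powr_powr powr_realpow[symmetric] flip: powr_numeral)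
    have rn: "r_min \<le> r n" "r n \<le> r_max" "r n > 0" using assms(4)[of n] rmin by auto
    define v where "v = a ^ ?d"
    have v: "vmin \<le> v" "v \<le> \<delta> ^ ?d" unfolding v_def vmin_def using a \<delta> apos by (auto intro!: power_mono)
    have vpos: "v > 0" using v vmin by linarith
    define lam where "lam = C / ln (real n)"
    define T where "T = ln (real n) / C"
    define t where "t = \<eta> * (ln (real n))\<^sup>2"
    define D where "D = ?g * (r n + 2 * a * real ?d) ^ ?d / v"
    define J where "J = (s n / a + 2) ^ ?d"
    have wide: "s n + a + r n + a * real ?d < L"
    proof -
      have "a * real ?d \<le> \<delta> * real ?d" using a by (intro mult_right_mono) auto
      then show ?thesis using elim(2) a rn unfolding L_def by linarith
    qed
    have D0: "0 \<le> D" using g rn apos vpos by (simp add: D_def)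
    have Dle: "D \<le> Dmax"
    proof -
      have "a * real ?d \<le> \<delta> * real ?d" using a by (intro mult_right_mono) auto
      then have "(r n + 2 * a * real ?d) ^ ?d \<le> (r_max + 2 * \<delta> * real ?d) ^ ?d"
        using rn apos by (intro power_mono add_mono) auto
      then have "?g * (r n + 2 * a * real ?d) ^ ?d \<le> ?g * (r_max + 2 * \<delta> * real ?d) ^ ?d"
        using g by (intro mult_left_mono) auto
      then show ?thesis unfolding D_def Dmax_def using v vmin g rn apos \<delta>(1) rmax by (intro frac_le) auto
    qed
    have s2: "(s n + 2 * a) ^ ?d \<le> 6 / 5 * (ln (real n))\<^sup>2"
    proof -
      have "2 * a / s n \<le> 2 * \<delta> / s n" using a spos by (intro divide_right_mono) auto
      then have "(1 + 2 * a / s n) ^ ?d \<le> (1 + 2 * \<delta> / s n) ^ ?d" using apos spos by (intro power_mono) auto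
      then have "(1 + 2 * a / s n) ^ ?d \<le> 6 / 5" using elim(3) by linarith
      then have "(1 + 2 * a / s n) ^ ?d * s n ^ ?d \<le> 6 / 5 * s n ^ ?d" using spos by (intro mult_right_mono) auto
      moreover have "s n + 2 * a = (1 + 2 * a / s n) * s n" using spos by (simp add: field_simps)
      then have "(s n + 2 * a) ^ ?d = (1 + 2 * a / s n) ^ ?d * s n ^ ?d" by (simp only: power_mult_distrib)
      ultimately show ?thesis using sd by linarith
    qed
    have r2: "(r n + 2 * a * real ?d) ^ ?d \<le> 5 / 4 * r n ^ ?d"
    proof -
      have "2 * a * real ?d \<le> 2 * \<delta> * real ?d" using a by (intro mult_right_mono) auto
      then have "2 * a * real ?d / r n \<le> 2 * \<delta> * real ?d / r_min" using rn rmin \<delta> by (intro frac_le) auto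
      then have "(1 + 2 * a * real ?d / r n) ^ ?d \<le> (1 + 2 * \<delta> * real ?d / r_min) ^ ?d"
        using apos rn by (intro power_mono) auto
      then have "(1 + 2 * a * real ?d / r n) ^ ?d \<le> 5 / 4" using \<delta>(2) by linarith
      then have "(1 + 2 * a * real ?d / r n) ^ ?d * r n ^ ?d \<le> 5 / 4 * r n ^ ?d" using rn by (intro mult_right_mono) auto
      moreover have "r n + 2 * a * real ?d = (1 + 2 * a * real ?d / r n) * r n" using rn by (simp add: field_simps)
      then have "(r n + 2 * a * real ?d) ^ ?d = (1 + 2 * a * real ?d / r n) ^ ?d * r n ^ ?d" by (simp only: power_mult_distrib)
      ultimately show ?thesis by linarith
    qed
    \<comment> \<open>The volume of the cube with its side enlarged by two cell sides: the main term
      \<open>D * J * v^2\<close> depends on the cell size only through rounding errors.\<close>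
    have Ja: "J * v = (s n + 2 * a) ^ ?d"
    proof -
      have "(s n / a + 2) * a = s n + 2 * a" using apos by (simp add: field_simps)
      then show ?thesis unfolding J_def v_def power_mult_distrib[symmetric] by simp
    qed
    have target: "D * (J * v\<^sup>2 + 2 * t) \<le> 2 * ?g * r n ^ ?d * (ln (real n))\<^sup>2"
    proof -
      have "D * (J * v\<^sup>2) = ?g * (r n + 2 * a * real ?d) ^ ?d * (J * v)"
        unfolding D_def using vpos by (simp add: power2_eq_square)
      also have "\<dots> \<le> ?g * (5 / 4 * r n ^ ?d) * (6 / 5 * (ln (real n))\<^sup>2)"
        unfolding Ja using r2 s2 g rn spos apos by (intro mult_mono mult_nonneg_nonneg zero_le_power) auto
      also have "\<dots> = 3 / 2 * (?g * r n ^ ?d * (ln (real n))\<^sup>2)" by simp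
      finally have 1: "D * (J * v\<^sup>2) \<le> 3 / 2 * (?g * r n ^ ?d * (ln (real n))\<^sup>2)" .
      have "D * (2 * t) \<le> Dmax * (2 * t)" using Dle \<eta> by (intro mult_right_mono) (auto simp: t_def)
      also have "\<dots> = 1 / 4 * (?g * r_min ^ ?d * (ln (real n))\<^sup>2)"
        using Dmax by (simp add: t_def \<eta>_def)
      also have "\<dots> \<le> 1 / 4 * (?g * r n ^ ?d * (ln (real n))\<^sup>2)"
        using rn rmin g by (intro mult_left_mono mult_right_mono power_mono) auto
      finally have "D * (2 * t) \<le> 1 / 4 * (?g * r n ^ ?d * (ln (real n))\<^sup>2)" .
      moreover have "0 \<le> ?g * r n ^ ?d * (ln (real n))\<^sup>2" using g rn by simp
      ultimately show ?thesis using 1 by (simp add: distrib_left)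
    qed
    \<comment> \<open>The choice \<open>u = 2 * C\<close> turns \<open>exp (- u * T)\<close> into
      \<open>n^(-2)\<close>, enough for a union over the \<open>n / v\<close> cells.\<close>
    have bound: "measure (PPP n) {\<omega>. \<forall>i<2 ^ ?d * n. real (deg_sum n (r n) \<omega> (tcube n (B n i) (s n))) < D * (J * v\<^sup>2 + 2 * t)}
      \<ge> 1 - (real M ^ ?d * exp (v * (exp (2 * C) - 1) - 2 * C * T)
        + real (2 ^ ?d * n) * D * (2 * exp (- lam * t + lam\<^sup>2 * J * moment_const v)))"
      unfolding v_def
      by (rule deg_sum_prob[OF n(1) M(1) _ wide[unfolded L_def]])
        (use spos rn C ln \<eta> in \<open>auto simp: a_def L_def lam_def T_def t_def D_def J_def v_def\<close>)
    have en: "exp (- 2 * ln (real n)) = 1 / (real n)\<^sup>2"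
      using n ln_powr[of "real n" "-2"] by (simp add: exp_minus exp_of_nat_mult[of 2, simplified] inverse_eq_divide flip: exp_of_nat_mult)
    have t1: "real M ^ ?d * exp (v * (exp (2 * C) - 1) - 2 * C * T) \<le> 1 / vmin * exp (\<delta> ^ ?d * exp (2 * C)) / real n"
    proof -
      have Md: "real M ^ ?d = real n / v"
        using side_power[OF n(1), where ?'d='d] M n by (simp add: v_def a_def L_def power_divide)
      have "v * (exp (2 * C) - 1) \<le> v * exp (2 * C)" using vpos by (intro mult_left_mono) auto
      also have "\<dots> \<le> \<delta> ^ ?d * exp (2 * C)" using v by (intro mult_right_mono) auto
      finally have "exp (v * (exp (2 * C) - 1) - 2 * C * T) \<le> exp (\<delta> ^ ?d * exp (2 * C) + - 2 * ln (real n))"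
        using C by (simp add: T_def)
      also have "\<dots> = exp (\<delta> ^ ?d * exp (2 * C)) / (real n)\<^sup>2" unfolding exp_add en by simp
      finally have "real M ^ ?d * exp (v * (exp (2 * C) - 1) - 2 * C * T) \<le> (real n / vmin) * (exp (\<delta> ^ ?d * exp (2 * C)) / (real n)\<^sup>2)"
        unfolding Md using v vmin by (intro mult_mono divide_left_mono) auto
      also have "\<dots> = 1 / vmin * exp (\<delta> ^ ?d * exp (2 * C)) / real n" using n by (simp add: power2_eq_square)
      finally show ?thesis .
    qed
    \<comment> \<open>\<open>J\<close> is of order \<open>(log n)^2\<close> and \<open>lam^2\<close>
      of the inverse order, so the quadratic term stays below \<open>E0\<close>; the factor
      \<open>n^(-2)\<close> supplied by \<open>lam * t\<close> beats the \<open>2^d * n\<close>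
      cubes.\<close>
    have t2: "real (2 ^ ?d * n) * D * (2 * exp (- lam * t + lam\<^sup>2 * J * moment_const v)) \<le> 2 ^ ?d * Dmax * (2 * exp E0) / real n"
    proof -
      have lt: "- lam * t = - 2 * ln (real n)" using ln \<eta> by (simp add: lam_def t_def C_def power2_eq_square)
      have "J = (s n + 2 * a) ^ ?d / v" using Ja vpos by (simp add: field_simps)
      also have "\<dots> \<le> 6 / 5 * (ln (real n))\<^sup>2 / vmin" using s2 v vmin spos apos by (intro frac_le) auto
      finally have "lam\<^sup>2 * J \<le> lam\<^sup>2 * (6 / 5 * (ln (real n))\<^sup>2 / vmin)" by (intro mult_left_mono) auto
      also have "\<dots> = C\<^sup>2 * (6 / 5) / vmin" using ln by (simp add: lam_def power_divide)
      finally have "lam\<^sup>2 * J * moment_const v \<le> E0"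
        unfolding E0_def using v vmin by (intro mult_mono moment_const_mono moment_const_nonneg) auto
      then have "exp (- lam * t + lam\<^sup>2 * J * moment_const v) \<le> exp (E0 + - 2 * ln (real n))" unfolding lt by simp
      also have "\<dots> = exp E0 / (real n)\<^sup>2" unfolding exp_add en by simp
      finally have "real (2 ^ ?d * n) * D * (2 * exp (- lam * t + lam\<^sup>2 * J * moment_const v)) \<le> real (2 ^ ?d * n) * Dmax * (2 * (exp E0 / (real n)\<^sup>2))"
        using Dle D0 Dmax by (intro mult_mono) auto
      also have "\<dots> = 2 ^ ?d * Dmax * (2 * exp E0) / real n" using n by (simp add: power2_eq_square)
      finally show ?thesis .
    qed
    have "1 - K / real n \<le> measure (PPP n) {\<omega>. \<forall>i<2 ^ ?d * n. real (deg_sum n (r n) \<omega> (tcube n (B n i) (s n))) < D * (J * v\<^sup>2 + 2 * t)}"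
      using bound t1 t2 by (simp add: K_def add_divide_distrib)
    also have "\<dots> \<le> ?m n"
    proof -
      interpret prob_space "PPP n :: (nat \<times> (real^'d) stream) measure" using n(1) by (rule prob_space_PPP)
      show ?thesis
      proof (rule finite_measure_mono)
        show "{\<omega>. \<forall>i<2 ^ ?d * n. real (deg_sum n (r n) \<omega> (tcube n (B n i) (s n))) < D * (J * v\<^sup>2 + 2 * t)}
          \<subseteq> {\<omega> \<in> space (PPP n). \<forall>i < 2 ^ ?d * n. real (deg_sum n (r n) \<omega> (tcube n (B n i) (s n))) < 2 * ?g * r n ^ ?d * (ln (real n))\<^sup>2}"
          using target by fastforce
        show "{\<omega> \<in> space (PPP n). \<forall>i < 2 ^ ?d * n. real (deg_sum n (r n) \<omega> (tcube n (B n i) (s n))) < 2 * ?g * r n ^ ?d * (ln (real n))\<^sup>2} \<in> sets (PPP n)"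
          by (rule sets_deg_sum_all)
      qed
    qed
    finally show ?case .
  qed
  have "?m \<longlonglongrightarrow> 1"
  proof (rule tendsto_sandwich[OF lower])
    show "eventually (\<lambda>n. ?m n \<le> 1) sequentially"
      using eventually_gt_at_top[of 0] by eventually_elim (use prob_space.prob_le_1[OF prob_space_PPP] in blast)
    show "(\<lambda>n. 1 - K / real n) \<longlonglongrightarrow> 1" by real_asymp
    show "(\<lambda>n::nat. 1::real) \<longlonglongrightarrow> 1" by simp
  qed
  then show ?thesis unfolding s_def .
qed

end
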